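(* Let $D$ be a (finite-dimensional) division algebra with center a field $K$, with an involution $\sigma$. Let $k=K^{\sigma}=\{x\in K\mid \sigma(x)=x\}$, suppose $\operatorname{char} k\neq 2$, and let $d=\deg(D)$. Suppose that $k$ is an $\mathscr A_i(2)$-field and that $D$ satisfies Springer's property. (i) If $\sigma$ is of the first kind, then $u^+(D)\le \left(1+\frac1d\right)2^{i-1}$ and $u^-(D)\le\left(1-\frac1d\right)2^{i-1}$. (ii) If $\sigma$ is of the second kind, then $u^0(D/k)\le 2^{i-1}$.
   Context: Hermitian $u$-invariants. Let $A$ be a central simple algebra over a field $K$ with an involution $\sigma$, $k=K^\sigma$, $\operatorname{char}k\ne2$, $\varepsilon\in\{1,-1\}$. An $\varepsilon$-hermitian space over $(A,\sigma)$ is a finitely generated right $A$-module $V$ with a bi-additive map $h:V\times V\to A$ such that $h(xa,yb)=\sigma(a)h(x,y)b$, $h(y,x)=\varepsilon\sigma(h(x,y))$, and such that $h(x,y)=0$ for all $x$ implies $y=0$. It is isotropic if $h(x,x)=0$ for some $x\ne0$, otherwise anisotropic. Its rank is $\dim_K(V)/(\deg(A)\operatorname{ind}(A))$ (for a division algebra: the dimension of $V$). Define $u(A,\sigma,\varepsilon)$ as the supremum of the ranks of anisotropic $\varepsilon$-hermitian spaces over $(A,\sigma)$. The involution $\sigma$ is of the first kind (orthogonal or symplectic) if $\sigma|_K=\mathrm{id}$, and of the second kind (unitary $K/k$-involution) if $[K:k]=2$. It is known that $u(A,\sigma,\varepsilon)$ depends only on the following data, so one defines: $u^+(A)=u(A,\sigma,\varepsilon)$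 if $\varepsilon=1$ and $\sigma$ is orthogonal, or $\varepsilon=-1$ and $\sigma$ is symplectic; $u^-(A)=u(A,\sigma,\varepsilon)$ if $\varepsilon=-1$ and $\sigma$ is orthogonal, or $\varepsilon=1$ and $\sigma$ is symplectic; $u^0(A/k)=u(A,\sigma,\varepsilon)$ if $\sigma$ is a unitary $K/k$-involution (either $\varepsilon$). A field $k$ is an $\mathscr A_i(m)$-field if for every $r$, every system of $r$ homogeneous forms of degree $m$ over $k$ in more than $rm^i$ variables has a nontrivial simultaneous zero over some finite field extension $L/k$ with $\gcd(m,[L:k])=1$. Springer's property for $D$: for every $\varepsilon\in\{1,-1\}$, every finite field extension $L/k$ of odd degree and every anisotropic $\varepsilon$-hermitian space $h$ over $(D,\sigma)$, the scalar extension $h_L$ is anisotropic over $(D\otimes_kL,\sigma\otimes\mathrm{id}_L)$. *)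

theory Defs
  imports
    "HOL-Algebra.Free_Abelian_Groups"
    "HOL-Algebra.Generated_Groups"
    "HOL-Algebra.Embedded_Algebras"
    "HOL-Algebra.QuotRing"
    "HOL-Library.Extended_Nat"
    "HOL-Library.Extended_Real"
begin

section \<open>Division algebras with involution\<close>

definition ring_center :: "('d, 'm) ring_scheme \<Rightarrow> 'd set" where
  "ring_center D = {x \<in> carrier D. \<forall>y\<in>carrier D. x \<otimes>\<^bsub>D\<^esub> y = y \<otimes>\<^bsub>D\<^esub> x}"

text \<open>A finite-dimensional division algebra of degree \<open>d\<close> over its center, the degree being
  the square root of the dimension over the center.\<close>

definition division_algebra :: "('d, 'm) ring_scheme \<Rightarrow> nat \<Rightarrow> bool" where
  "division_algebra D d \<longleftrightarrow>
     ring D \<and> Units D = carrier D - {\<zero>\<^bsub>D\<^esub>} \<and>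
     ring.dimension D (d ^ 2) (ring_center D) (carrier D)"

locale involution = ring D for D (structure) and \<sigma> +
  assumes inv_closed: "x \<in> carrier D \<Longrightarrow> \<sigma> x \<in> carrier D"
    and inv_add: "\<lbrakk>x \<in> carrier D; y \<in> carrier D\<rbrakk> \<Longrightarrow> \<sigma> (x \<oplus> y) = \<sigma> x \<oplus> \<sigma> y"
    and inv_mult: "\<lbrakk>x \<in> carrier D; y \<in> carrier D\<rbrakk> \<Longrightarrow> \<sigma> (x \<otimes> y) = \<sigma> y \<otimes> \<sigma> x"
    and inv_inv: "x \<in> carrier D \<Longrightarrow> \<sigma> (\<sigma> x) = x"

text \<open>With \<open>K\<close> the center, \<open>center_field D\<close> is \<open>K\<close> and \<open>fixed_field D \<sigma>\<close> is
  \<open>k = {x \<in> K. \<sigma> x = x}\<close>, both with the operations of \<open>D\<close>.\<close>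

definition center_field :: "('d, 'm) ring_scheme \<Rightarrow> ('d, 'm) ring_scheme" where
  "center_field D = D\<lparr>carrier := ring_center D\<rparr>"

definition fixed_field :: "('d, 'm) ring_scheme \<Rightarrow> ('d \<Rightarrow> 'd) \<Rightarrow> ('d, 'm) ring_scheme" where
  "fixed_field D \<sigma> = D\<lparr>carrier := {x \<in> ring_center D. \<sigma> x = x}\<rparr>"

definition first_kind :: "('d, 'm) ring_scheme \<Rightarrow> ('d \<Rightarrow> 'd) \<Rightarrow> bool" where
  "first_kind D \<sigma> \<longleftrightarrow> (\<forall>x\<in>ring_center D. \<sigma> x = x)"

definition second_kind :: "('d, 'm) ring_scheme \<Rightarrow> ('d \<Rightarrow> 'd) \<Rightarrow> bool" where
  "second_kind D \<sigma> \<longleftrightarrow> ring.dimension D 2 (carrier (fixed_field D \<sigma>)) (ring_center D)"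

section \<open>Hermitian spaces\<close>

text \<open>A right module is stored in the record \<^typ>\<open>('d, 'v) module\<close>, where
  \<open>a \<odot>\<^bsub>V\<^esub> v\<close> stands for \<open>v a\<close>; this is why the scalars are reversed in \<open>rsmult_assoc\<close>.
  (The multiplicative fields of that record are not used.)\<close>

locale right_module = D?: ring D + V?: abelian_group V
  for D :: "('d, 'm) ring_scheme" (structure) and V :: "('d, 'v) module" (structure) +
  assumes rsmult_closed: "\<lbrakk>a \<in> carrier D; x \<in> carrier V\<rbrakk> \<Longrightarrow> a \<odot>\<^bsub>V\<^esub> x \<in> carrier V"
    and rsmult_distr_scalar: "\<lbrakk>a \<in> carrier D; b \<in> carrier D; x \<in> carrier V\<rbrakk> \<Longrightarrow>
          (a \<oplus>\<^bsub>D\<^esub> b) \<odot>\<^bsub>V\<^esub> x = a \<odot>\<^bsub>V\<^esub> x \<oplus>\<^bsub>V\<^esub> b \<odot>\<^bsub>V\<^esub> x"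
    and rsmult_distr_vector: "\<lbrakk>a \<in> carrier D; x \<in> carrier V; y \<in> carrier V\<rbrakk> \<Longrightarrow>
          a \<odot>\<^bsub>V\<^esub> (x \<oplus>\<^bsub>V\<^esub> y) = a \<odot>\<^bsub>V\<^esub> x \<oplus>\<^bsub>V\<^esub> a \<odot>\<^bsub>V\<^esub> y"
    and rsmult_assoc: "\<lbrakk>a \<in> carrier D; b \<in> carrier D; x \<in> carrier V\<rbrakk> \<Longrightarrow>
          (a \<otimes>\<^bsub>D\<^esub> b) \<odot>\<^bsub>V\<^esub> x = b \<odot>\<^bsub>V\<^esub> (a \<odot>\<^bsub>V\<^esub> x)"
    and rsmult_one: "x \<in> carrier V \<Longrightarrow> \<one>\<^bsub>D\<^esub> \<odot>\<^bsub>V\<^esub> x = x"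

definition finitely_generated :: "('d, 'm) ring_scheme \<Rightarrow> ('d, 'v) module \<Rightarrow> bool" where
  "finitely_generated D V \<longleftrightarrow>
     (\<exists>S. finite S \<and> S \<subseteq> carrier V \<and>
        (\<forall>v\<in>carrier V. \<exists>f \<in> S \<rightarrow> carrier D. v = (\<Oplus>\<^bsub>V\<^esub>s\<in>S. f s \<odot>\<^bsub>V\<^esub> s)))"

definition right_basis :: "('d, 'm) ring_scheme \<Rightarrow> ('d, 'v) module \<Rightarrow> 'v set \<Rightarrow> bool" where
  "right_basis D V B \<longleftrightarrow>
     B \<subseteq> carrier V \<and>
     (\<forall>v\<in>carrier V. \<exists>!f. f \<in> B \<rightarrow>\<^sub>E carrier D \<and> v = (\<Oplus>\<^bsub>V\<^esub>b\<in>B. f b \<odot>\<^bsub>V\<^esub> b))"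

definition right_dimension :: "('d, 'm) ring_scheme \<Rightarrow> ('d, 'v) module \<Rightarrow> nat \<Rightarrow> bool" where
  "right_dimension D V n \<longleftrightarrow> (\<exists>B. finite B \<and> right_basis D V B \<and> card B = n)"

locale hermitian_space = involution D \<sigma> + right_module D V
  for D :: "('d, 'm) ring_scheme" (structure) and \<sigma> and \<epsilon> :: 'd
    and V :: "('d, 'v) module" and h :: "'v \<Rightarrow> 'v \<Rightarrow> 'd" +
  assumes eps: "\<epsilon> \<in> {\<one>\<^bsub>D\<^esub>, \<ominus>\<^bsub>D\<^esub> \<one>\<^bsub>D\<^esub>}"
    and fin_gen: "finitely_generated D V"
    and form_closed: "\<lbrakk>x \<in> carrier V; y \<in> carrier V\<rbrakk> \<Longrightarrow> h x y \<in> carrier D"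
    and form_add_left: "\<lbrakk>x \<in> carrier V; x' \<in> carrier V; y \<in> carrier V\<rbrakk> \<Longrightarrow>
          h (x \<oplus>\<^bsub>V\<^esub> x') y = h x y \<oplus>\<^bsub>D\<^esub> h x' y"
    and form_add_right: "\<lbrakk>x \<in> carrier V; y \<in> carrier V; y' \<in> carrier V\<rbrakk> \<Longrightarrow>
          h x (y \<oplus>\<^bsub>V\<^esub> y') = h x y \<oplus>\<^bsub>D\<^esub> h x y'"
    and form_sesquilinear:
          "\<lbrakk>x \<in> carrier V; y \<in> carrier V; a \<in> carrier D; b \<in> carrier D\<rbrakk> \<Longrightarrow>
          h (a \<odot>\<^bsub>V\<^esub> x) (b \<odot>\<^bsub>V\<^esub> y) = \<sigma> a \<otimes>\<^bsub>D\<^esub> h x y \<otimes>\<^bsub>D\<^esub> b"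
    and form_hermitian: "\<lbrakk>x \<in> carrier V; y \<in> carrier V\<rbrakk> \<Longrightarrow>
          h y x = \<epsilon> \<otimes>\<^bsub>D\<^esub> \<sigma> (h x y)"
    and form_nondegenerate:
          "\<lbrakk>y \<in> carrier V; \<And>x. x \<in> carrier V \<Longrightarrow> h x y = \<zero>\<^bsub>D\<^esub>\<rbrakk> \<Longrightarrow> y = \<zero>\<^bsub>V\<^esub>"

text \<open>Anisotropy is stated for a form on \<open>V\<close> with values in an arbitrary ring \<open>A\<close>, so
  that it also applies to scalar extensions.\<close>

definition anisotropic ::
  "('a, 'm) ring_scheme \<Rightarrow> ('b, 'v) module \<Rightarrow> ('v \<Rightarrow> 'v \<Rightarrow> 'a) \<Rightarrow> bool" where
  "anisotropic A V h \<longleftrightarrow> (\<forall>x\<in>carrier V. h x x = \<zero>\<^bsub>A\<^esub> \<longrightarrow> x = \<zero>\<^bsub>V\<^esub>)"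

text \<open>The carriers of the spaces range over subsets of \<^typ>\<open>'d list\<close>. Every finitely generated
  right module over a division ring \<open>D\<close> is isomorphic to one of these (coordinate lists with
  respect to a basis), so the supremum is over all anisotropic spaces.\<close>

definition u_inv :: "('d, 'm) ring_scheme \<Rightarrow> ('d \<Rightarrow> 'd) \<Rightarrow> 'd \<Rightarrow> enat" where
  "u_inv D \<sigma> \<epsilon> =
     Sup {enat n | n. \<exists>(V :: ('d, 'd list) module) h.
            hermitian_space D \<sigma> \<epsilon> V h \<and> anisotropic D V h \<and> right_dimension D V n}"

section \<open>Field extensions and scalar extension\<close>

text \<open>A field extension \<open>L/F\<close> is given by an embedding \<open>\<phi>\<close> of \<open>F\<close> into \<open>L\<close>.\<close>

definition field_extension ::
  "('f, 'm) ring_scheme \<Rightarrow> ('l, 'n) ring_scheme \<Rightarrow> ('f \<Rightarrow> 'l) \<Rightarrow> bool" where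
  "field_extension F L \<phi> \<longleftrightarrow> field F \<and> field L \<and> \<phi> \<in> ring_hom F L"

definition finite_extension ::
  "('f, 'm) ring_scheme \<Rightarrow> ('l, 'n) ring_scheme \<Rightarrow> ('f \<Rightarrow> 'l) \<Rightarrow> nat \<Rightarrow> bool" where
  "finite_extension F L \<phi> e \<longleftrightarrow>
     field_extension F L \<phi> \<and> ring.dimension L e (\<phi> ` carrier F) (carrier L)"

text \<open>The tensor product \<open>M \<otimes>\<^sub>F L\<close> of an \<open>F\<close>-vector space \<open>M\<close>, with scalar multiplication
  \<open>s\<close>, and an extension \<open>L/F\<close>: the free abelian group on \<open>M \<times> L\<close> modulo the usual relations.
  In \<open>tensor_group\<close>, which is written multiplicatively in the library, the operation is the
  addition of \<open>M \<otimes>\<^sub>F L\<close>.\<close>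

definition tensor_relations ::
  "('f, 'p) ring_scheme \<Rightarrow> ('l, 'n) ring_scheme \<Rightarrow> ('f \<Rightarrow> 'l) \<Rightarrow> ('m, 'q) ring_scheme \<Rightarrow>
   ('f \<Rightarrow> 'm \<Rightarrow> 'm) \<Rightarrow> (('m \<times> 'l) \<Rightarrow>\<^sub>0 int) set" where
  "tensor_relations F L \<phi> M s =
     {frag_of (x \<oplus>\<^bsub>M\<^esub> x', l) - frag_of (x, l) - frag_of (x', l) | x x' l.
        x \<in> carrier M \<and> x' \<in> carrier M \<and> l \<in> carrier L} \<union>
     {frag_of (x, l \<oplus>\<^bsub>L\<^esub> l') - frag_of (x, l) - frag_of (x, l') | x l l'.
        x \<in> carrier M \<and> l \<in> carrier L \<and> l' \<in> carrier L} \<union>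
     {frag_of (s c x, l) - frag_of (x, \<phi> c \<otimes>\<^bsub>L\<^esub> l) | c x l.
        c \<in> carrier F \<and> x \<in> carrier M \<and> l \<in> carrier L}"

definition tensor_subgroup ::
  "('f, 'p) ring_scheme \<Rightarrow> ('l, 'n) ring_scheme \<Rightarrow> ('f \<Rightarrow> 'l) \<Rightarrow> ('m, 'q) ring_scheme \<Rightarrow>
   ('f \<Rightarrow> 'm \<Rightarrow> 'm) \<Rightarrow> (('m \<times> 'l) \<Rightarrow>\<^sub>0 int) set" where
  "tensor_subgroup F L \<phi> M s =
     generate (free_Abelian_group (carrier M \<times> carrier L)) (tensor_relations F L \<phi> M s)"

definition tensor_group ::
  "('f, 'p) ring_scheme \<Rightarrow> ('l, 'n) ring_scheme \<Rightarrow> ('f \<Rightarrow> 'l) \<Rightarrow> ('m, 'q) ring_scheme \<Rightarrow>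
   ('f \<Rightarrow> 'm \<Rightarrow> 'm) \<Rightarrow> (('m \<times> 'l) \<Rightarrow>\<^sub>0 int) set monoid" where
  "tensor_group F L \<phi> M s =
     free_Abelian_group (carrier M \<times> carrier L) Mod tensor_subgroup F L \<phi> M s"

definition tensor_class ::
  "('f, 'p) ring_scheme \<Rightarrow> ('l, 'n) ring_scheme \<Rightarrow> ('f \<Rightarrow> 'l) \<Rightarrow> ('m, 'q) ring_scheme \<Rightarrow>
   ('f \<Rightarrow> 'm \<Rightarrow> 'm) \<Rightarrow> (('m \<times> 'l) \<Rightarrow>\<^sub>0 int) \<Rightarrow> (('m \<times> 'l) \<Rightarrow>\<^sub>0 int) set" where
  "tensor_class F L \<phi> M s p =
     tensor_subgroup F L \<phi> M s #>\<^bsub>free_Abelian_group (carrier M \<times> carrier L)\<^esub> p"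

text \<open>\<open>tensor_map\<close> is \<open>f \<otimes> id\<^sub>L\<close>, and \<open>tensor_map2\<close> is
  \<open>(x \<otimes> l, y \<otimes> l') \<mapsto> f x y \<otimes> l l'\<close>, both extended additively; they are applied to cosets
  \<open>X\<close>, \<open>Y\<close>, and \<open>cls\<close> is the projection onto the target tensor product. For \<open>f\<close> that is
  \<open>F\<close>-linear resp. \<open>F\<close>-bilinear all the cosets in the union coincide.\<close>

definition tensor_map ::
  "((('c \<times> 'l) \<Rightarrow>\<^sub>0 int) \<Rightarrow> (('c \<times> 'l) \<Rightarrow>\<^sub>0 int) set) \<Rightarrow> ('a \<Rightarrow> 'c) \<Rightarrow>
   (('a \<times> 'l) \<Rightarrow>\<^sub>0 int) set \<Rightarrow> (('c \<times> 'l) \<Rightarrow>\<^sub>0 int) set" where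
  "tensor_map cls f X = (\<Union>p\<in>X. cls (frag_extend (\<lambda>(x, l). frag_of (f x, l)) p))"

definition tensor_map2 ::
  "((('c \<times> 'l) \<Rightarrow>\<^sub>0 int) \<Rightarrow> (('c \<times> 'l) \<Rightarrow>\<^sub>0 int) set) \<Rightarrow> ('l, 'n) ring_scheme \<Rightarrow>
   ('a \<Rightarrow> 'b \<Rightarrow> 'c) \<Rightarrow>
   (('a \<times> 'l) \<Rightarrow>\<^sub>0 int) set \<Rightarrow> (('b \<times> 'l) \<Rightarrow>\<^sub>0 int) set \<Rightarrow> (('c \<times> 'l) \<Rightarrow>\<^sub>0 int) set" where
  "tensor_map2 cls L f X Y =
     (\<Union>p\<in>X. \<Union>q\<in>Y. cls
        (frag_extend (\<lambda>(x, l). frag_extend (\<lambda>(y, l'). frag_of (f x y, l \<otimes>\<^bsub>L\<^esub> l')) q) p))"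

text \<open>The algebra \<open>D \<otimes>\<^sub>F L\<close> and, for a right \<open>D\<close>-module \<open>V\<close>, the right
  \<open>D \<otimes>\<^sub>F L\<close>-module \<open>V \<otimes>\<^sub>F L\<close>, where \<open>F\<close> is a field contained in the center of \<open>D\<close>.\<close>

abbreviation algebra_class ::
  "('d, 'p) ring_scheme \<Rightarrow> ('l, 'n) ring_scheme \<Rightarrow> ('d \<Rightarrow> 'l) \<Rightarrow> ('d, 'q) ring_scheme \<Rightarrow>
   (('d \<times> 'l) \<Rightarrow>\<^sub>0 int) \<Rightarrow> (('d \<times> 'l) \<Rightarrow>\<^sub>0 int) set" where
  "algebra_class F L \<phi> D \<equiv> tensor_class F L \<phi> D (mult D)"

definition ext_algebra ::
  "('d, 'p) ring_scheme \<Rightarrow> ('l, 'n) ring_scheme \<Rightarrow> ('d \<Rightarrow> 'l) \<Rightarrow> ('d, 'q) ring_scheme \<Rightarrow>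
   (('d \<times> 'l) \<Rightarrow>\<^sub>0 int) set ring" where
  "ext_algebra F L \<phi> D =
     \<lparr>carrier = carrier (tensor_group F L \<phi> D (mult D)),
      monoid.mult = tensor_map2 (algebra_class F L \<phi> D) L (mult D),
      one = algebra_class F L \<phi> D (frag_of (\<one>\<^bsub>D\<^esub>, \<one>\<^bsub>L\<^esub>)),
      zero = \<one>\<^bsub>tensor_group F L \<phi> D (mult D)\<^esub>,
      add = mult (tensor_group F L \<phi> D (mult D))\<rparr>"

definition ext_module ::
  "('d, 'p) ring_scheme \<Rightarrow> ('l, 'n) ring_scheme \<Rightarrow> ('d \<Rightarrow> 'l) \<Rightarrow> ('d, 'v) module \<Rightarrow>
   ((('d \<times> 'l) \<Rightarrow>\<^sub>0 int) set, (('v \<times> 'l) \<Rightarrow>\<^sub>0 int) set) module" where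
  "ext_module F L \<phi> V =
     \<lparr>carrier = carrier (tensor_group F L \<phi> V (smult V)),
      monoid.mult = undefined,
      one = undefined,
      zero = \<one>\<^bsub>tensor_group F L \<phi> V (smult V)\<^esub>,
      add = mult (tensor_group F L \<phi> V (smult V)),
      smult = tensor_map2 (tensor_class F L \<phi> V (smult V)) L (smult V)\<rparr>"

definition ext_involution ::
  "('d, 'p) ring_scheme \<Rightarrow> ('l, 'n) ring_scheme \<Rightarrow> ('d \<Rightarrow> 'l) \<Rightarrow> ('d, 'q) ring_scheme \<Rightarrow>
   ('d \<Rightarrow> 'd) \<Rightarrow> (('d \<times> 'l) \<Rightarrow>\<^sub>0 int) set \<Rightarrow> (('d \<times> 'l) \<Rightarrow>\<^sub>0 int) set" where
  "ext_involution F L \<phi> D \<sigma> = tensor_map (algebra_class F L \<phi> D) \<sigma>"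

definition ext_form ::
  "('d, 'p) ring_scheme \<Rightarrow> ('l, 'n) ring_scheme \<Rightarrow> ('d \<Rightarrow> 'l) \<Rightarrow> ('d, 'q) ring_scheme \<Rightarrow>
   ('v \<Rightarrow> 'v \<Rightarrow> 'd) \<Rightarrow>
   (('v \<times> 'l) \<Rightarrow>\<^sub>0 int) set \<Rightarrow> (('v \<times> 'l) \<Rightarrow>\<^sub>0 int) set \<Rightarrow> (('d \<times> 'l) \<Rightarrow>\<^sub>0 int) set" where
  "ext_form F L \<phi> D h = tensor_map2 (algebra_class F L \<phi> D) L h"

text \<open>Up to isomorphism, every finite extension of a field whose elements have type \<^typ>\<open>'d\<close>
  lives on a subset of \<^typ>\<open>'d list\<close> (coordinate lists). The same choice is made in \<open>A_field\<close>
  and in \<open>splitting\<close> below.\<close>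

definition springer_property :: "('d, 'm) ring_scheme \<Rightarrow> ('d \<Rightarrow> 'd) \<Rightarrow> bool" where
  "springer_property D \<sigma> \<longleftrightarrow>
     (\<forall>\<epsilon>\<in>{\<one>\<^bsub>D\<^esub>, \<ominus>\<^bsub>D\<^esub> \<one>\<^bsub>D\<^esub>}. \<forall>(L :: 'd list ring) \<phi> e (V :: ('d, 'd list) module) h.
        finite_extension (fixed_field D \<sigma>) L \<phi> e \<and> odd e \<and>
        hermitian_space D \<sigma> \<epsilon> V h \<and> anisotropic D V h \<longrightarrow>
        anisotropic (ext_algebra (fixed_field D \<sigma>) L \<phi> D)
                    (ext_module (fixed_field D \<sigma>) L \<phi> V)
                    (ext_form (fixed_field D \<sigma>) L \<phi> D h))"

section \<open>Orthogonal and symplectic involutions\<close>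

definition matrix_ring :: "('l, 'n) ring_scheme \<Rightarrow> nat \<Rightarrow> (nat \<Rightarrow> nat \<Rightarrow> 'l) ring" where
  "matrix_ring L n =
     \<lparr>carrier = {A. \<forall>i j. (if i < n \<and> j < n then A i j \<in> carrier L else A i j = \<zero>\<^bsub>L\<^esub>)},
      monoid.mult = (\<lambda>A B i j. \<Oplus>\<^bsub>L\<^esub>l\<in>{..<n}. A i l \<otimes>\<^bsub>L\<^esub> B l j),
      one = (\<lambda>i j. if i < n \<and> i = j then \<one>\<^bsub>L\<^esub> else \<zero>\<^bsub>L\<^esub>),
      zero = (\<lambda>i j. \<zero>\<^bsub>L\<^esub>),
      add = (\<lambda>A B i j. A i j \<oplus>\<^bsub>L\<^esub> B i j)\<rparr>"

definition mat_transpose :: "(nat \<Rightarrow> nat \<Rightarrow> 'l) \<Rightarrow> nat \<Rightarrow> nat \<Rightarrow> 'l" where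
  "mat_transpose A = (\<lambda>i j. A j i)"

text \<open>\<open>\<psi>\<close> is an isomorphism of \<open>L\<close>-algebras from \<open>D \<otimes>\<^sub>K L\<close> to the ring of \<open>n \<times> n\<close> matrices
  over \<open>L\<close>, where \<open>K\<close> is the center of \<open>D\<close>.\<close>

definition splitting ::
  "('d, 'm) ring_scheme \<Rightarrow> 'd list ring \<Rightarrow> ('d \<Rightarrow> 'd list) \<Rightarrow> nat \<Rightarrow>
   ((('d \<times> 'd list) \<Rightarrow>\<^sub>0 int) set \<Rightarrow> nat \<Rightarrow> nat \<Rightarrow> 'd list) \<Rightarrow> bool" where
  "splitting D L \<phi> n \<psi> \<longleftrightarrow>
     field_extension (center_field D) L \<phi> \<and>
     \<psi> \<in> ring_iso (ext_algebra (center_field D) L \<phi> D) (matrix_ring L n) \<and>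
     (\<forall>l\<in>carrier L. \<psi> (algebra_class (center_field D) L \<phi> D (frag_of (\<one>\<^bsub>D\<^esub>, l))) =
        (\<lambda>i j. if i < n \<and> i = j then l else \<zero>\<^bsub>L\<^esub>))"

text \<open>Under the splitting \<open>\<psi>\<close>, the involution \<open>\<sigma> \<otimes> id\<^sub>L\<close> becomes the adjoint involution
  \<open>A \<mapsto> G\<^sup>-\<^sup>1 A\<^sup>T G\<close> of the nondegenerate bilinear form \<open>(x, y) \<mapsto> x\<^sup>T G y\<close>.\<close>

definition adjoint_under ::
  "('d, 'm) ring_scheme \<Rightarrow> ('d \<Rightarrow> 'd) \<Rightarrow> 'd list ring \<Rightarrow> ('d \<Rightarrow> 'd list) \<Rightarrow> nat \<Rightarrow>
   ((('d \<times> 'd list) \<Rightarrow>\<^sub>0 int) set \<Rightarrow> nat \<Rightarrow> nat \<Rightarrow> 'd list) \<Rightarrow> (nat \<Rightarrow> nat \<Rightarrow> 'd list) \<Rightarrow> bool" where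
  "adjoint_under D \<sigma> L \<phi> n \<psi> G \<longleftrightarrow>
     G \<in> Units (matrix_ring L n) \<and>
     (\<forall>X\<in>carrier (ext_algebra (center_field D) L \<phi> D).
        \<psi> (ext_involution (center_field D) L \<phi> D \<sigma> X) =
        inv\<^bsub>matrix_ring L n\<^esub> G \<otimes>\<^bsub>matrix_ring L n\<^esub> mat_transpose (\<psi> X) \<otimes>\<^bsub>matrix_ring L n\<^esub> G)"

text \<open>An involution of the first kind is orthogonal (symplectic) if over a splitting field it
  is adjoint to a symmetric (alternating) form, in characteristic different from 2. By the
  standard theory this does not depend on the splitting field, the splitting or the form, and
  every involution of the first kind is of exactly one of the two types.\<close>

definition orthogonal_inv :: "('d, 'm) ring_scheme \<Rightarrow> ('d \<Rightarrow> 'd) \<Rightarrow> bool" where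
  "orthogonal_inv D \<sigma> \<longleftrightarrow> first_kind D \<sigma> \<and>
     (\<exists>L \<phi> n \<psi> G. splitting D L \<phi> n \<psi> \<and> adjoint_under D \<sigma> L \<phi> n \<psi> G \<and>
        mat_transpose G = G)"

definition symplectic_inv :: "('d, 'm) ring_scheme \<Rightarrow> ('d \<Rightarrow> 'd) \<Rightarrow> bool" where
  "symplectic_inv D \<sigma> \<longleftrightarrow> first_kind D \<sigma> \<and>
     (\<exists>L \<phi> n \<psi> G. splitting D L \<phi> n \<psi> \<and> adjoint_under D \<sigma> L \<phi> n \<psi> G \<and>
        mat_transpose G = (\<lambda>i j. \<ominus>\<^bsub>L\<^esub> G i j) \<and> (\<forall>i. G i i = \<zero>\<^bsub>L\<^esub>))"

text \<open>Exactly one \<open>\<epsilon>\<close> matches a given type of \<open>\<sigma>\<close>, so the suprema in \<open>u_plus\<close> and \<open>u_minus\<close>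
  are over one value; in \<open>u_zero\<close> they are over two values, which are equal for an involution
  of the second kind. The invariants depend on \<open>D\<close> (and \<open>k\<close>) only; \<open>\<sigma>\<close> is the involution
  used to compute them.\<close>

definition u_plus :: "('d, 'm) ring_scheme \<Rightarrow> ('d \<Rightarrow> 'd) \<Rightarrow> enat" where
  "u_plus D \<sigma> = Sup {u_inv D \<sigma> \<epsilon> | \<epsilon>.
     \<epsilon> = \<one>\<^bsub>D\<^esub> \<and> orthogonal_inv D \<sigma> \<or> \<epsilon> = \<ominus>\<^bsub>D\<^esub> \<one>\<^bsub>D\<^esub> \<and> symplectic_inv D \<sigma>}"

definition u_minus :: "('d, 'm) ring_scheme \<Rightarrow> ('d \<Rightarrow> 'd) \<Rightarrow> enat" where
  "u_minus D \<sigma> = Sup {u_inv D \<sigma> \<epsilon> | \<epsilon>.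
     \<epsilon> = \<ominus>\<^bsub>D\<^esub> \<one>\<^bsub>D\<^esub> \<and> orthogonal_inv D \<sigma> \<or> \<epsilon> = \<one>\<^bsub>D\<^esub> \<and> symplectic_inv D \<sigma>}"

definition u_zero :: "('d, 'm) ring_scheme \<Rightarrow> ('d \<Rightarrow> 'd) \<Rightarrow> enat" where
  "u_zero D \<sigma> = Sup {u_inv D \<sigma> \<epsilon> | \<epsilon>. \<epsilon> \<in> {\<one>\<^bsub>D\<^esub>, \<ominus>\<^bsub>D\<^esub> \<one>\<^bsub>D\<^esub>}}"

section \<open>Systems of forms\<close>

definition exponents :: "nat \<Rightarrow> nat \<Rightarrow> (nat \<Rightarrow> nat) set" where
  "exponents n m = {\<alpha>. (\<forall>j\<ge>n. \<alpha> j = 0) \<and> (\<Sum>j<n. \<alpha> j) = m}"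

text \<open>A form of degree \<open>m\<close> in \<open>n\<close> variables is given by its coefficients \<open>c \<alpha>\<close>.\<close>

definition form_eval ::
  "('l, 'n) ring_scheme \<Rightarrow> nat \<Rightarrow> nat \<Rightarrow> ((nat \<Rightarrow> nat) \<Rightarrow> 'l) \<Rightarrow> (nat \<Rightarrow> 'l) \<Rightarrow> 'l" where
  "form_eval L n m c x =
     (\<Oplus>\<^bsub>L\<^esub>\<alpha>\<in>exponents n m. c \<alpha> \<otimes>\<^bsub>L\<^esub> (\<Otimes>\<^bsub>L\<^esub>j\<in>{..<n}. x j [^]\<^bsub>L\<^esub> \<alpha> j))"

definition A_field :: "nat \<Rightarrow> nat \<Rightarrow> ('f, 'm) ring_scheme \<Rightarrow> bool" where
  "A_field i m F \<longleftrightarrow> field F \<and>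
     (\<forall>r n c. n > r * m ^ i \<and> (\<forall>s<r. \<forall>\<alpha>\<in>exponents n m. c s \<alpha> \<in> carrier F) \<longrightarrow>
        (\<exists>(L :: 'f list ring) \<phi> e x.
           finite_extension F L \<phi> e \<and> coprime m e \<and>
           (\<forall>j<n. x j \<in> carrier L) \<and> (\<exists>j<n. x j \<noteq> \<zero>\<^bsub>L\<^esub>) \<and>
           (\<forall>s<r. form_eval L n m (\<lambda>\<alpha>. \<phi> (c s \<alpha>)) x = \<zero>\<^bsub>L\<^esub>)))"

end

theory Submission
  imports Defs
begin

text \<open>If \<open>h\<close> is an anisotropic \<open>\<epsilon>\<close>-hermitian form on \<open>V\<close>, then \<open>x \<mapsto> h x x\<close> is a quadratic map over \<open>k\<close>
  from \<open>V\<close> to the space \<open>S\<close> of all \<open>a\<close> in \<open>D\<close> with \<open>\<sigma> a = \<epsilon> a\<close>, that is, a system of \<open>dim S\<close> quadratic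
  forms in \<open>dim V \<cdot> [D : k]\<close> variables. If \<open>dim V \<cdot> [D : k] > dim S \<cdot> 2\<^sup>i\<close>, this system has a nontrivial
  zero over an extension of odd degree, which contradicts Springer's property; hence
  \<open>dim V \<le> dim S \<cdot> 2\<^sup>i / [D : k]\<close>. For an involution of the second kind \<open>dim S\<close> is half of
  \<open>[D : k] = 2 d\<^sup>2\<close>. For one of the first kind, \<open>S\<close> is embedded over a splitting field into
  the symmetric or the skew-symmetric \<open>d \<times> d\<close> matrices, and only this upper bound for \<open>dim S\<close>
  is needed.\<close>

section \<open>Finite sums and homogeneous linear systems\<close>

text \<open>Two obstacles shape the argument. The quadratic system only makes the
  \<open>dim S\<close> coordinates of the value along \<open>S\<close> vanish, whereas an isotropic
  vector needs all \<open>[D : k]\<close> of them. The others vanish by polarisation: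
  \<open>h v w + h w v\<close> lies in \<open>S\<close> for all \<open>v\<close>, \<open>w\<close>
  in \<open>V\<close>, so outside \<open>S\<close> the Gram matrices are antisymmetric and, 2 being
  invertible, their quadratic forms are zero over every \<open>L\<close>. Secondly, the tensor
  products are quotients of free abelian groups, where equality is hard to test; a basis over
  \<open>k\<close> with coordinates \<open>c t\<close> yields maps \<open>c t\<close> tensor
  \<open>id\<close> to \<open>L\<close>, and an element is zero exactly when all of them kill it.
  For the first kind, a splitting does not say that its matrices have size \<open>d\<close>;
  comparing dimensions gives \<open>n * n \<le> d ^ 2\<close>, which is enough. The matrices
  \<open>G T\<close> are symmetric or skew according to the sign of \<open>G\<close> times
  \<epsilon>, so \<open>dim S\<close> is at most d (d + 1) / 2 or d (d - 1) / 2, and the factor 2^i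
  / d^2 turns this into (1 + 1/d) 2^(i-1) or (1 - 1/d) 2^(i-1).\<close>

lemma (in abelian_monoid) finsum_swap:
  assumes "finite A" "finite B" "\<And>a b. a \<in> A \<Longrightarrow> b \<in> B \<Longrightarrow> f a b \<in> carrier G"
  shows "(\<Oplus>a\<in>A. \<Oplus>b\<in>B. f a b) = (\<Oplus>b\<in>B. \<Oplus>a\<in>A. f a b)"
  using assms(1,3)
proof (induction A rule: finite_induct)
  case empty
  then show ?case by (simp add: finsum_zero)
next
  case (insert x A)
  have "(\<Oplus>a\<in>insert x A. \<Oplus>b\<in>B. f a b) = (\<Oplus>b\<in>B. f x b) \<oplus> (\<Oplus>b\<in>B. \<Oplus>a\<in>A. f a b)"
    using insert by (subst finsum_insert) (auto intro!: finsum_closed)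
  also have "\<dots> = (\<Oplus>b\<in>B. f x b \<oplus> (\<Oplus>a\<in>A. f a b))"
    using insert by (subst finsum_addf) (auto intro!: finsum_closed)
  also have "\<dots> = (\<Oplus>b\<in>B. \<Oplus>a\<in>insert x A. f a b)"
    using insert by (intro finsum_cong') (auto intro!: finsum_closed)
  finally show ?case .
qed

lemma (in abelian_monoid) finsum_Times:
  assumes "finite A" "finite B" "\<And>a b. a \<in> A \<Longrightarrow> b \<in> B \<Longrightarrow> f (a, b) \<in> carrier G"
  shows "(\<Oplus>p\<in>A \<times> B. f p) = (\<Oplus>a\<in>A. \<Oplus>b\<in>B. f (a, b))"
proof -
  have "(\<Oplus>p\<in>A \<times> B. f p) = (\<Oplus>p\<in>(\<Union>a\<in>A. Pair a ` B). f p)"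
    by (rule arg_cong[where f = "finsum G f"]) auto
  also have "\<dots> = (\<Oplus>a\<in>A. \<Oplus>p\<in>Pair a ` B. f p)"
    using assms by (intro add.finprod_UN_disjoint) (auto simp: pairwise_def disjnt_def)
  also have "\<dots> = (\<Oplus>a\<in>A. \<Oplus>b\<in>B. f (a, b))"
    using assms
    by (intro finsum_cong') (auto intro!: finsum_closed finsum_reindex inj_onI)
  finally show ?thesis .
qed

lemma (in abelian_monoid) finsum_delta:
  assumes "finite A" "i \<in> A" "x \<in> carrier G" "\<And>j. j \<in> A \<Longrightarrow> f j = (if j = i then x else \<zero>)"
  shows "finsum G f A = x"
proof -
  have "finsum G f A = (\<Oplus>j\<in>A. if i = j then (\<lambda>_. x) j else \<zero>)"
    using assms by (intro finsum_cong') auto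
  also have "\<dots> = x"
    using assms by (subst finsum_singleton) auto
  finally show ?thesis .
qed

lemma (in abelian_monoid) finsum_hom:
  assumes "abelian_monoid H" and "\<And>x. x \<in> carrier G \<Longrightarrow> g x \<in> carrier H"
    and "\<And>x y. \<lbrakk>x \<in> carrier G; y \<in> carrier G\<rbrakk> \<Longrightarrow> g (x \<oplus> y) = g x \<oplus>\<^bsub>H\<^esub> g y"
    and "g \<zero> = \<zero>\<^bsub>H\<^esub>" and "finite A" and "\<And>a. a \<in> A \<Longrightarrow> f a \<in> carrier G"
  shows "g (finsum G f A) = (\<Oplus>\<^bsub>H\<^esub>a\<in>A. g (f a))"
proof -
  interpret H: abelian_monoid H by fact
  from assms(5,6) show ?thesis
  proof (induction A rule: finite_induct)
    case (insert x A)
    then have "g (finsum G f (insert x A)) = g (f x) \<oplus>\<^bsub>H\<^esub> (\<Oplus>\<^bsub>H\<^esub>a\<in>A. g (f a))"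
      by (subst finsum_insert) (auto simp: assms(3) finsum_closed)
    also have "\<dots> = (\<Oplus>\<^bsub>H\<^esub>a\<in>insert x A. g (f a))"
      using insert by (subst H.finsum_insert) (auto simp: assms(2))
    finally show ?case .
  qed (simp add: assms(4))
qed

lemma (in abelian_group) finsum_minus:
  assumes "finite A" "\<And>a. a \<in> A \<Longrightarrow> f a \<in> carrier G"
  shows "(\<Oplus>a\<in>A. \<ominus> f a) = \<ominus> finsum G f A"
  using assms
  by (intro finsum_hom[symmetric] abelian_monoid_axioms) (auto simp: minus_add)

text \<open>Gaussian elimination, one equation per induction step: a nonzero coefficient in the new
  equation \<open>r0\<close> eliminates one unknown from all others, which keeps fewer equations
  than unknowns. The index sets are arbitrary because matrix positions serve later both as equations
  and as unknowns.\<close>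

lemma homogeneous_system_nontrivial_solution:
  fixes L (structure)
  assumes "field L" "finite R" "finite I" "card R < card I"
    and "\<And>r i. r \<in> R \<Longrightarrow> i \<in> I \<Longrightarrow> a r i \<in> carrier L"
  shows "\<exists>x. (\<forall>i\<in>I. x i \<in> carrier L) \<and> (\<exists>i\<in>I. x i \<noteq> \<zero>) \<and>
           (\<forall>r\<in>R. (\<Oplus>i\<in>I. a r i \<otimes> x i) = \<zero>)"
proof -
  interpret field L by fact
  from assms(2-5) show ?thesis
  proof (induction R arbitrary: I a rule: finite_induct)
    case empty
    then have "I \<noteq> {}" by auto
    then show ?case by (intro exI[of _ "\<lambda>_. \<one>"]) auto
  next
    case (insert r0 R)
    show ?case
    proof (cases "\<forall>i\<in>I. a r0 i = \<zero>")
      case True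
      obtain x where x: "\<forall>i\<in>I. x i \<in> carrier L" "\<exists>i\<in>I. x i \<noteq> \<zero>"
        "\<forall>r\<in>R. (\<Oplus>i\<in>I. a r i \<otimes> x i) = \<zero>"
        using insert.IH[of I a] insert.prems insert.hyps by auto
      have "(\<Oplus>i\<in>I. a r0 i \<otimes> x i) = (\<Oplus>i\<in>I. \<zero>)"
        using True x by (intro finsum_cong') auto
      with x show ?thesis by auto
    next
      case False
      then obtain i0 where i0: "i0 \<in> I" "a r0 i0 \<noteq> \<zero>" by auto
      define c where "c = inv (a r0 i0)"
      have c: "c \<in> carrier L" "c \<otimes> a r0 i0 = \<one>"
        using i0 insert.prems field_Units by (auto simp: c_def)
      let ?J = "I - {i0}"
      have fin: "finite I" by (fact insert.prems)
      have J: "finite ?J" "I = insert i0 ?J" "card R < card ?J"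
        using insert.prems insert.hyps i0 by auto
      have aI: "a r i \<in> carrier L" if "r = r0 \<or> r \<in> R" "i \<in> I" for r i
        using that insert.prems by auto
      \<comment> \<open>Coefficients after subtracting from equation \<open>r\<close> the multiple
        of \<open>r0\<close> that removes the unknown \<open>i0\<close>; \<open>c\<close> is the
        inverse of the pivot.\<close>
      define b where "b r i = a r i \<ominus> a r i0 \<otimes> (c \<otimes> a r0 i)" for r i
      obtain x where x: "\<forall>i\<in>?J. x i \<in> carrier L" "\<exists>i\<in>?J. x i \<noteq> \<zero>"
        "\<forall>r\<in>R. (\<Oplus>i\<in>?J. b r i \<otimes> x i) = \<zero>"
        using insert.IH[of ?J b] J aI i0 c by (auto simp: b_def)
      define s where "s r = (\<Oplus>i\<in>?J. a r i \<otimes> x i)" for r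
      have s: "s r \<in> carrier L" if "r = r0 \<or> r \<in> R" for r
        unfolding s_def using that x aI by (auto intro!: finsum_closed)
      \<comment> \<open>The value at \<open>i0\<close> is the one that equation \<open>r0\<close>
        forces, so equation \<open>r\<close> at \<open>y\<close> takes the value of the reduced
        equation at \<open>x\<close>.\<close>
      define y where "y = x(i0 := \<ominus> (c \<otimes> s r0))"
      have sum_y: "(\<Oplus>i\<in>I. a r i \<otimes> y i) = \<ominus> (a r i0 \<otimes> (c \<otimes> s r0)) \<oplus> s r"
        if r: "r = r0 \<or> r \<in> R" for r
      proof -
        have "(\<Oplus>i\<in>I. a r i \<otimes> y i) = a r i0 \<otimes> y i0 \<oplus> (\<Oplus>i\<in>?J. a r i \<otimes> y i)"
          using r aI i0 x c s by (subst J(2), subst finsum_insert) (auto simp: fin y_def)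
        also have "(\<Oplus>i\<in>?J. a r i \<otimes> y i) = s r"
          unfolding s_def using r aI x by (intro finsum_cong') (auto simp: y_def)
        finally show ?thesis
          using r aI i0 c s by (simp add: y_def r_minus)
      qed
      have sum_b: "(\<Oplus>i\<in>?J. b r i \<otimes> x i) = s r \<ominus> a r i0 \<otimes> (c \<otimes> s r0)" if r: "r \<in> R" for r
      proof -
        have "(\<Oplus>i\<in>?J. b r i \<otimes> x i)
            = (\<Oplus>i\<in>?J. a r i \<otimes> x i \<oplus> \<ominus> (a r i0 \<otimes> (c \<otimes> (a r0 i \<otimes> x i))))"
          using r aI x c i0
          by (intro finsum_cong') (auto simp: b_def a_minus_def l_distr l_minus m_assoc)
        also have "\<dots> = s r \<oplus> (\<Oplus>i\<in>?J. \<ominus> (a r i0 \<otimes> (c \<otimes> (a r0 i \<otimes> x i))))"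
          unfolding s_def using r aI x c i0 by (subst finsum_addf) auto
        also have "(\<Oplus>i\<in>?J. \<ominus> (a r i0 \<otimes> (c \<otimes> (a r0 i \<otimes> x i))))
            = \<ominus> (\<Oplus>i\<in>?J. a r i0 \<otimes> (c \<otimes> (a r0 i \<otimes> x i)))"
          using r aI x c i0 fin by (intro finsum_minus) auto
        also have "(\<Oplus>i\<in>?J. a r i0 \<otimes> (c \<otimes> (a r0 i \<otimes> x i))) = a r i0 \<otimes> (c \<otimes> s r0)"
          unfolding s_def using r aI x c i0 fin
          by (simp add: finsum_rdistr Pi_def)
        finally show ?thesis by (simp add: a_minus_def)
      qed
      have "(\<Oplus>i\<in>I. a r i \<otimes> y i) = \<zero>" if r: "r \<in> insert r0 R" for r
      proof (cases "r = r0")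
        case True
        have "a r0 i0 \<otimes> (c \<otimes> s r0) = s r0"
          using c aI[of r0 i0] i0 s[of r0] by (metis l_one m_assoc m_comm)
        then show ?thesis
          using True sum_y[of r0] s[of r0] by (simp add: l_neg)
      next
        case False
        then have "s r \<ominus> a r i0 \<otimes> (c \<otimes> s r0) = \<zero>"
          using sum_b[of r] x r by auto
        then show ?thesis
          using sum_y[of r] False r s[of r] s[of r0] c aI[of r i0] i0 by (simp add: a_minus_def a_comm)
      qed
      moreover have "\<forall>i\<in>I. y i \<in> carrier L" "\<exists>i\<in>I. y i \<noteq> \<zero>"
        using x c s[of r0] by (auto simp: y_def)
      ultimately show ?thesis by blast
    qed
  qed
qed

section \<open>Systems of quadratic forms over finite index sets\<close>

text \<open>Exponent vector of the monomial \<open>x i * x j\<close>; adding two indicators makes it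
  2 at \<open>i\<close> when \<open>i = j\<close>.\<close>

definition pair_exponent :: "nat \<Rightarrow> nat \<Rightarrow> nat \<Rightarrow> nat" where
  "pair_exponent i j l = (if l = i then 1 else 0) + (if l = j then 1 else 0)"

lemma finite_exponents: "finite (exponents n m)"
proof (rule finite_subset)
  show "exponents n m \<subseteq> {\<alpha>. \<forall>j. (j \<in> {..<n} \<longrightarrow> \<alpha> j \<in> {..m}) \<and> (j \<notin> {..<n} \<longrightarrow> \<alpha> j = 0)}"
    by (auto simp: exponents_def intro: member_le_sum)
qed (rule finite_set_of_finite_funs; simp)

lemma pair_exponent_in_exponents: "i < n \<Longrightarrow> j < n \<Longrightarrow> pair_exponent i j \<in> exponents n 2"
  by (auto simp: exponents_def pair_exponent_def sum.distrib sum.delta)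

lemma (in cring) monomial_pair_exponent:
  assumes "i < n" "j < n" "\<And>l. l < n \<Longrightarrow> x l \<in> carrier R"
  shows "(\<Otimes>l\<in>{..<n}. x l [^] pair_exponent i j l) = x i \<otimes> x j"
proof -
  have "(\<Otimes>l\<in>{..<n}. x l [^] pair_exponent i j l)
      = (\<Otimes>l\<in>{..<n}. (if i = l then x l else \<one>) \<otimes> (if j = l then x l else \<one>))"
    using assms by (intro finprod_cong') (auto simp: pair_exponent_def numeral_2_eq_2)
  also have "\<dots> = x i \<otimes> x j"
    using assms by (subst finprod_multf) (auto simp: finprod_singleton)
  finally show ?thesis .
qed

text \<open>Passes from forms indexed by monomials to double sums over pairs. The pairs
  \<open>(i, j)\<close> and \<open>(j, i)\<close> share a monomial, so its coefficient collects
  \<open>a\<close> over all pairs with that exponent vector.\<close>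

lemma form_eval_quadratic:
  fixes F :: "('f, 'p) ring_scheme" and L :: "('l, 'q) ring_scheme"
  assumes "field_extension F L \<phi>"
    and x: "\<And>l. l < n \<Longrightarrow> x l \<in> carrier L"
    and a: "\<And>i j. i < n \<Longrightarrow> j < n \<Longrightarrow> a i j \<in> carrier F"
    and c: "\<And>\<alpha>. c \<alpha> = (\<Oplus>\<^bsub>F\<^esub>p\<in>{..<n} \<times> {..<n}.
              if pair_exponent (fst p) (snd p) = \<alpha> then a (fst p) (snd p) else \<zero>\<^bsub>F\<^esub>)"
  shows "form_eval L n 2 (\<lambda>\<alpha>. \<phi> (c \<alpha>)) x
       = (\<Oplus>\<^bsub>L\<^esub>p\<in>{..<n} \<times> {..<n}. \<phi> (a (fst p) (snd p)) \<otimes>\<^bsub>L\<^esub> (x (fst p) \<otimes>\<^bsub>L\<^esub> x (snd p)))"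
proof -
  interpret F: field F using assms(1) by (simp add: field_extension_def)
  interpret L: field L using assms(1) by (simp add: field_extension_def)
  interpret h: ring_hom_cring F L \<phi>
    using assms(1) by unfold_locales (simp add: field_extension_def)
  let ?P = "{..<n} \<times> {..<n}" and ?e = "\<lambda>p. pair_exponent (fst p) (snd p)"
  let ?mon = "\<lambda>\<alpha>. \<Otimes>\<^bsub>L\<^esub>j\<in>{..<n}. x j [^]\<^bsub>L\<^esub> (\<alpha> j :: nat)"
  have mon: "?mon \<alpha> \<in> carrier L" for \<alpha>
    using x by (intro L.finprod_closed) auto
  have ap: "a (fst p) (snd p) \<in> carrier F" if "p \<in> ?P" for p
    using that a by auto
  have \<phi>c: "\<phi> (c \<alpha>) = (\<Oplus>\<^bsub>L\<^esub>p\<in>?P. if ?e p = \<alpha> then \<phi> (a (fst p) (snd p)) else \<zero>\<^bsub>L\<^esub>)" for \<alpha>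
    unfolding c using ap
    by (subst h.hom_finsum) (auto intro!: L.finsum_cong')
  have "form_eval L n 2 (\<lambda>\<alpha>. \<phi> (c \<alpha>)) x
      = (\<Oplus>\<^bsub>L\<^esub>\<alpha>\<in>exponents n 2. \<Oplus>\<^bsub>L\<^esub>p\<in>?P. (if ?e p = \<alpha> then \<phi> (a (fst p) (snd p)) \<otimes>\<^bsub>L\<^esub> ?mon \<alpha> else \<zero>\<^bsub>L\<^esub>))"
    unfolding form_eval_def \<phi>c using ap mon
    by (intro L.finsum_cong' refl)
      (auto intro!: L.finsum_closed L.finsum_cong' simp: L.finsum_ldistr)
  \<comment> \<open>After the exchange each pair \<open>p\<close> meets exactly one exponent vector,
    \<open>?e p\<close>.\<close>
  also have "\<dots> = (\<Oplus>\<^bsub>L\<^esub>p\<in>?P. \<Oplus>\<^bsub>L\<^esub>\<alpha>\<in>exponents n 2. (if ?e p = \<alpha> then \<phi> (a (fst p) (snd p)) \<otimes>\<^bsub>L\<^esub> ?mon \<alpha> else \<zero>\<^bsub>L\<^esub>))"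
    using ap mon by (intro L.finsum_swap finite_exponents) auto
  also have "\<dots> = (\<Oplus>\<^bsub>L\<^esub>p\<in>?P. \<phi> (a (fst p) (snd p)) \<otimes>\<^bsub>L\<^esub> ?mon (?e p))"
    using ap mon
    by (intro L.finsum_cong' refl L.finsum_delta finite_exponents)
      (auto intro!: pair_exponent_in_exponents)
  also have "\<dots> = (\<Oplus>\<^bsub>L\<^esub>p\<in>?P. \<phi> (a (fst p) (snd p)) \<otimes>\<^bsub>L\<^esub> (x (fst p) \<otimes>\<^bsub>L\<^esub> x (snd p)))"
    using ap x by (intro L.finsum_cong' refl) (auto simp: L.monomial_pair_exponent)
  finally show ?thesis .
qed

text \<open>Restates the defining property of \<open>A_field\<close> in degree 2 for Gram matrices
  \<open>a t\<close> over arbitrary finite index sets, by enumerating \<open>I\<close> and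
  \<open>T\<close>; being coprime to 2 becomes odd degree.\<close>

lemma A_field_quadratic_system:
  fixes F :: "('f, 'p) ring_scheme"
  assumes A: "A_field i 2 F" and I: "finite I" and T: "finite T" and gt: "card I > card T * 2 ^ i"
    and a: "\<And>t u v. t \<in> T \<Longrightarrow> u \<in> I \<Longrightarrow> v \<in> I \<Longrightarrow> a t u v \<in> carrier F"
  shows "\<exists>(L :: 'f list ring) \<phi> e x. finite_extension F L \<phi> e \<and> odd e \<and>
           (\<forall>u\<in>I. x u \<in> carrier L) \<and> (\<exists>u\<in>I. x u \<noteq> \<zero>\<^bsub>L\<^esub>) \<and>
           (\<forall>t\<in>T. (\<Oplus>\<^bsub>L\<^esub>p\<in>I \<times> I. \<phi> (a t (fst p) (snd p)) \<otimes>\<^bsub>L\<^esub> (x (fst p) \<otimes>\<^bsub>L\<^esub> x (snd p))) = \<zero>\<^bsub>L\<^esub>)"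
proof -
  interpret F: field F using A by (simp add: A_field_def)
  obtain f where f: "bij_betw f {..<card I} I"
    using ex_bij_betw_nat_finite[OF I] by (auto simp: atLeast0LessThan)
  obtain g where g: "bij_betw g {..<card T} T"
    using ex_bij_betw_nat_finite[OF T] by (auto simp: atLeast0LessThan)
  have fI: "f j \<in> I" if "j < card I" for j using f that by (auto simp: bij_betw_def)
  have gT: "g j \<in> T" if "j < card T" for j using g that by (auto simp: bij_betw_def)
  define c where "c s \<alpha> = (\<Oplus>\<^bsub>F\<^esub>p\<in>{..<card I} \<times> {..<card I}.
      if pair_exponent (fst p) (snd p) = \<alpha> then a (g s) (f (fst p)) (f (snd p)) else \<zero>\<^bsub>F\<^esub>)" for s \<alpha>
  have "\<forall>s<card T. \<forall>\<alpha>\<in>exponents (card I) 2. c s \<alpha> \<in> carrier F"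
    unfolding c_def using a fI gT by (auto intro!: F.finsum_closed)
  with gt have "\<exists>(L :: 'f list ring) \<phi> e x. finite_extension F L \<phi> e \<and> coprime 2 e \<and>
      (\<forall>j<card I. x j \<in> carrier L) \<and> (\<exists>j<card I. x j \<noteq> \<zero>\<^bsub>L\<^esub>) \<and>
      (\<forall>s<card T. form_eval L (card I) 2 (\<lambda>\<alpha>. \<phi> (c s \<alpha>)) x = \<zero>\<^bsub>L\<^esub>)"
    by (intro A[unfolded A_field_def, THEN conjunct2, rule_format]) auto
  then obtain L :: "'f list ring" and \<phi> e x where
    L: "finite_extension F L \<phi> e" "coprime 2 e"
      "\<forall>j<card I. x j \<in> carrier L" "\<exists>j<card I. x j \<noteq> \<zero>\<^bsub>L\<^esub>"
      "\<forall>s<card T. form_eval L (card I) 2 (\<lambda>\<alpha>. \<phi> (c s \<alpha>)) x = \<zero>\<^bsub>L\<^esub>"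
    by blast
  have ext: "field_extension F L \<phi>" using L(1) by (simp add: finite_extension_def)
  interpret L: field L using ext by (simp add: field_extension_def)
  interpret h: ring_hom_cring F L \<phi>
    using ext by unfold_locales (simp add: field_extension_def)
  define f' where "f' = inv_into {..<card I} f"
  define y where "y u = x (f' u)" for u
  have f': "f' u < card I" "f (f' u) = u" if "u \<in> I" for u
    using f that unfolding f'_def bij_betw_def
    by (metis inv_into_into lessThan_iff, metis f_inv_into_f)
  have f'f: "f' (f j) = j" if "j < card I" for j
    using f that unfolding f'_def bij_betw_def by (simp add: inv_into_f_f)
  have "(\<Oplus>\<^bsub>L\<^esub>p\<in>I \<times> I. \<phi> (a t (fst p) (snd p)) \<otimes>\<^bsub>L\<^esub> (y (fst p) \<otimes>\<^bsub>L\<^esub> y (snd p))) = \<zero>\<^bsub>L\<^esub>" if t: "t \<in> T" for t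
  proof -
    obtain s where s: "s < card T" "t = g s" using g t by (auto simp: bij_betw_def)
    have img: "I \<times> I = map_prod f f ` ({..<card I} \<times> {..<card I})"
      using f by (auto simp: bij_betw_def map_prod_surj_on)
    have inj: "inj_on (map_prod f f) ({..<card I} \<times> {..<card I})"
      using f by (auto simp: bij_betw_def intro: map_prod_inj_on)
    have "(\<Oplus>\<^bsub>L\<^esub>p\<in>I \<times> I. \<phi> (a t (fst p) (snd p)) \<otimes>\<^bsub>L\<^esub> (y (fst p) \<otimes>\<^bsub>L\<^esub> y (snd p)))
       = (\<Oplus>\<^bsub>L\<^esub>p\<in>{..<card I} \<times> {..<card I}. \<phi> (a t (f (fst p)) (f (snd p))) \<otimes>\<^bsub>L\<^esub> (y (f (fst p)) \<otimes>\<^bsub>L\<^esub> y (f (snd p))))"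
      unfolding img using inj a t fI L(3)
      by (subst L.finsum_reindex) (auto simp: y_def f'f)
    also have "\<dots> = form_eval L (card I) 2 (\<lambda>\<alpha>. \<phi> (c s \<alpha>)) x"
      using s a t fI L(3)
      by (subst form_eval_quadratic[OF ext, where a = "\<lambda>i j. a t (f i) (f j)"])
        (auto simp: c_def y_def f'f intro!: L.finsum_cong')
    finally show ?thesis using L(5) s by simp
  qed
  moreover have "\<forall>u\<in>I. y u \<in> carrier L" "\<exists>u\<in>I. y u \<noteq> \<zero>\<^bsub>L\<^esub>"
    using L(3,4) f'f fI by (auto simp: y_def f', metis)
  moreover have "odd e" using L(2) by simp
  ultimately show ?thesis using L(1) by blast
qed

section \<open>Scalar extension of vector spaces\<close>

lemmas free_Abelian_group_induct_named =
  free_Abelian_group_induct[consumes 1, case_names zero diff frag]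

text \<open>One locale for both kinds of tensor product over \<open>k\<close> that occur: of
  \<open>D\<close>, with \<open>s\<close> the multiplication, and of \<open>V\<close>, with
  \<open>s\<close> the action of \<open>D\<close> cut down to \<open>k\<close>.\<close>

locale scalar_extension =
  fixes F :: "('f, 'p) ring_scheme" and L :: "('l, 'n) ring_scheme" and \<phi> :: "'f \<Rightarrow> 'l"
    and M :: "('m, 'q) ring_scheme" and s :: "'f \<Rightarrow> 'm \<Rightarrow> 'm"
  assumes ext: "field_extension F L \<phi>" and M_group: "abelian_group M"
    and s_closed: "\<lbrakk>a \<in> carrier F; x \<in> carrier M\<rbrakk> \<Longrightarrow> s a x \<in> carrier M"
begin

sublocale F: field F using ext by (simp add: field_extension_def)
sublocale L: field L using ext by (simp add: field_extension_def)
sublocale M: abelian_group M by (rule M_group)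
sublocale \<phi>: ring_hom_cring F L \<phi>
  using ext by unfold_locales (simp add: field_extension_def)

abbreviation free where "free \<equiv> free_Abelian_group (carrier M \<times> carrier L)"
abbreviation H where "H \<equiv> tensor_subgroup F L \<phi> M s"
abbreviation cls where "cls \<equiv> tensor_class F L \<phi> M s"

lemma relations_in_free: "tensor_relations F L \<phi> M s \<subseteq> carrier free"
  unfolding tensor_relations_def carrier_free_Abelian_group_iff
  by (auto simp: s_closed dest!: keys_diff[THEN subsetD])

sublocale G: comm_group free
  rewrites "mult free = (+)" and "one free = 0"
  by (rule abelian_free_Abelian_group) (auto simp: fun_eq_iff)

lemma subgroup_H: "subgroup H free"
  unfolding tensor_subgroup_def by (rule G.generate_is_subgroup[OF relations_in_free])

lemma normal_H: "H \<lhd> free"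
  using G.subgroup_imp_normal subgroup_H by blast

lemma H_subset: "p \<in> H \<Longrightarrow> p \<in> carrier free"
  using subgroup.subset[OF subgroup_H] by blast

lemma zero_in_H: "0 \<in> H"
  using subgroup.one_closed[OF subgroup_H] by simp

lemma add_in_H: "\<lbrakk>p \<in> H; q \<in> H\<rbrakk> \<Longrightarrow> p + q \<in> H"
  using subgroup.m_closed[OF subgroup_H] by simp

lemma uminus_in_H: "p \<in> H \<Longrightarrow> - p \<in> H"
  using subgroup.m_inv_closed[OF subgroup_H, of p] H_subset[of p] by simp

lemma diff_in_H: "\<lbrakk>p \<in> H; q \<in> H\<rbrakk> \<Longrightarrow> p - q \<in> H"
  using add_in_H[OF _ uminus_in_H] by fastforce

lemma sum_in_H: "(\<And>i. i \<in> A \<Longrightarrow> f i \<in> H) \<Longrightarrow> sum f A \<in> H"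
  by (induction A rule: infinite_finite_induct) (auto intro: zero_in_H add_in_H)

lemma relation_in_H: "p \<in> tensor_relations F L \<phi> M s \<Longrightarrow> p \<in> H"
  unfolding tensor_subgroup_def by (rule generate.incl)

lemma frag_add_left_in_H:
  "\<lbrakk>x \<in> carrier M; x' \<in> carrier M; l \<in> carrier L\<rbrakk> \<Longrightarrow>
     frag_of (x \<oplus>\<^bsub>M\<^esub> x', l) - frag_of (x, l) - frag_of (x', l) \<in> H"
  by (rule relation_in_H) (auto simp: tensor_relations_def)

lemma frag_add_right_in_H:
  "\<lbrakk>x \<in> carrier M; l \<in> carrier L; l' \<in> carrier L\<rbrakk> \<Longrightarrow>
     frag_of (x, l \<oplus>\<^bsub>L\<^esub> l') - frag_of (x, l) - frag_of (x, l') \<in> H"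
  by (rule relation_in_H) (auto simp: tensor_relations_def)

lemma frag_scalar_in_H:
  "\<lbrakk>a \<in> carrier F; x \<in> carrier M; l \<in> carrier L\<rbrakk> \<Longrightarrow>
     frag_of (s a x, l) - frag_of (x, \<phi> a \<otimes>\<^bsub>L\<^esub> l) \<in> H"
  by (rule relation_in_H) (auto simp: tensor_relations_def)

lemma frag_zero_left_in_H: "l \<in> carrier L \<Longrightarrow> frag_of (\<zero>\<^bsub>M\<^esub>, l) \<in> H"
  using uminus_in_H[OF frag_add_left_in_H[of "\<zero>\<^bsub>M\<^esub>" "\<zero>\<^bsub>M\<^esub>" l]] by simp

lemma frag_zero_right_in_H: "x \<in> carrier M \<Longrightarrow> frag_of (x, \<zero>\<^bsub>L\<^esub>) \<in> H"
  using uminus_in_H[OF frag_add_right_in_H[of x "\<zero>\<^bsub>L\<^esub>" "\<zero>\<^bsub>L\<^esub>"]] by simp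

lemma frag_finsum_in_H:
  assumes "finite A" "\<And>t. t \<in> A \<Longrightarrow> g t \<in> carrier M" "l \<in> carrier L"
  shows "frag_of (finsum M g A, l) - (\<Sum>t\<in>A. frag_of (g t, l)) \<in> H"
  using assms(1,2)
proof (induction A rule: finite_induct)
  case empty
  then show ?case using assms(3) by (simp add: frag_zero_left_in_H)
next
  case (insert t A)
  then have "frag_of (g t \<oplus>\<^bsub>M\<^esub> finsum M g A, l) - frag_of (g t, l) - frag_of (finsum M g A, l) \<in> H"
    by (intro frag_add_left_in_H M.finsum_closed) (auto simp: assms(3))
  from add_in_H[OF this insert.IH] insert show ?case
    by (simp add: M.finsum_insert Pi_def algebra_simps)
qed

lemma cls_eq_iff:
  assumes "p \<in> carrier free" "q \<in> carrier free"
  shows "cls p = cls q \<longleftrightarrow> p - q \<in> H"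
proof -
  have "cls p = cls q \<longleftrightarrow> p \<in> cls q"
    unfolding tensor_class_def
    using G.repr_independence[OF _ assms(2) subgroup_H] G.rcos_self[OF assms(1) subgroup_H]
    by metis
  also have "\<dots> \<longleftrightarrow> p - q \<in> H"
    unfolding tensor_class_def r_coset_def
    by (auto simp: algebra_simps intro!: bexI[of _ "p - q"])
  finally show ?thesis .
qed

lemma carrier_tensor_group: "carrier (tensor_group F L \<phi> M s) = cls ` carrier free"
  by (auto simp: tensor_group_def FactGroup_def RCOSETS_def tensor_class_def)

lemma one_tensor_group: "\<one>\<^bsub>tensor_group F L \<phi> M s\<^esub> = H"
  by (simp add: tensor_group_def FactGroup_def)

lemma cls_eq_H_iff: "p \<in> carrier free \<Longrightarrow> cls p = H \<longleftrightarrow> p \<in> H"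
  unfolding tensor_class_def
  using G.coset_join1[OF _ _ subgroup_H] G.coset_join2[OF _ subgroup_H] subgroup.subset[OF subgroup_H]
  by blast

lemma mult_cls:
  "\<lbrakk>p \<in> carrier free; q \<in> carrier free\<rbrakk> \<Longrightarrow>
     cls p \<otimes>\<^bsub>tensor_group F L \<phi> M s\<^esub> cls q = cls (p + q)"
  using normal.rcos_sum[OF normal_H, of p q]
  by (simp add: tensor_group_def FactGroup_def tensor_class_def)

lemma mem_clsD:
  assumes "p' \<in> cls p" "p \<in> carrier free" shows "p' \<in> carrier free" "p' - p \<in> H"
proof -
  obtain h where h: "h \<in> H" "p' = h + p"
    using assms(1) by (auto simp: tensor_class_def r_coset_def)
  then show "p' \<in> carrier free" "p' - p \<in> H"
    using G.m_closed[OF H_subset[OF h(1)] assms(2)] by auto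
qed

lemma cls_self: "p \<in> carrier free \<Longrightarrow> p \<in> cls p"
  unfolding tensor_class_def by (rule G.rcos_self[OF _ subgroup_H])

definition linear_functional :: "('m \<Rightarrow> 'f) \<Rightarrow> bool" where
  "linear_functional c \<longleftrightarrow> (\<forall>x\<in>carrier M. c x \<in> carrier F) \<and>
     (\<forall>x\<in>carrier M. \<forall>y\<in>carrier M. c (x \<oplus>\<^bsub>M\<^esub> y) = c x \<oplus>\<^bsub>F\<^esub> c y) \<and>
     (\<forall>a\<in>carrier F. \<forall>x\<in>carrier M. c (s a x) = a \<otimes>\<^bsub>F\<^esub> c x)"

text \<open>The functional \<open>c\<close> tensor \<open>id\<close> with values in
  \<open>L\<close>, but taken on representatives in the free group, where the universal property
  supplies it; \<open>ext_functional_H\<close> shows that it descends to the tensor product.\<close>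

definition ext_functional :: "('m \<Rightarrow> 'f) \<Rightarrow> (('m \<times> 'l) \<Rightarrow>\<^sub>0 int) \<Rightarrow> 'l" where
  "ext_functional c = (SOME \<Phi>. \<Phi> \<in> hom free (add_monoid L) \<and>
     (\<forall>x\<in>carrier M. \<forall>l\<in>carrier L. \<Phi> (frag_of (x, l)) = \<phi> (c x) \<otimes>\<^bsub>L\<^esub> l))"

context
  fixes c assumes lin: "linear_functional c"
begin

lemma c_closed: "x \<in> carrier M \<Longrightarrow> c x \<in> carrier F"
  using lin by (simp add: linear_functional_def)

lemma ext_functional_hom: "ext_functional c \<in> hom free (add_monoid L)"
  and ext_functional_frag:
    "\<lbrakk>x \<in> carrier M; l \<in> carrier L\<rbrakk> \<Longrightarrow> ext_functional c (frag_of (x, l)) = \<phi> (c x) \<otimes>\<^bsub>L\<^esub> l"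
proof -
  obtain \<Phi> where "\<Phi> \<in> hom free (add_monoid L)"
    "\<And>p. p \<in> carrier M \<times> carrier L \<Longrightarrow> \<Phi> (frag_of p) = \<phi> (c (fst p)) \<otimes>\<^bsub>L\<^esub> snd p"
    by (rule comm_group.free_Abelian_group_universal
        [OF L.a_comm_group, of "\<lambda>p. \<phi> (c (fst p)) \<otimes>\<^bsub>L\<^esub> snd p" "carrier M \<times> carrier L"]) (auto simp: c_closed)
  then have "\<exists>\<Phi>. \<Phi> \<in> hom free (add_monoid L) \<and>
     (\<forall>x\<in>carrier M. \<forall>l\<in>carrier L. \<Phi> (frag_of (x, l)) = \<phi> (c x) \<otimes>\<^bsub>L\<^esub> l)"
    by (intro exI[of _ \<Phi>]) auto
  from someI_ex[OF this] show "ext_functional c \<in> hom free (add_monoid L)"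
    "\<lbrakk>x \<in> carrier M; l \<in> carrier L\<rbrakk> \<Longrightarrow> ext_functional c (frag_of (x, l)) = \<phi> (c x) \<otimes>\<^bsub>L\<^esub> l"
    unfolding ext_functional_def by auto
qed

lemma ext_functional_group_hom: "group_hom free (add_monoid L) (ext_functional c)"
  by (intro group_hom.intro group_hom_axioms.intro ext_functional_hom L.a_group G.group_axioms)

lemma ext_functional_closed: "p \<in> carrier free \<Longrightarrow> ext_functional c p \<in> carrier L"
  using hom_in_carrier[OF ext_functional_hom] by simp

lemma ext_functional_add:
  "\<lbrakk>p \<in> carrier free; q \<in> carrier free\<rbrakk> \<Longrightarrow>
     ext_functional c (p + q) = ext_functional c p \<oplus>\<^bsub>L\<^esub> ext_functional c q"
  using hom_mult[OF ext_functional_hom, of p q] by simp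

lemma ext_functional_zero: "ext_functional c 0 = \<zero>\<^bsub>L\<^esub>"
  using group_hom.hom_one[OF ext_functional_group_hom] by simp

lemma ext_functional_uminus:
  "p \<in> carrier free \<Longrightarrow> ext_functional c (- p) = \<ominus>\<^bsub>L\<^esub> ext_functional c p"
  using group_hom.hom_inv[OF ext_functional_group_hom, of p] by (simp add: a_inv_def)

lemma ext_functional_diff:
  "\<lbrakk>p \<in> carrier free; q \<in> carrier free\<rbrakk> \<Longrightarrow>
     ext_functional c (p - q) = ext_functional c p \<ominus>\<^bsub>L\<^esub> ext_functional c q"
  using ext_functional_add[of p "- q"] by (simp add: ext_functional_uminus a_minus_def)

lemma ext_functional_sum:
  assumes "finite A" "\<And>i. i \<in> A \<Longrightarrow> g i \<in> carrier free"
  shows "ext_functional c (sum g A) = (\<Oplus>\<^bsub>L\<^esub>i\<in>A. ext_functional c (g i))"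
  using assms
proof (induction A rule: finite_induct)
  case (insert i A)
  have "sum g A \<in> carrier free"
    using insert.prems by (intro sum_closed_free_Abelian_group) blast
  then have "ext_functional c (sum g (insert i A)) = ext_functional c (g i) \<oplus>\<^bsub>L\<^esub> ext_functional c (sum g A)"
    using insert.hyps insert.prems[of i] ext_functional_add[of "g i" "sum g A"] by simp
  then show ?case
    using insert by (simp add: L.finsum_insert ext_functional_closed Pi_def del: carrier_free_Abelian_group_iff)
qed (simp add: ext_functional_zero)

text \<open>The kernel is a subgroup, so it contains \<open>H\<close> once it contains the three
  kinds of generating relations; these die by additivity of \<open>c\<close>, distributivity in
  \<open>L\<close> and linearity of \<open>c\<close> over \<open>F\<close>.\<close>

lemma ext_functional_H: "p \<in> H \<Longrightarrow> ext_functional c p = \<zero>\<^bsub>L\<^esub>"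
proof -
  let ?K = "kernel free (add_monoid L) (ext_functional c)"
  have lin': "\<And>x x'. \<lbrakk>x \<in> carrier M; x' \<in> carrier M\<rbrakk> \<Longrightarrow> c (x \<oplus>\<^bsub>M\<^esub> x') = c x \<oplus>\<^bsub>F\<^esub> c x'"
    "\<And>a x. \<lbrakk>a \<in> carrier F; x \<in> carrier M\<rbrakk> \<Longrightarrow> c (s a x) = a \<otimes>\<^bsub>F\<^esub> c x"
    using lin by (auto simp: linear_functional_def)
  have diff3: "ext_functional c (frag_of p - frag_of q - frag_of q') =
      ext_functional c (frag_of p) \<ominus>\<^bsub>L\<^esub> ext_functional c (frag_of q) \<ominus>\<^bsub>L\<^esub> ext_functional c (frag_of q')"
    if "p \<in> carrier M \<times> carrier L" "q \<in> carrier M \<times> carrier L" "q' \<in> carrier M \<times> carrier L" for p q q'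
  proof -
    have "frag_of p - frag_of q \<in> carrier free"
      using that keys_diff[of "frag_of p" "frag_of q"] by auto
    with that show ?thesis
      by (simp add: ext_functional_diff del: carrier_free_Abelian_group_iff)
  qed
  have cancel: "(u \<oplus>\<^bsub>L\<^esub> v) \<ominus>\<^bsub>L\<^esub> u = v" if "u \<in> carrier L" "v \<in> carrier L" for u v
    using that by algebra
  have "tensor_relations F L \<phi> M s \<subseteq> ?K"
  proof
    fix r assume r: "r \<in> tensor_relations F L \<phi> M s"
    then have "ext_functional c r = \<zero>\<^bsub>L\<^esub>"
      unfolding tensor_relations_def
      by (auto simp: diff3 ext_functional_diff ext_functional_frag c_closed s_closed lin'
          L.l_distr L.r_distr L.m_assoc L.m_lcomm cancel L.r_right_minus_eq)
    moreover have "r \<in> carrier free" using r relations_in_free by blast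
    ultimately show "r \<in> ?K" by (simp add: kernel_def)
  qed
  then have "H \<subseteq> ?K"
    unfolding tensor_subgroup_def
    by (rule G.generate_subgroup_incl[OF _ group_hom.subgroup_kernel[OF ext_functional_group_hom]])
  then show "p \<in> H \<Longrightarrow> ext_functional c p = \<zero>\<^bsub>L\<^esub>" by (auto simp: kernel_def)
qed

end

text \<open>Both terms are additive in \<open>p\<close> modulo \<open>H\<close>, so a single
  generator \<open>frag_of (x, l)\<close> is enough; there \<open>x\<close> is expanded along
  \<open>e\<close> and the scalars \<open>c t x\<close> move across the tensor sign.\<close>

lemma coordinate_decomposition:
  assumes T: "finite T" and e: "\<And>t. t \<in> T \<Longrightarrow> e t \<in> carrier M"
    and lin: "\<And>t. t \<in> T \<Longrightarrow> linear_functional (c t)"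
    and span: "\<And>x. x \<in> carrier M \<Longrightarrow> x = (\<Oplus>\<^bsub>M\<^esub>t\<in>T. s (c t x) (e t))"
    and p: "p \<in> carrier free"
  shows "p - (\<Sum>t\<in>T. frag_of (e t, ext_functional (c t) p)) \<in> H"
proof -
  let ?\<Phi> = "\<lambda>t. ext_functional (c t)"
  have "Poly_Mapping.keys p \<subseteq> carrier M \<times> carrier L" using p by simp
  then show ?thesis
  proof (induction p rule: free_Abelian_group_induct_named)
    case zero
    then show ?case
      using uminus_in_H[OF sum_in_H[of T "\<lambda>t. frag_of (e t, \<zero>\<^bsub>L\<^esub>)"]] e
      by (simp add: ext_functional_zero lin frag_zero_right_in_H)
  next
    case (diff x y)
    \<comment> \<open>Additivity of the expansion in \<open>p\<close>: for each \<open>t\<close> one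
      relation in the second factor.\<close>
    have "frag_of (e t, ?\<Phi> t x) - frag_of (e t, ?\<Phi> t y) - frag_of (e t, ?\<Phi> t (x - y)) \<in> H"
      if t: "t \<in> T" for t
    proof -
      have "?\<Phi> t x = ?\<Phi> t (x - y) \<oplus>\<^bsub>L\<^esub> ?\<Phi> t y"
        using diff(1,2) t by (simp add: ext_functional_diff ext_functional_closed lin L.minus_eq L.a_assoc L.l_neg)
      then show ?thesis
        using frag_add_right_in_H[of "e t" "?\<Phi> t (x - y)" "?\<Phi> t y"] e t diff(1,2)
          ext_functional_closed[OF lin, of t y] ext_functional_closed[OF lin, of t "x - y"]
          keys_diff[of x y]
        by (auto simp: algebra_simps)
    qed
    then have "(\<Sum>t\<in>T. frag_of (e t, ?\<Phi> t x) - frag_of (e t, ?\<Phi> t y) - frag_of (e t, ?\<Phi> t (x - y))) \<in> H"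
      by (rule sum_in_H)
    from add_in_H[OF diff_in_H[OF diff(3,4)] this] show ?case
      by (simp add: sum_subtractf sum.distrib algebra_simps)
  next
    case (frag a)
    obtain x l where a: "a = (x, l)" "x \<in> carrier M" "l \<in> carrier L" using frag by auto
    have c: "c t x \<in> carrier F" if "t \<in> T" for t
      using lin[OF that] a by (simp add: linear_functional_def)
    have "frag_of (x, l) - (\<Sum>t\<in>T. frag_of (s (c t x) (e t), l)) \<in> H"
      by (subst span[OF a(2)], rule frag_finsum_in_H) (use T a c e s_closed in auto)
    moreover have "(\<Sum>t\<in>T. frag_of (s (c t x) (e t), l) - frag_of (e t, ?\<Phi> t (frag_of (x, l)))) \<in> H"
      using a c e by (intro sum_in_H) (simp add: ext_functional_frag lin frag_scalar_in_H)
    ultimately have "frag_of (x, l) - (\<Sum>t\<in>T. frag_of (s (c t x) (e t), l)) +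
      (\<Sum>t\<in>T. frag_of (s (c t x) (e t), l) - frag_of (e t, ?\<Phi> t (frag_of (x, l)))) \<in> H"
      by (rule add_in_H)
    then show ?case by (simp add: a sum_subtractf)
  qed
qed

text \<open>The test for being zero in the tensor product; its converse is
  \<open>ext_functional_H\<close>.\<close>

lemma coordinates_zero_imp_in_H:
  assumes "finite T" "\<And>t. t \<in> T \<Longrightarrow> e t \<in> carrier M"
    and "\<And>t. t \<in> T \<Longrightarrow> linear_functional (c t)"
    and "\<And>x. x \<in> carrier M \<Longrightarrow> x = (\<Oplus>\<^bsub>M\<^esub>t\<in>T. s (c t x) (e t))"
    and "p \<in> carrier free" "\<And>t. t \<in> T \<Longrightarrow> ext_functional (c t) p = \<zero>\<^bsub>L\<^esub>"
  shows "p \<in> H"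
proof -
  have "(\<Sum>t\<in>T. frag_of (e t, ext_functional (c t) p)) \<in> H"
    using assms by (intro sum_in_H) (simp add: frag_zero_right_in_H)
  from add_in_H[OF coordinate_decomposition[OF assms(1-5)] this] show ?thesis by simp
qed

end

section \<open>Bilinear maps on scalar extensions\<close>

definition frag_map2 ::
  "('l, 'n) ring_scheme \<Rightarrow> ('a \<Rightarrow> 'b \<Rightarrow> 'c) \<Rightarrow> (('a \<times> 'l) \<Rightarrow>\<^sub>0 int) \<Rightarrow> (('b \<times> 'l) \<Rightarrow>\<^sub>0 int) \<Rightarrow> (('c \<times> 'l) \<Rightarrow>\<^sub>0 int)"
  where "frag_map2 L f p q =
    frag_extend (\<lambda>(x, l). frag_extend (\<lambda>(y, l'). frag_of (f x y, l \<otimes>\<^bsub>L\<^esub> l')) q) p"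

lemma frag_map2_of:
  "frag_map2 L f (frag_of (x, l)) (frag_of (y, l')) = frag_of (f x y, l \<otimes>\<^bsub>L\<^esub> l')"
  by (simp add: frag_map2_def)

lemma frag_map2_diff_left: "frag_map2 L f (p - p') q = frag_map2 L f p q - frag_map2 L f p' q"
  by (simp add: frag_map2_def frag_extend_diff)

lemma frag_map2_diff_right: "frag_map2 L f p (q - q') = frag_map2 L f p q - frag_map2 L f p q'"
proof -
  \<comment> \<open>\<open>frag_extend\<close> is additive in the map as well as in its argument;
    here \<open>q\<close> sits inside the map.\<close>
  have "frag_extend (\<lambda>x. g x - g' x) p = frag_extend g p - frag_extend g' p"
    for g g' :: "'x \<Rightarrow> 'y \<Rightarrow>\<^sub>0 int" and p
    using subset_UNIV by (induction p rule: frag_induction) (auto simp: frag_extend_diff)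
  then show ?thesis by (simp add: frag_map2_def frag_extend_diff case_prod_unfold)
qed

lemma frag_map2_zero: "frag_map2 L f 0 q = 0" "frag_map2 L f p 0 = 0"
  using frag_map2_diff_left[of L f 0 0 q] frag_map2_diff_right[of L f p 0 0] by simp_all

lemma frag_map2_add: "frag_map2 L f (p + p') q = frag_map2 L f p q + frag_map2 L f p' q"
  "frag_map2 L f p (q + q') = frag_map2 L f p q + frag_map2 L f p q'"
  using frag_map2_diff_left[of L f "p + p'" p' q] frag_map2_diff_right[of L f p "q + q'" q']
  by (simp_all add: algebra_simps)

lemma frag_map2_sum:
  "frag_map2 L f (sum g A) (sum g' B) = (\<Sum>i\<in>A. \<Sum>j\<in>B. frag_map2 L f (g i) (g' j))"
proof -
  have left: "frag_map2 L f (sum g A) q = (\<Sum>i\<in>A. frag_map2 L f (g i) q)" for q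
    by (induction A rule: infinite_finite_induct) (auto simp: frag_map2_add frag_map2_zero)
  have right: "frag_map2 L f p (sum g' B) = (\<Sum>j\<in>B. frag_map2 L f p (g' j))" for p
    by (induction B rule: infinite_finite_induct) (auto simp: frag_map2_add frag_map2_zero)
  show ?thesis unfolding left by (simp only: right)
qed

text \<open>Instantiated with \<open>h\<close> on \<open>V\<close> and with the multiplication of
  \<open>D\<close>. A hermitian form is only sesquilinear over \<open>D\<close>, yet bilinear over
  \<open>k\<close>, whose elements are central and fixed by \<sigma>.\<close>

locale bilinear_extension =
  X: scalar_extension F L \<phi> M s + Y: scalar_extension F L \<phi> M' s' + Z: scalar_extension F L \<phi> N r
  for F :: "('f, 'p) ring_scheme" and L :: "('l, 'n) ring_scheme" and \<phi> :: "'f \<Rightarrow> 'l"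
    and M :: "('a, 'q) ring_scheme" and s and M' :: "('b, 'q1) ring_scheme" and s'
    and N :: "('c, 'q2) ring_scheme" and r +
  fixes f :: "'a \<Rightarrow> 'b \<Rightarrow> 'c"
  assumes f_closed: "\<lbrakk>x \<in> carrier M; y \<in> carrier M'\<rbrakk> \<Longrightarrow> f x y \<in> carrier N"
    and f_add_left: "\<lbrakk>x \<in> carrier M; x' \<in> carrier M; y \<in> carrier M'\<rbrakk> \<Longrightarrow>
      f (x \<oplus>\<^bsub>M\<^esub> x') y = f x y \<oplus>\<^bsub>N\<^esub> f x' y"
    and f_add_right: "\<lbrakk>x \<in> carrier M; y \<in> carrier M'; y' \<in> carrier M'\<rbrakk> \<Longrightarrow>
      f x (y \<oplus>\<^bsub>M'\<^esub> y') = f x y \<oplus>\<^bsub>N\<^esub> f x y'"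
    and f_scalar_left: "\<lbrakk>a \<in> carrier F; x \<in> carrier M; y \<in> carrier M'\<rbrakk> \<Longrightarrow> f (s a x) y = r a (f x y)"
    and f_scalar_right: "\<lbrakk>a \<in> carrier F; x \<in> carrier M; y \<in> carrier M'\<rbrakk> \<Longrightarrow> f x (s' a y) = r a (f x y)"
begin

lemma frag_map2_closed:
  assumes "p \<in> carrier X.free" "q \<in> carrier Y.free"
  shows "frag_map2 L f p q \<in> carrier Z.free"
proof -
  have "Poly_Mapping.keys (frag_map2 L f p q) \<subseteq> carrier N \<times> carrier L"
    unfolding frag_map2_def
    by (intro order_trans[OF keys_frag_extend] UN_least)
      (use assms in \<open>auto split: prod.splits dest!: keys_frag_extend[THEN subsetD]
        intro!: f_closed X.L.m_closed\<close>)
  then show ?thesis by simp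
qed

text \<open>For fixed \<open>q\<close> the elements sent into \<open>Z.H\<close> form a subgroup, so
  it suffices to treat the generating relations; for these an induction on \<open>q\<close> reduces
  to a single pair.\<close>

lemma frag_map2_H_left:
  assumes p: "p \<in> X.H" and q: "q \<in> carrier Y.free"
  shows "frag_map2 L f p q \<in> Z.H"
proof -
  let ?K = "{p \<in> carrier X.free. frag_map2 L f p q \<in> Z.H}"
  have K: "subgroup ?K X.free"
    using X.G.m_closed
    by (intro X.G.subgroupI)
      (auto simp: frag_map2_zero frag_map2_add Z.add_in_H Z.zero_in_H Z.uminus_in_H
        frag_map2_diff_left[of L f 0, simplified frag_map2_zero, simplified] intro!: exI[of _ 0])
  have "frag_map2 L f p' q \<in> Z.H" if p': "p' \<in> tensor_relations F L \<phi> M s" for p'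
  proof -
    have "Poly_Mapping.keys q \<subseteq> carrier M' \<times> carrier L" using q by simp
    then show ?thesis
    proof (induction q rule: free_Abelian_group_induct_named)
      case (frag y)
      show ?case
        using p' frag unfolding tensor_relations_def
        by (auto simp: frag_map2_diff_left frag_map2_of f_add_left f_scalar_left f_closed
            X.L.l_distr X.L.m_assoc intro!: Z.frag_add_left_in_H Z.frag_add_right_in_H Z.frag_scalar_in_H)
    qed (auto simp: frag_map2_zero frag_map2_diff_right Z.zero_in_H Z.diff_in_H)
  qed
  then have "X.H \<subseteq> ?K"
    unfolding tensor_subgroup_def[of F L \<phi> M]
    using X.relations_in_free by (intro X.G.generate_subgroup_incl[OF _ K]) blast
  with p show ?thesis by blast
qed

lemma frag_map2_H_right:
  assumes p: "p \<in> carrier X.free" and q: "q \<in> Y.H"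
  shows "frag_map2 L f p q \<in> Z.H"
proof -
  let ?K = "{q \<in> carrier Y.free. frag_map2 L f p q \<in> Z.H}"
  have K: "subgroup ?K Y.free"
    using Y.G.m_closed
    by (intro Y.G.subgroupI)
      (auto simp: frag_map2_zero frag_map2_add Z.add_in_H Z.zero_in_H Z.uminus_in_H
        frag_map2_diff_right[of L f p 0, simplified frag_map2_zero, simplified] intro!: exI[of _ 0])
  have "frag_map2 L f p q' \<in> Z.H" if q': "q' \<in> tensor_relations F L \<phi> M' s'" for q'
  proof -
    have "Poly_Mapping.keys p \<subseteq> carrier M \<times> carrier L" using p by simp
    then show ?thesis
    proof (induction p rule: free_Abelian_group_induct_named)
      case (frag y)
      \<comment> \<open>In the second variable the scalar has to be pulled past \<open>y'\<close>,
        which uses commutativity of \<open>L\<close>.\<close>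
      have "y' \<otimes>\<^bsub>L\<^esub> (\<phi> a \<otimes>\<^bsub>L\<^esub> l) = \<phi> a \<otimes>\<^bsub>L\<^esub> (y' \<otimes>\<^bsub>L\<^esub> l)"
        if "a \<in> carrier F" "y' \<in> carrier L" "l \<in> carrier L" for a y' l
        using that by (simp add: X.L.m_lcomm)
      then show ?case
        using q' frag unfolding tensor_relations_def
        by (auto simp: frag_map2_diff_right frag_map2_of f_add_right f_scalar_right f_closed
            X.L.r_distr intro!: Z.frag_add_left_in_H Z.frag_add_right_in_H Z.frag_scalar_in_H)
    qed (auto simp: frag_map2_zero frag_map2_diff_left Z.zero_in_H Z.diff_in_H)
  qed
  then have "Y.H \<subseteq> ?K"
    unfolding tensor_subgroup_def[of F L \<phi> M']
    using Y.relations_in_free by (intro Y.G.generate_subgroup_incl[OF _ K]) blast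
  with q show ?thesis by blast
qed

text \<open>Any two choices of representatives give the same class, so the union that defines
  \<open>tensor_map2\<close> collapses to one coset.\<close>

lemma tensor_map2_cls:
  assumes p: "p \<in> carrier X.free" and q: "q \<in> carrier Y.free"
  shows "tensor_map2 Z.cls L f (X.cls p) (Y.cls q) = Z.cls (frag_map2 L f p q)"
proof -
  have eq: "Z.cls (frag_map2 L f p' q') = Z.cls (frag_map2 L f p q)"
    if p': "p' \<in> X.cls p" and q': "q' \<in> Y.cls q" for p' q'
  proof -
    note P = X.mem_clsD[OF p' p] and Q = Y.mem_clsD[OF q' q]
    \<comment> \<open>The change of representatives is made one argument at a time: first from
      \<open>p\<close> to \<open>p'\<close>, then from \<open>q\<close> to
      \<open>q'\<close>.\<close>
    have "frag_map2 L f (p' - p) q' + frag_map2 L f p (q' - q) \<in> Z.H"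
      by (intro Z.add_in_H frag_map2_H_left frag_map2_H_right P Q p)
    then have "frag_map2 L f p' q' - frag_map2 L f p q \<in> Z.H"
      by (simp add: frag_map2_diff_left frag_map2_diff_right)
    then show ?thesis
      by (subst Z.cls_eq_iff) (intro frag_map2_closed P Q p q | assumption)+
  qed
  have "tensor_map2 Z.cls L f (X.cls p) (Y.cls q) = (\<Union>p'\<in>X.cls p. \<Union>q'\<in>Y.cls q. Z.cls (frag_map2 L f p' q'))"
    by (simp add: tensor_map2_def frag_map2_def)
  also have "\<dots> = (\<Union>p'\<in>X.cls p. \<Union>q'\<in>Y.cls q. Z.cls (frag_map2 L f p q))"
    by (intro SUP_cong refl eq)
  also have "\<dots> = Z.cls (frag_map2 L f p q)"
    using X.cls_self[OF p] Y.cls_self[OF q] by blast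
  finally show ?thesis .
qed

end

text \<open>Relations go to relations under the additive and \<open>F\<close>-linear
  \<open>f\<close>, so the image of a coset does not depend on the representative. Pure tensors are
  the elements on which \<sigma> tensor \<open>id\<close> is evaluated later.\<close>

lemma tensor_map_cls_frag:
  assumes M: "scalar_extension F L \<phi> M s"
    and f: "\<And>x. x \<in> carrier M \<Longrightarrow> f x \<in> carrier M"
      "\<And>x y. \<lbrakk>x \<in> carrier M; y \<in> carrier M\<rbrakk> \<Longrightarrow> f (x \<oplus>\<^bsub>M\<^esub> y) = f x \<oplus>\<^bsub>M\<^esub> f y"
      "\<And>a x. \<lbrakk>a \<in> carrier F; x \<in> carrier M\<rbrakk> \<Longrightarrow> f (s a x) = s a (f x)"
    and x: "x \<in> carrier M" and l: "l \<in> carrier L"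
  shows "tensor_map (tensor_class F L \<phi> M s) f (tensor_class F L \<phi> M s (frag_of (x, l)))
       = tensor_class F L \<phi> M s (frag_of (f x, l))"
proof -
  interpret X: scalar_extension F L \<phi> M s by fact
  let ?g = "frag_extend (\<lambda>(x, l). frag_of (f x, l))"
  have closed: "?g p \<in> carrier X.free" if "p \<in> carrier X.free" for p
  proof -
    have "Poly_Mapping.keys (?g p) \<subseteq> carrier M \<times> carrier L"
      by (intro order_trans[OF keys_frag_extend] UN_least)
        (use that f(1) in \<open>auto split: prod.splits\<close>)
    then show ?thesis by simp
  qed
  let ?K = "{p \<in> carrier X.free. ?g p \<in> X.H}"
  have K: "subgroup ?K X.free"
    using X.G.m_closed
    by (intro X.G.subgroupI)
      (auto simp: frag_extend_add frag_extend_minus X.add_in_H X.zero_in_H X.uminus_in_H intro!: exI[of _ 0])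
  have "tensor_relations F L \<phi> M s \<subseteq> ?K"
  proof
    fix r assume r: "r \<in> tensor_relations F L \<phi> M s"
    then have "?g r \<in> X.H"
      unfolding tensor_relations_def
      by (auto simp: frag_extend_diff f
          intro!: X.frag_add_left_in_H X.frag_add_right_in_H X.frag_scalar_in_H)
    with r X.relations_in_free show "r \<in> ?K" by blast
  qed
  then have "generate X.free (tensor_relations F L \<phi> M s) \<subseteq> ?K"
    by (intro X.G.generate_subgroup_incl[OF _ K])
  then have HK: "X.H \<subseteq> ?K"
    by (simp only: tensor_subgroup_def)
  have xl: "frag_of (x, l) \<in> carrier X.free" using x l by simp
  have "X.cls (?g p) = X.cls (frag_of (f x, l))" if p: "p \<in> X.cls (frag_of (x, l))" for p
  proof -
    note P = X.mem_clsD[OF p xl]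
    have "?g p - ?g (frag_of (x, l)) \<in> X.H"
      using HK P(2) by (auto simp: frag_extend_diff)
    then show ?thesis
      using closed[OF P(1)] f(1)[OF x] l by (subst X.cls_eq_iff) auto
  qed
  then show ?thesis
    using X.cls_self[OF xl] by (auto simp: tensor_map_def)
qed

section \<open>Bases of eigenspaces of the involution\<close>

text \<open>Bridge from list combinations to indexed sums; the induction runs over prefixes of the
  two lists.\<close>

lemma (in ring) combine_eq_finsum:
  assumes "length Ks = length Us" "set Ks \<subseteq> carrier R" "set Us \<subseteq> carrier R"
  shows "combine Ks Us = (\<Oplus>t\<in>{..<length Us}. Ks ! t \<otimes> Us ! t)"
proof -
  have "combine (take n Ks) (take n Us) = (\<Oplus>t\<in>{..<n}. Ks ! t \<otimes> Us ! t)" if "n \<le> length Us" for n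
    using that
  proof (induction n)
    case (Suc n)
    have in_R: "Ks ! t \<in> carrier R" "Us ! t \<in> carrier R" if "t \<le> n" for t
      using that Suc.prems assms by (auto simp: subset_iff)
    have sub: "set (take n Ks) \<subseteq> carrier R" "set (take n Us) \<subseteq> carrier R"
      using assms set_take_subset by fast+
    have "combine (take (Suc n) Ks) (take (Suc n) Us)
        = combine (take n Ks) (take n Us) \<oplus> combine [Ks ! n] [Us ! n]"
      using Suc.prems assms(1) sub in_R[of n]
      by (subst combine_append) (auto simp: take_Suc_conv_app_nth)
    also have "\<dots> = (\<Oplus>t\<in>{..<Suc n}. Ks ! t \<otimes> Us ! t)"
      using Suc in_R by (simp add: lessThan_Suc finsum_insert Pi_def a_comm finsum_closed)
    finally show ?case .
  qed simp
  from this[of "length Us"] show ?thesis using assms(1) by simp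
qed

text \<open>A basis of the ring over \<open>F\<close> packaged with its dual basis: spanning is the
  third clause, linear independence the last, in the form of uniqueness of coefficients.\<close>

definition (in ring) coordinate_system :: "'a set \<Rightarrow> nat \<Rightarrow> (nat \<Rightarrow> 'a) \<Rightarrow> (nat \<Rightarrow> 'a \<Rightarrow> 'a) \<Rightarrow> bool" where
  "coordinate_system F m e c \<longleftrightarrow>
     (\<forall>t<m. e t \<in> carrier R) \<and> (\<forall>t<m. \<forall>x\<in>carrier R. c t x \<in> F) \<and>
     (\<forall>x\<in>carrier R. x = (\<Oplus>t\<in>{..<m}. c t x \<otimes> e t)) \<and>
     (\<forall>a. (\<forall>t<m. a t \<in> F) \<longrightarrow> (\<forall>t<m. c t (\<Oplus>u\<in>{..<m}. a u \<otimes> e u) = a t))"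

lemma (in ring) basis_coordinates:
  assumes F: "subfield F R" and indep: "independent F Ws" and span: "Span F Ws = carrier R"
  obtains c where "coordinate_system F (length Ws) ((!) Ws) c"
proof -
  have FR: "F \<subseteq> carrier R" by (rule subfieldE(3)[OF F])
  have Ws: "set Ws \<subseteq> carrier R" by (rule independent_in_carrier[OF indep])
  let ?P = "\<lambda>x Ks. set Ks \<subseteq> F \<and> length Ks = length Ws \<and> x = combine Ks Ws"
  have uniq: "\<exists>!Ks. ?P x Ks" if "x \<in> carrier R" for x
    using unique_decomposition[OF F indep] that span by blast
  define C where "C x = (THE Ks. ?P x Ks)" for x
  define c where "c t x = C x ! t" for t x
  have P: "?P x (C x)" if "x \<in> carrier R" for x
    using theI'[OF uniq[OF that]] unfolding C_def .
  show ?thesis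
  proof (rule that[of c], unfold coordinate_system_def, intro conjI allI impI ballI)
    show "Ws ! t \<in> carrier R" if "t < length Ws" for t
      using that Ws by auto
    show "c t x \<in> F" if "t < length Ws" "x \<in> carrier R" for t x
      using P[OF that(2)] that(1) nth_mem[of t "C x"] unfolding c_def by auto
    show "x = (\<Oplus>t\<in>{..<length Ws}. c t x \<otimes> Ws ! t)" if "x \<in> carrier R" for x
    proof -
      note Q = P[OF that]
      have "x = combine (C x) Ws" using Q by blast
      also have "\<dots> = (\<Oplus>t\<in>{..<length Ws}. c t x \<otimes> Ws ! t)"
        unfolding c_def using Q FR Ws by (intro combine_eq_finsum) auto
      finally show ?thesis .
    qed
    show "c t (\<Oplus>t\<in>{..<length Ws}. a t \<otimes> Ws ! t) = a t"
      if a: "\<forall>t<length Ws. a t \<in> F" and t: "t < length Ws" for a t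
    proof -
      let ?x = "\<Oplus>t\<in>{..<length Ws}. a t \<otimes> Ws ! t" and ?Ks = "map a [0..<length Ws]"
      have "combine ?Ks Ws = (\<Oplus>t\<in>{..<length Ws}. ?Ks ! t \<otimes> Ws ! t)"
        using a FR Ws by (intro combine_eq_finsum) auto
      also have "\<dots> = ?x"
        using a FR Ws by (intro finsum_cong') (auto simp: subset_iff)
      finally have eq: "?x = combine ?Ks Ws" by simp
      have x: "?x \<in> carrier R" unfolding eq using a FR Ws by (intro combine_in_carrier) auto
      have "?P ?x ?Ks" using a eq by auto
      with uniq[OF x] P[OF x] have "C ?x = ?Ks" by blast
      then show ?thesis using t by (simp add: c_def)
    qed
  qed
qed

context ring
begin

context
  fixes F m e c assumes cs: "coordinate_system F m e c" and sub: "subring F R"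
begin

lemma coordinate_system_closed: "t < m \<Longrightarrow> e t \<in> carrier R" "\<lbrakk>t < m; x \<in> carrier R\<rbrakk> \<Longrightarrow> c t x \<in> F"
  and coordinate_system_expand: "x \<in> carrier R \<Longrightarrow> x = (\<Oplus>t\<in>{..<m}. c t x \<otimes> e t)"
  and coordinate_system_unique:
    "\<lbrakk>\<And>t. t < m \<Longrightarrow> a t \<in> F; t < m\<rbrakk> \<Longrightarrow> c t (\<Oplus>u\<in>{..<m}. a u \<otimes> e u) = a t"
  using cs by (auto simp: coordinate_system_def)

lemma coordinate_system_closed_carrier: "\<lbrakk>t < m; x \<in> carrier R\<rbrakk> \<Longrightarrow> c t x \<in> carrier R"
  using coordinate_system_closed(2) subringE(1)[OF sub] by blast

text \<open>Follows from uniqueness, because the coefficientwise sum also expands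
  \<open>x \<oplus> y\<close>; the scalar law below has the same proof.\<close>

lemma coordinate_system_add:
  assumes "t < m" "x \<in> carrier R" "y \<in> carrier R" shows "c t (x \<oplus> y) = c t x \<oplus> c t y"
proof -
  have "x \<oplus> y = (\<Oplus>t\<in>{..<m}. c t x \<otimes> e t) \<oplus> (\<Oplus>t\<in>{..<m}. c t y \<otimes> e t)"
    using coordinate_system_expand assms by simp
  also have "\<dots> = (\<Oplus>t\<in>{..<m}. (c t x \<oplus> c t y) \<otimes> e t)"
    using assms coordinate_system_closed coordinate_system_closed_carrier
    by (subst finsum_addf[symmetric], force, force, intro finsum_cong') (auto simp: l_distr)
  finally show ?thesis
    using coordinate_system_unique[of "\<lambda>t. c t x \<oplus> c t y"] assms coordinate_system_closed(2)
      subringE(7)[OF sub] by simp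
qed

lemma coordinate_system_scale:
  assumes "t < m" "x \<in> carrier R" "a \<in> F" shows "c t (a \<otimes> x) = a \<otimes> c t x"
proof -
  have a: "a \<in> carrier R" using assms subringE(1)[OF sub] by blast
  have "a \<otimes> x = a \<otimes> (\<Oplus>t\<in>{..<m}. c t x \<otimes> e t)"
    using coordinate_system_expand assms by simp
  also have "\<dots> = (\<Oplus>t\<in>{..<m}. (a \<otimes> c t x) \<otimes> e t)"
    using assms a coordinate_system_closed coordinate_system_closed_carrier
    by (subst finsum_rdistr) (auto simp: m_assoc intro!: finsum_cong')
  finally show ?thesis
    using coordinate_system_unique[of "\<lambda>t. a \<otimes> c t x"] assms coordinate_system_closed(2)
      subringE(6)[OF sub] by simp
qed

lemma coordinate_system_basis:
  assumes "t < m" "u < m" shows "c t (e u) = (if t = u then \<one> else \<zero>)"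
proof -
  have "(\<Oplus>t\<in>{..<m}. (if t = u then \<one> else \<zero>) \<otimes> e t) = e u"
    using assms coordinate_system_closed(1) by (intro finsum_delta[where i = u]) auto
  then show ?thesis
    using coordinate_system_unique[of "\<lambda>t. if t = u then \<one> else \<zero>" t] assms subringE(2,3)[OF sub] by simp
qed

lemma coordinate_system_minus:
  assumes "t < m" "x \<in> carrier R" "y \<in> carrier R" "c t (x \<oplus> y) = \<zero>" shows "c t x = \<ominus> c t y"
  using coordinate_system_add[OF assms(1-3)] coordinate_system_closed_carrier assms
  by (simp add: minus_equality)

end

end

section \<open>Center, fixed field and eigenspaces of the involution\<close>

locale division_involution = involution D \<sigma> for D (structure) and \<sigma> +
  assumes units: "Units D = carrier D - {\<zero>}"
    and two_nonzero: "\<one> \<oplus> \<one> \<noteq> \<zero>"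
    and fixed_is_field: "field (fixed_field D \<sigma>)"
begin

abbreviation "K \<equiv> ring_center D"
abbreviation "k \<equiv> {x \<in> K. \<sigma> x = x}"

lemma K_closed: "a \<in> K \<Longrightarrow> a \<in> carrier D"
  and K_comm: "\<lbrakk>a \<in> K; x \<in> carrier D\<rbrakk> \<Longrightarrow> x \<otimes> a = a \<otimes> x"
  by (auto simp: ring_center_def)

lemma K_memI: "\<lbrakk>a \<in> carrier D; \<And>x. x \<in> carrier D \<Longrightarrow> a \<otimes> x = x \<otimes> a\<rbrakk> \<Longrightarrow> a \<in> K"
  unfolding ring_center_def by blast

lemma one_not_zero: "\<one> \<noteq> \<zero>"
  using units Units_one_closed by blast

lemma integral:
  assumes "a \<otimes> b = \<zero>" "a \<in> carrier D" "b \<in> carrier D" shows "a = \<zero> \<or> b = \<zero>"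
proof (rule disjCI)
  assume "b \<noteq> \<zero>"
  then have b: "b \<in> Units D" using units assms by simp
  have "a = a \<otimes> (b \<otimes> inv b)" using b assms by simp
  also have "\<dots> = a \<otimes> b \<otimes> inv b" using b assms(2,3) by (simp only: m_assoc Units_inv_closed)
  also have "\<dots> = \<zero>" using b assms(1) by simp
  finally show "a = \<zero>" .
qed

lemma subfield_K: "subfield K D"
proof (rule subfieldI)
  have "subring K D"
  proof (rule subringI)
    show "\<ominus> h \<in> K" if "h \<in> K" for h
      using that by (auto simp: ring_center_def l_minus r_minus)
    show "h1 \<otimes> h2 \<in> K" if "h1 \<in> K" "h2 \<in> K" for h1 h2
    proof -
      have h: "h1 \<in> carrier D" "h2 \<in> carrier D" using that K_closed by auto
      have "h1 \<otimes> h2 \<otimes> y = y \<otimes> (h1 \<otimes> h2)" if y: "y \<in> carrier D" for y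
      proof -
        have "h1 \<otimes> h2 \<otimes> y = h1 \<otimes> (y \<otimes> h2)"
          using h y K_comm[OF \<open>h2 \<in> K\<close> y] by (simp add: m_assoc)
        also have "\<dots> = h1 \<otimes> y \<otimes> h2" using h y by (simp add: m_assoc)
        also have "\<dots> = y \<otimes> (h1 \<otimes> h2)"
          using h y K_comm[OF \<open>h1 \<in> K\<close> y, symmetric] by (simp add: m_assoc)
        finally show ?thesis .
      qed
      then show ?thesis using h by (intro K_memI) auto
    qed
    show "h1 \<oplus> h2 \<in> K" if "h1 \<in> K" "h2 \<in> K" for h1 h2
      using that by (auto simp: ring_center_def l_distr r_distr)
  qed (auto simp: ring_center_def)
  then show "subcring K D"
    by (rule subcringI) (simp add: K_comm K_closed)
  show "Units (D\<lparr>carrier := K\<rparr>) = K - {\<zero>}"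
  proof (intro equalityI subsetI)
    fix x assume "x \<in> Units (D\<lparr>carrier := K\<rparr>)"
    then obtain y where "x \<in> K" "y \<in> K" "x \<otimes> y = \<one>" by (auto simp: Units_def)
    then show "x \<in> K - {\<zero>}" using one_not_zero K_closed by auto
  next
    fix x assume x: "x \<in> K - {\<zero>}"
    then have u: "x \<in> Units D" using units K_closed by auto
    have "inv x \<otimes> y = y \<otimes> inv x" if y: "y \<in> carrier D" for y
    proof -
      have xD: "x \<in> carrier D" "inv x \<in> carrier D" using u by auto
      have "inv x \<otimes> y = inv x \<otimes> (y \<otimes> x) \<otimes> inv x"
        using u xD y by (simp add: m_assoc)
      also have "\<dots> = inv x \<otimes> (x \<otimes> y) \<otimes> inv x" using x y by (simp add: K_comm)
      also have "\<dots> = y \<otimes> inv x" using u xD y by (simp add: m_assoc[symmetric])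
      finally show ?thesis .
    qed
    then have "inv x \<in> K" using u by (intro K_memI) auto
    then show "x \<in> Units (D\<lparr>carrier := K\<rparr>)"
      using x Units_l_inv[OF u] Units_r_inv[OF u] by (auto simp: Units_def)
  qed
qed

text \<open>That \<open>k\<close> is a field comes with \<open>A_field\<close> and is an axiom of
  the locale; here it is transferred to a statement inside \<open>D\<close>.\<close>

lemma subfield_k: "subfield k D"
  using fixed_is_field K_closed by (intro subfield_iff(1)) (auto simp: fixed_field_def)

lemma k_closed: "a \<in> k \<Longrightarrow> a \<in> carrier D"
  using K_closed by blast

lemma one_in_k: "\<one> \<in> k" and uminus_in_k: "a \<in> k \<Longrightarrow> \<ominus> a \<in> k"
  and add_in_k: "\<lbrakk>a \<in> k; b \<in> k\<rbrakk> \<Longrightarrow> a \<oplus> b \<in> k"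
  using subringE(3,5,7)[OF subfieldE(1)[OF subfield_k]] by auto

lemma inv_zero: "\<sigma> \<zero> = \<zero>"
  using inv_add[of \<zero> \<zero>] inv_closed[of \<zero>] by (metis l_zero add.r_cancel_one zero_closed)

lemma inv_minus: "x \<in> carrier D \<Longrightarrow> \<sigma> (\<ominus> x) = \<ominus> \<sigma> x"
  using inv_add[of "\<ominus> x" x] inv_zero by (metis a_inv_closed inv_closed l_neg minus_equality)

lemma inv_scalar: "\<lbrakk>a \<in> k; x \<in> carrier D\<rbrakk> \<Longrightarrow> \<sigma> (a \<otimes> x) = a \<otimes> \<sigma> x"
  by (simp add: inv_mult K_closed K_comm inv_closed)

definition eigenspace :: "'a \<Rightarrow> 'a set" where
  "eigenspace \<epsilon> = {x \<in> carrier D. \<sigma> x = \<epsilon> \<otimes> x}"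

lemma sign_in_k: "\<epsilon> \<in> {\<one>, \<ominus> \<one>} \<Longrightarrow> \<epsilon> \<in> k"
  using one_in_k uminus_in_k by blast

lemma sign_square: "\<epsilon> \<in> {\<one>, \<ominus> \<one>} \<Longrightarrow> \<epsilon> \<otimes> \<epsilon> = \<one>"
  by (auto simp: l_minus)

text \<open>\<open>subalgebra k\<close> asks for a \<open>k\<close>-subspace, not for closure under
  products; in this form the dimension theory accepts the eigenspaces.\<close>

lemma subalgebra_eigenspace:
  assumes "\<epsilon> \<in> k" shows "subalgebra k (eigenspace \<epsilon>) D"
proof -
  have \<epsilon>: "\<epsilon> \<in> carrier D" using assms k_closed by blast
  have "subgroup (eigenspace \<epsilon>) (add_monoid D)"
  proof (rule add.subgroupI)
    have "\<zero> \<in> eigenspace \<epsilon>" using \<epsilon> inv_zero by (simp add: eigenspace_def)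
    then show "eigenspace \<epsilon> \<noteq> {}" by blast
  qed (use \<epsilon> in \<open>auto simp: eigenspace_def inv_add inv_minus r_distr r_minus\<close>)
  moreover have "a \<otimes> x \<in> eigenspace \<epsilon>" if "a \<in> k" "x \<in> eigenspace \<epsilon>" for a x
    using that \<epsilon> K_comm[of a \<epsilon>] K_closed[of a]
    by (auto simp: eigenspace_def inv_scalar m_assoc[symmetric])
  ultimately show ?thesis by (auto simp: subalgebra_def subalgebra_axioms_def)
qed

lemma double_eq_zero: "\<lbrakk>x \<in> carrier D; x = \<ominus> x\<rbrakk> \<Longrightarrow> x = \<zero>"
proof -
  assume x: "x \<in> carrier D" "x = \<ominus> x"
  then have "(\<one> \<oplus> \<one>) \<otimes> x = \<zero>" by (metis l_distr l_one one_closed r_neg)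
  then show "x = \<zero>" using integral[of "\<one> \<oplus> \<one>" x] x two_nonzero by auto
qed

text \<open>A common element \<open>x\<close> makes \<epsilon> x equal to its own negative, and 2 is
  nonzero in the division ring; then \<epsilon>, whose square is 1, cancels.\<close>

lemma eigenspaces_inter:
  assumes "\<epsilon> \<in> {\<one>, \<ominus> \<one>}" shows "eigenspace \<epsilon> \<inter> eigenspace (\<ominus> \<epsilon>) = {\<zero>}"
proof -
  have \<epsilon>: "\<epsilon> \<in> carrier D" using assms by auto
  have "x = \<zero>" if "x \<in> carrier D" "\<sigma> x = \<epsilon> \<otimes> x" "\<sigma> x = \<ominus> \<epsilon> \<otimes> x" for x
  proof -
    have "\<epsilon> \<otimes> x = \<zero>"
      using that \<epsilon> by (intro double_eq_zero) (auto simp: l_minus)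
    then have "\<epsilon> \<otimes> \<epsilon> \<otimes> x = \<zero>" using \<epsilon> that by (simp add: m_assoc)
    then show ?thesis using that by (simp add: sign_square[OF assms])
  qed
  then show ?thesis using \<epsilon> inv_zero by (auto simp: eigenspace_def)
qed

text \<open>The decomposition is x = (x + \<epsilon> \<sigma>(x)) / 2 + (x - \<epsilon> \<sigma>(x))
  / 2.\<close>

lemma eigenspaces_sum:
  assumes "\<epsilon> \<in> {\<one>, \<ominus> \<one>}"
  shows "eigenspace \<epsilon> <+>\<^bsub>D\<^esub> eigenspace (\<ominus> \<epsilon>) = carrier D"
proof -
  have \<epsilon>: "\<epsilon> \<in> carrier D" "\<epsilon> \<in> k" "\<ominus> \<epsilon> \<in> k" using assms sign_in_k uminus_in_k by auto
  note alg = subalgebra_eigenspace[OF \<epsilon>(2)] subalgebra_eigenspace[OF \<epsilon>(3)]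
  have two: "\<one> \<oplus> \<one> \<in> k - {\<zero>}" using one_in_k add_in_k two_nonzero by auto
  \<comment> \<open>One half; it lies in \<open>k\<close>, so scaling by it stays inside the
    eigenspaces.\<close>
  define a where "a = inv (\<one> \<oplus> \<one>)"
  have a: "a \<in> k" "a \<otimes> (\<one> \<oplus> \<one>) = \<one>" "a \<in> carrier D"
    using subfield_m_inv[OF subfield_k two] K_closed by (auto simp: a_def)
  have "x \<in> eigenspace \<epsilon> <+>\<^bsub>D\<^esub> eigenspace (\<ominus> \<epsilon>)" if x: "x \<in> carrier D" for x
  proof -
    have \<sigma>x: "\<sigma> x \<in> carrier D" using inv_closed x .
    have \<epsilon>\<epsilon>: "\<epsilon> \<otimes> (\<epsilon> \<otimes> y) = y" if "y \<in> carrier D" for y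
      using that \<epsilon> sign_square[OF assms] by (simp add: m_assoc[symmetric])
    have "x \<oplus> \<epsilon> \<otimes> \<sigma> x \<in> eigenspace \<epsilon>" "x \<ominus> \<epsilon> \<otimes> \<sigma> x \<in> eigenspace (\<ominus> \<epsilon>)"
      using x \<sigma>x \<epsilon> by (auto simp: eigenspace_def a_minus_def inv_add inv_minus inv_scalar
          inv_inv r_distr l_minus r_minus \<epsilon>\<epsilon> a_comm minus_minus)
    then have "a \<otimes> (x \<oplus> \<epsilon> \<otimes> \<sigma> x) \<in> eigenspace \<epsilon>" "a \<otimes> (x \<ominus> \<epsilon> \<otimes> \<sigma> x) \<in> eigenspace (\<ominus> \<epsilon>)"
      using subalgebra.smult_closed[OF alg(1) a(1)] subalgebra.smult_closed[OF alg(2) a(1)] by auto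
    moreover have "a \<otimes> (x \<oplus> \<epsilon> \<otimes> \<sigma> x) \<oplus> a \<otimes> (x \<ominus> \<epsilon> \<otimes> \<sigma> x) = x"
    proof -
      have "a \<otimes> (x \<oplus> \<epsilon> \<otimes> \<sigma> x) \<oplus> a \<otimes> (x \<ominus> \<epsilon> \<otimes> \<sigma> x)
          = a \<otimes> ((x \<oplus> \<epsilon> \<otimes> \<sigma> x) \<oplus> (x \<ominus> \<epsilon> \<otimes> \<sigma> x))"
        using a(3) x \<sigma>x \<epsilon>(1) by (simp add: r_distr)
      also have "(x \<oplus> \<epsilon> \<otimes> \<sigma> x) \<oplus> (x \<ominus> \<epsilon> \<otimes> \<sigma> x) = x \<oplus> x"
        using x \<sigma>x \<epsilon>(1) by (simp add: a_minus_def a_ac r_neg r_neg1)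
      also have "\<dots> = (\<one> \<oplus> \<one>) \<otimes> x" using x by (simp add: l_distr)
      also have "a \<otimes> \<dots> = x" using a x by (simp add: m_assoc[symmetric])
      finally show ?thesis .
    qed
    ultimately show ?thesis unfolding set_add_def' by (auto intro: sym)
  qed
  moreover have "eigenspace \<epsilon> <+>\<^bsub>D\<^esub> eigenspace (\<ominus> \<epsilon>) \<subseteq> carrier D"
    by (auto simp: set_add_def' eigenspace_def)
  ultimately show ?thesis by blast
qed

text \<open>The last two conditions say that the first \<open>p\<close> vectors are a basis of the eigenspace.\<close>

definition eigen_coordinates :: "'a \<Rightarrow> nat \<Rightarrow> nat \<Rightarrow> (nat \<Rightarrow> 'a) \<Rightarrow> (nat \<Rightarrow> 'a \<Rightarrow> 'a) \<Rightarrow> bool" where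
  "eigen_coordinates \<epsilon> m p e c \<longleftrightarrow> coordinate_system k m e c \<and> p \<le> m \<and>
     (\<forall>t<p. e t \<in> eigenspace \<epsilon>) \<and>
     (\<forall>t x. p \<le> t \<and> t < m \<and> x \<in> eigenspace \<epsilon> \<longrightarrow> c t x = \<zero>)"

text \<open>For an involution of the second kind the two eigenspaces are isomorphic by multiplication
  with a central \<open>w\<close> such that \<open>\<sigma> w = -w\<close>.\<close>

lemma eigen_coordinates_exist:
  assumes \<epsilon>: "\<epsilon> \<in> {\<one>, \<ominus> \<one>}" and dim: "dimension m k (carrier D)"
  obtains p e c where "eigen_coordinates \<epsilon> m p e c" "\<not> first_kind D \<sigma> \<Longrightarrow> 2 * p \<le> m"
proof -
  have \<epsilon>k: "\<epsilon> \<in> k" "\<ominus> \<epsilon> \<in> k" using \<epsilon> sign_in_k uminus_in_k by auto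
  note alg = subalgebra_eigenspace[OF \<epsilon>k(1)] subalgebra_eigenspace[OF \<epsilon>k(2)]
  have fin: "finite_dimension k (carrier D)" using dim by (rule finite_dimensionI)
  have "finite_dimension k (eigenspace \<epsilon>)" "finite_dimension k (eigenspace (\<ominus> \<epsilon>))"
    using alg by (auto intro!: subalbegra_incl_imp_finite_dimension[OF subfield_k fin]
        simp: eigenspace_def)
  then obtain p q where p: "dimension p k (eigenspace \<epsilon>)" and q: "dimension q k (eigenspace (\<ominus> \<epsilon>))"
    unfolding finite_dimension_def by blast
  obtain Us where Us: "set Us \<subseteq> carrier D" "independent k Us" "length Us = p" "Span k Us = eigenspace \<epsilon>"
    using exists_base[OF subfield_k p] by blast
  obtain Vs where Vs: "set Vs \<subseteq> carrier D" "independent k Vs" "length Vs = q" "Span k Vs = eigenspace (\<ominus> \<epsilon>)"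
    using exists_base[OF subfield_k q] by blast
  define Ws where "Ws = Us @ Vs"
  have Ws: "independent k Ws"
    unfolding Ws_def using Us Vs eigenspaces_inter[OF \<epsilon>]
    by (intro independent_append[OF subfield_k]) auto
  have span: "Span k Ws = carrier D"
    unfolding Ws_def using Us Vs eigenspaces_sum[OF \<epsilon>]
    by (subst Span_append_eq_set_add[OF subfield_k]) auto
  have len: "length Ws = m"
    using dimension_is_inj[OF subfield_k dim] dimensionI[OF subfield_k Ws span] by simp
  then have m: "m = p + q" using Us Vs by (simp add: Ws_def)
  have WsR: "Ws ! t \<in> carrier D" if "t < m" for t
    using independent_in_carrier[OF Ws] that len by (auto simp: subset_iff)
  obtain c where c: "coordinate_system k m ((!) Ws) c"
    using basis_coordinates[OF subfield_k Ws span] len by metis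
  have "eigen_coordinates \<epsilon> m p ((!) Ws) c"
    unfolding eigen_coordinates_def
  proof (intro conjI allI impI)
    show "coordinate_system k m ((!) Ws) c" by (fact c)
    show "p \<le> m" using m by simp
    show "Ws ! t \<in> eigenspace \<epsilon>" if "t < p" for t
      using that Us Span_base_incl[OF subfield_k Us(1)] by (auto simp: Ws_def nth_append)
    show "c t x = \<zero>" if tx: "p \<le> t \<and> t < m \<and> x \<in> eigenspace \<epsilon>" for t x
    proof -
      from tx have t: "p \<le> t" "t < m" and x: "x \<in> eigenspace \<epsilon>" by auto
      obtain Ks where Ks: "set Ks \<subseteq> k" "length Ks = p" "x = combine Ks Us"
        using x Span_mem_iff_length_version[OF subfield_k Us(1)] Us by auto
      \<comment> \<open>Coefficients of \<open>x\<close> in the basis \<open>Us\<close> of its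
        eigenspace, padded by 0 at the places of \<open>Vs\<close>; uniqueness identifies them with
        the coordinates of \<open>x\<close>.\<close>
      define a where "a t = (if t < p then Ks ! t else \<zero>)" for t
      have ak: "a t \<in> k" for t
        using Ks subringE(2)[OF subfieldE(1)[OF subfield_k]] by (auto simp: a_def subset_iff)
      have "(\<Oplus>t\<in>{..<m}. a t \<otimes> Ws ! t) = (\<Oplus>t\<in>{..<p}. Ks ! t \<otimes> Us ! t)"
        using m ak k_closed WsR Us(3) Vs(1,3)
        by (intro add.finprod_mono_neutral_cong_right)
          (auto simp: a_def Ws_def nth_append subset_iff intro!: l_null)
      also have "\<dots> = x"
        using Ks Us k_closed by (subst Ks(3), subst combine_eq_finsum) auto
      finally show ?thesis
        using coordinate_system_unique[OF c subfieldE(1)[OF subfield_k], of a t] ak t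
        by (simp add: a_def)
    qed
  qed
  moreover have "2 * p \<le> m" if nf: "\<not> first_kind D \<sigma>"
  proof -
    obtain u where u: "u \<in> K" "\<sigma> u \<noteq> u" using nf by (auto simp: first_kind_def)
    have \<sigma>u: "\<sigma> u \<in> K"
    proof -
      have "\<sigma> u \<otimes> y = y \<otimes> \<sigma> u" if "y \<in> carrier D" for y
        using that u K_closed K_comm[of u "\<sigma> y"]
        by (metis inv_closed inv_inv inv_mult)
      then show ?thesis using u K_closed inv_closed by (blast intro: K_memI)
    qed
    \<comment> \<open>\<sigma> swaps \<open>u\<close> and \<open>\<sigma> u\<close>, so their
      difference is central, nonzero and skew.\<close>
    define w where "w = u \<ominus> \<sigma> u"
    have w: "w \<in> K" "w \<noteq> \<zero>" "\<sigma> w = \<ominus> w"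
    proof -
      show "w \<in> K"
        unfolding w_def a_minus_def
        using u \<sigma>u subringE(5,7)[OF subfieldE(1)[OF subfield_K]] by blast
      show "w \<noteq> \<zero>" using u K_closed inv_closed by (simp add: w_def)
      show "\<sigma> w = \<ominus> w"
        using u K_closed inv_closed
        by (simp add: w_def a_minus_def inv_add inv_minus inv_inv minus_add minus_minus a_comm)
    qed
    \<comment> \<open>Injectivity into the other eigenspace gives \<open>p \<le> q\<close>, hence
      \<open>2 * p \<le> p + q = m\<close>.\<close>
    let ?Xs = "map (\<lambda>x. x \<otimes> w) Us"
    have wD: "w \<in> carrier D" using w K_closed by blast
    have "independent k ?Xs"
    proof (rule trivial_combine_imp_independent[OF subfield_k])
      show "set ?Xs \<subseteq> carrier D" using Us(1) wD by auto
      fix Ks assume Ks: "set Ks \<subseteq> k" "combine Ks ?Xs = \<zero>"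
      have KsD: "set Ks \<subseteq> carrier D" using Ks k_closed by blast
      have "combine Ks Us \<otimes> w = \<zero>" using Ks combine_l_distr[OF KsD Us(1) wD] by simp
      then have "combine Ks Us = \<zero>"
        using integral[of "combine Ks Us" w] w wD combine_in_carrier[OF KsD Us(1)] by auto
      then show "set (take (length ?Xs) Ks) \<subseteq> {\<zero>}"
        using independent_imp_trivial_combine[OF subfield_k Us(2) Ks(1)] by simp
    qed
    moreover have "set ?Xs \<subseteq> eigenspace (\<ominus> \<epsilon>)"
    proof -
      have "x \<otimes> w \<in> eigenspace (\<ominus> \<epsilon>)" if "x \<in> eigenspace \<epsilon>" for x
      proof -
        have x: "x \<in> carrier D" "\<sigma> x = \<epsilon> \<otimes> x" using that by (auto simp: eigenspace_def)
        have "\<sigma> (x \<otimes> w) = \<ominus> (w \<otimes> (\<epsilon> \<otimes> x))"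
          using x w wD \<epsilon>k K_closed by (simp add: inv_mult l_minus)
        also have "w \<otimes> (\<epsilon> \<otimes> x) = \<epsilon> \<otimes> x \<otimes> w"
          using x w \<epsilon>k K_closed by (subst K_comm[OF w(1)]) auto
        finally show ?thesis
          using x wD \<epsilon>k K_closed by (simp add: eigenspace_def l_minus m_assoc)
      qed
      then show ?thesis using Us Span_base_incl[OF subfield_k Us(1)] by auto
    qed
    ultimately have "length ?Xs \<le> q"
      by (rule independent_length_le_dimension[OF subfield_k q])
    then show ?thesis using m Us by simp
  qed
  ultimately show ?thesis by (rule that)
qed

end

section \<open>Anisotropic spaces and systems of quadratic forms\<close>

context right_module
begin

lemma rsmult_zero: "a \<in> carrier D \<Longrightarrow> a \<odot>\<^bsub>V\<^esub> \<zero>\<^bsub>V\<^esub> = \<zero>\<^bsub>V\<^esub>"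
  using rsmult_distr_vector[of a "\<zero>\<^bsub>V\<^esub>" "\<zero>\<^bsub>V\<^esub>"] rsmult_closed[of a "\<zero>\<^bsub>V\<^esub>"]
  by (simp add: V.add.l_cancel_one')

lemma rsmult_zero_scalar: "x \<in> carrier V \<Longrightarrow> \<zero> \<odot>\<^bsub>V\<^esub> x = \<zero>\<^bsub>V\<^esub>"
  using rsmult_distr_scalar[of \<zero> \<zero> x] rsmult_closed[of \<zero> x]
  by (simp add: V.add.l_cancel_one')

lemma rsmult_finsum:
  "\<lbrakk>finite A; a \<in> carrier D; \<And>i. i \<in> A \<Longrightarrow> f i \<in> carrier V\<rbrakk> \<Longrightarrow>
     a \<odot>\<^bsub>V\<^esub> finsum V f A = (\<Oplus>\<^bsub>V\<^esub>i\<in>A. a \<odot>\<^bsub>V\<^esub> f i)"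
  by (intro V.finsum_hom V.abelian_monoid_axioms)
    (auto simp: rsmult_closed rsmult_distr_vector rsmult_zero)

context
  fixes B assumes B: "right_basis D V B" and fin: "finite B"
begin

definition right_coordinate :: "'v \<Rightarrow> 'v \<Rightarrow> 'd" where
  "right_coordinate v = (THE f. f \<in> B \<rightarrow>\<^sub>E carrier D \<and> v = (\<Oplus>\<^bsub>V\<^esub>b\<in>B. f b \<odot>\<^bsub>V\<^esub> b))"

lemma basis_closed: "b \<in> B \<Longrightarrow> b \<in> carrier V"
  using B by (auto simp: right_basis_def)

lemma right_coordinate:
  assumes "v \<in> carrier V"
  shows "right_coordinate v \<in> B \<rightarrow>\<^sub>E carrier D"
    and "v = (\<Oplus>\<^bsub>V\<^esub>b\<in>B. right_coordinate v b \<odot>\<^bsub>V\<^esub> b)"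
proof -
  have "\<exists>!f. f \<in> B \<rightarrow>\<^sub>E carrier D \<and> v = (\<Oplus>\<^bsub>V\<^esub>b\<in>B. f b \<odot>\<^bsub>V\<^esub> b)"
    using B assms unfolding right_basis_def by blast
  from theI'[OF this]
  show "right_coordinate v \<in> B \<rightarrow>\<^sub>E carrier D"
    "v = (\<Oplus>\<^bsub>V\<^esub>b\<in>B. right_coordinate v b \<odot>\<^bsub>V\<^esub> b)"
    unfolding right_coordinate_def by auto
qed

lemma right_coordinate_closed: "\<lbrakk>v \<in> carrier V; b \<in> B\<rbrakk> \<Longrightarrow> right_coordinate v b \<in> carrier D"
  using right_coordinate(1) by blast

lemma right_coordinate_unique:
  assumes f: "\<And>b. b \<in> B \<Longrightarrow> f b \<in> carrier D" and b: "b \<in> B"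
    and v: "v = (\<Oplus>\<^bsub>V\<^esub>b\<in>B. f b \<odot>\<^bsub>V\<^esub> b)"
  shows "right_coordinate v b = f b"
proof -
  have V: "v \<in> carrier V"
    unfolding v using f basis_closed rsmult_closed by (intro V.finsum_closed) auto
  have "v = (\<Oplus>\<^bsub>V\<^esub>b\<in>B. restrict f B b \<odot>\<^bsub>V\<^esub> b)"
    unfolding v using f basis_closed rsmult_closed by (intro V.finsum_cong') auto
  moreover have "restrict f B \<in> B \<rightarrow>\<^sub>E carrier D" using f by auto
  ultimately have "right_coordinate v = restrict f B"
    using B V right_coordinate[OF V] unfolding right_basis_def by blast
  then show ?thesis using b by simp
qed

lemma right_coordinate_add:
  assumes "v \<in> carrier V" "w \<in> carrier V" "b \<in> B"
  shows "right_coordinate (v \<oplus>\<^bsub>V\<^esub> w) b = right_coordinate v b \<oplus> right_coordinate w b"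
proof (rule right_coordinate_unique)
  note cl = right_coordinate_closed basis_closed rsmult_closed assms
  have "v \<oplus>\<^bsub>V\<^esub> w = (\<Oplus>\<^bsub>V\<^esub>b\<in>B. right_coordinate v b \<odot>\<^bsub>V\<^esub> b) \<oplus>\<^bsub>V\<^esub> (\<Oplus>\<^bsub>V\<^esub>b\<in>B. right_coordinate w b \<odot>\<^bsub>V\<^esub> b)"
    using right_coordinate(2) assms by simp
  also have "\<dots> = (\<Oplus>\<^bsub>V\<^esub>b\<in>B. (right_coordinate v b \<oplus> right_coordinate w b) \<odot>\<^bsub>V\<^esub> b)"
    using cl
    by (subst V.finsum_addf[symmetric], force, force, intro V.finsum_cong')
      (auto simp: rsmult_distr_scalar)
  finally show "v \<oplus>\<^bsub>V\<^esub> w = (\<Oplus>\<^bsub>V\<^esub>b\<in>B. (right_coordinate v b \<oplus> right_coordinate w b) \<odot>\<^bsub>V\<^esub> b)" .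
qed (use assms right_coordinate_closed in auto)

text \<open>The action is on the right, so \<open>a\<close> lands to the right of the coordinate;
  for \<open>a\<close> in \<open>k\<close>, which is central, this becomes
  \<open>k\<close>-linearity.\<close>

lemma right_coordinate_smult:
  assumes "v \<in> carrier V" "a \<in> carrier D" "b \<in> B"
  shows "right_coordinate (a \<odot>\<^bsub>V\<^esub> v) b = right_coordinate v b \<otimes> a"
proof (rule right_coordinate_unique)
  note cl = right_coordinate_closed basis_closed rsmult_closed assms
  have "a \<odot>\<^bsub>V\<^esub> v = a \<odot>\<^bsub>V\<^esub> (\<Oplus>\<^bsub>V\<^esub>b\<in>B. right_coordinate v b \<odot>\<^bsub>V\<^esub> b)"
    using right_coordinate(2) assms by simp
  also have "\<dots> = (\<Oplus>\<^bsub>V\<^esub>b\<in>B. (right_coordinate v b \<otimes> a) \<odot>\<^bsub>V\<^esub> b)"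
    using cl fin
    by (subst rsmult_finsum) (auto simp: rsmult_assoc intro!: V.finsum_cong')
  finally show "a \<odot>\<^bsub>V\<^esub> v = (\<Oplus>\<^bsub>V\<^esub>b\<in>B. (right_coordinate v b \<otimes> a) \<odot>\<^bsub>V\<^esub> b)" .
qed (use assms right_coordinate_closed in auto)

lemma right_coordinate_basis:
  assumes "b0 \<in> B" "a \<in> carrier D" "b \<in> B"
  shows "right_coordinate (a \<odot>\<^bsub>V\<^esub> b0) b = (if b = b0 then a else \<zero>)"
proof (rule right_coordinate_unique)
  show "a \<odot>\<^bsub>V\<^esub> b0 = (\<Oplus>\<^bsub>V\<^esub>b\<in>B. (if b = b0 then a else \<zero>) \<odot>\<^bsub>V\<^esub> b)"
    using assms fin basis_closed rsmult_closed
    by (intro V.finsum_delta[symmetric, where i = b0]) (auto simp: rsmult_zero_scalar)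
qed (use assms in auto)

end

end

context division_involution
begin

lemma fixed_field_simps [simp]:
  "carrier (fixed_field D \<sigma>) = k" "x \<otimes>\<^bsub>fixed_field D \<sigma>\<^esub> y = x \<otimes> y" "x \<oplus>\<^bsub>fixed_field D \<sigma>\<^esub> y = x \<oplus> y"
  "\<one>\<^bsub>fixed_field D \<sigma>\<^esub> = \<one>" "\<zero>\<^bsub>fixed_field D \<sigma>\<^esub> = \<zero>"
  by (simp_all add: fixed_field_def)

lemma scalar_extension_D:
  assumes "field_extension (fixed_field D \<sigma>) L \<phi>"
  shows "scalar_extension (fixed_field D \<sigma>) L \<phi> D (mult D)"
  using assms K_closed abelian_group_axioms by unfold_locales auto

lemma extension_minus:
  assumes "field_extension (fixed_field D \<sigma>) L \<phi>" "a \<in> k" shows "\<phi> (\<ominus> a) = \<ominus>\<^bsub>L\<^esub> \<phi> a"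
proof -
  interpret scalar_extension "fixed_field D \<sigma>" L \<phi> D "mult D" by (rule scalar_extension_D[OF assms(1)])
  have "\<phi> (\<ominus> a) \<oplus>\<^bsub>L\<^esub> \<phi> a = \<phi> (\<ominus> a \<oplus> a)"
    using assms(2) uminus_in_k \<phi>.hom_add[of "\<ominus> a" a] by simp
  also have "\<dots> = \<zero>\<^bsub>L\<^esub>" using assms(2) k_closed \<phi>.hom_zero by (simp add: l_neg)
  finally show ?thesis
    using assms(2) uminus_in_k \<phi>.hom_closed by (intro L.minus_equality[symmetric]) auto
qed

text \<open>2 is a unit in \<open>k\<close> and \<phi> preserves inverses, so 2 is nonzero in
  \<open>L\<close> too, and 2 y = 0 forces y = 0.\<close>

lemma extension_double_eq_zero:
  assumes "field_extension (fixed_field D \<sigma>) L \<phi>" "y \<in> carrier L" "y = \<ominus>\<^bsub>L\<^esub> y"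
  shows "y = \<zero>\<^bsub>L\<^esub>"
proof -
  interpret scalar_extension "fixed_field D \<sigma>" L \<phi> D "mult D" by (rule scalar_extension_D[OF assms(1)])
  have two: "\<one> \<oplus> \<one> \<in> k - {\<zero>}" using two_nonzero one_in_k add_in_k by auto
  have two_L: "\<phi> (\<one> \<oplus> \<one>) = \<one>\<^bsub>L\<^esub> \<oplus>\<^bsub>L\<^esub> \<one>\<^bsub>L\<^esub>"
    using \<phi>.hom_add[of \<one> \<one>] \<phi>.hom_one one_in_k by simp
  have "\<phi> (\<one> \<oplus> \<one>) \<otimes>\<^bsub>L\<^esub> \<phi> (inv (\<one> \<oplus> \<one>)) = \<one>\<^bsub>L\<^esub>"
    using \<phi>.hom_mult[of "\<one> \<oplus> \<one>" "inv (\<one> \<oplus> \<one>)"] two subfield_m_inv[OF subfield_k two] \<phi>.hom_one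
    by simp
  moreover have "\<phi> (inv (\<one> \<oplus> \<one>)) \<in> carrier L"
    using subfield_m_inv(1)[OF subfield_k two] \<phi>.hom_closed by auto
  ultimately have "\<one>\<^bsub>L\<^esub> \<oplus>\<^bsub>L\<^esub> \<one>\<^bsub>L\<^esub> \<noteq> \<zero>\<^bsub>L\<^esub>" using two_L by auto
  moreover have "(\<one>\<^bsub>L\<^esub> \<oplus>\<^bsub>L\<^esub> \<one>\<^bsub>L\<^esub>) \<otimes>\<^bsub>L\<^esub> y = \<zero>\<^bsub>L\<^esub>"
    using assms(2,3) by (metis L.l_distr L.l_one L.one_closed L.r_neg)
  ultimately show ?thesis using assms(2) L.integral[of "\<one>\<^bsub>L\<^esub> \<oplus>\<^bsub>L\<^esub> \<one>\<^bsub>L\<^esub>" y] by simp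
qed

text \<open>Were the bound violated, the equations \<open>c t (h x x) = 0\<close> for
  \<open>t < p\<close>, in \<open>n * m\<close> variables, would have a nonzero solution over an odd
  extension. The work lies in turning the solution into a vector of the scalar extension, showing
  that it is isotropic, and showing that it is nonzero there.\<close>

lemma anisotropic_rank_le:
  fixes V :: "('a, 'a list) module"
  assumes A: "A_field i 2 (fixed_field D \<sigma>)" and springer: "springer_property D \<sigma>"
    and hs: "hermitian_space D \<sigma> \<epsilon> V h" and aniso: "anisotropic D V h"
    and rank: "right_dimension D V n" and ec: "eigen_coordinates \<epsilon> m p e c"
  shows "n * m \<le> p * 2 ^ i"
proof (rule ccontr)
  assume "\<not> n * m \<le> p * 2 ^ i"
  then have gt: "n * m > p * 2 ^ i" by simp
  interpret hs: hermitian_space D \<sigma> \<epsilon> V h by fact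
  have \<epsilon>: "\<epsilon> \<in> {\<one>, \<ominus> \<one>}" "\<epsilon> \<in> carrier D" using hs.eps by auto
  have cs: "coordinate_system k m e c" and pm: "p \<le> m"
    and van: "\<And>t x. \<lbrakk>p \<le> t; t < m; x \<in> eigenspace \<epsilon>\<rbrakk> \<Longrightarrow> c t x = \<zero>"
    using ec by (auto simp: eigen_coordinates_def)
  note sub = subfieldE(1)[OF subfield_k]
  note csD = coordinate_system_closed[OF cs sub] and csR = coordinate_system_closed_carrier[OF cs sub]
  obtain B where B: "finite B" "right_basis D V B" "card B = n"
    using rank by (auto simp: right_dimension_def)
  note rc = hs.right_coordinate_closed[OF B(2,1)]
  define I where "I = B \<times> {..<m}"
  \<comment> \<open>Products of a basis vector of \<open>V\<close> with a basis vector of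
    \<open>D\<close>, as for a tower of fields; \<open>\<gamma>\<close> is the dual family, see
    \<open>\<gamma>v\<close>.\<close>
  define v where "v = (\<lambda>(b, t). e t \<odot>\<^bsub>V\<^esub> b)"
  define \<gamma> where "\<gamma> = (\<lambda>(b, t) x. c t (hs.right_coordinate B x b))"
  have I: "finite I" "card I = n * m" using B by (auto simp: I_def)
  have vV: "v u \<in> carrier V" if "u \<in> I" for u
    using that hs.basis_closed[OF B(2,1)] csD by (auto simp: v_def I_def intro!: hs.rsmult_closed)
  have \<gamma>v: "\<gamma> u (v w) = (if u = w then \<one> else \<zero>)" if "u \<in> I" "w \<in> I" for u w
  proof -
    have "c t \<zero> = \<zero>" if "t < m" for t
      using coordinate_system_scale[OF cs sub that, of \<zero> \<zero>] subringE(2)[OF sub] csR[OF that] by simp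
    then show ?thesis
      using that csD
      by (auto simp: \<gamma>_def v_def I_def hs.right_coordinate_basis[OF B(2,1)] coordinate_system_basis[OF cs sub] split: if_splits)
  qed
  have hvv: "h (v u) (v w) \<in> carrier D" if "u \<in> I" "w \<in> I" for u w
    using that vV hs.form_closed by auto
  have "card I > card {..<p} * 2 ^ i" using gt I by simp
  moreover have "c t (h (v u) (v w)) \<in> carrier (fixed_field D \<sigma>)"
    if "t \<in> {..<p}" "u \<in> I" "w \<in> I" for t u w
    using that pm csD(2) hvv by simp
  ultimately obtain L :: "'a list ring" and \<phi> l x where
    L: "finite_extension (fixed_field D \<sigma>) L \<phi> l" "odd l" "\<forall>u\<in>I. x u \<in> carrier L"
      "\<exists>u\<in>I. x u \<noteq> \<zero>\<^bsub>L\<^esub>"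
      "\<forall>t\<in>{..<p}. (\<Oplus>\<^bsub>L\<^esub>w\<in>I \<times> I. \<phi> (c t (h (v (fst w)) (v (snd w)))) \<otimes>\<^bsub>L\<^esub> (x (fst w) \<otimes>\<^bsub>L\<^esub> x (snd w))) = \<zero>\<^bsub>L\<^esub>"
    using A_field_quadratic_system[OF A I(1) finite_lessThan, of p "\<lambda>t u w. c t (h (v u) (v w))"]
    by blast
  have ext: "field_extension (fixed_field D \<sigma>) L \<phi>"
    using L(1) by (simp add: finite_extension_def)
  interpret BE: bilinear_extension "fixed_field D \<sigma>" L \<phi> V "smult V" V "smult V" D "mult D" h
  proof -
    interpret Z: scalar_extension "fixed_field D \<sigma>" L \<phi> D "mult D" by (rule scalar_extension_D[OF ext])
    have left: "h (a \<odot>\<^bsub>V\<^esub> x) y = a \<otimes> h x y" and right: "h x (a \<odot>\<^bsub>V\<^esub> y) = a \<otimes> h x y"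
      if "a \<in> k" "x \<in> carrier V" "y \<in> carrier V" for a x y
      using that hs.form_sesquilinear[of x y a \<one>] hs.form_sesquilinear[of x y \<one> a]
        K_closed hs.rsmult_one inv_scalar[of a \<one>] hs.form_closed[of x y] K_comm[of a "h x y"]
        hs.form_sesquilinear[of x y \<one> \<one>] one_in_k
      by auto
    show "bilinear_extension (fixed_field D \<sigma>) L \<phi> V (smult V) V (smult V) D (mult D) h"
      using K_closed ext hs.V.abelian_group_axioms
      by unfold_locales
        (auto simp: left right hs.form_closed hs.form_add_left hs.form_add_right intro: hs.rsmult_closed)
  qed
  \<comment> \<open>The solution over \<open>L\<close>, read as a vector of the scalar extension;
    \<open>Q\<close> represents its value under the extended form.\<close>
  define P where "P = (\<Sum>u\<in>I. frag_of (v u, x u))"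
  define Q where "Q = frag_map2 L h P P"
  have P_in: "P \<in> carrier BE.X.free"
    unfolding P_def using vV L(3) by (intro sum_closed_free_Abelian_group) auto
  have Q_in: "Q \<in> carrier BE.Z.free"
    unfolding Q_def by (rule BE.frag_map2_closed[OF P_in P_in])
  have lin: "BE.Z.linear_functional (c t)" if "t < m" for t
    using that csD coordinate_system_add[OF cs sub] coordinate_system_scale[OF cs sub] K_closed
    by (auto simp: BE.Z.linear_functional_def)
  have coord_Q: "BE.Z.ext_functional (c t) Q = \<zero>\<^bsub>L\<^esub>" if t: "t < m" for t
  proof -
    let ?y = "\<lambda>u w. \<phi> (c t (h (v u) (v w))) \<otimes>\<^bsub>L\<^esub> (x u \<otimes>\<^bsub>L\<^esub> x w)"
    have y: "?y u w \<in> carrier L" if "u \<in> I" "w \<in> I" for u w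
      using that L(3) csD[OF t] hvv t by auto
    have "BE.Z.ext_functional (c t) Q = (\<Oplus>\<^bsub>L\<^esub>u\<in>I. BE.Z.ext_functional (c t) (\<Sum>w\<in>I. frag_of (h (v u) (v w), x u \<otimes>\<^bsub>L\<^esub> x w)))"
      unfolding Q_def P_def frag_map2_sum frag_map2_of using I L(3) hvv
      by (intro BE.Z.ext_functional_sum[OF lin[OF t]] sum_closed_free_Abelian_group) auto
    also have "\<dots> = (\<Oplus>\<^bsub>L\<^esub>u\<in>I. \<Oplus>\<^bsub>L\<^esub>w\<in>I. ?y u w)"
      using I L(3) hvv y
      by (intro BE.X.L.finsum_cong' refl)
        (auto intro!: BE.X.L.finsum_closed BE.X.L.finsum_cong'
          simp: BE.Z.ext_functional_sum[OF lin[OF t]] BE.Z.ext_functional_frag[OF lin[OF t]])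
    finally have eq: "BE.Z.ext_functional (c t) Q = (\<Oplus>\<^bsub>L\<^esub>u\<in>I. \<Oplus>\<^bsub>L\<^esub>w\<in>I. ?y u w)" .
    show ?thesis
    proof (cases "t < p")
      case True
      have "(\<Oplus>\<^bsub>L\<^esub>u\<in>I. \<Oplus>\<^bsub>L\<^esub>w\<in>I. ?y u w) = (\<Oplus>\<^bsub>L\<^esub>w\<in>I \<times> I. ?y (fst w) (snd w))"
        using I y by (subst BE.X.L.finsum_Times) auto
      then show ?thesis using True L(5) eq by simp
    next
      case False
      \<comment> \<open>The system says nothing about these coordinates. But
        \<open>h (v u) (v w)\<close> plus its mirror image lies in the eigenspace, where the
        coordinates \<open>t \<ge> p\<close> are zero, so the coefficients are
        antisymmetric.\<close>
      have anti: "?y u w = \<ominus>\<^bsub>L\<^esub> ?y w u" if uw: "u \<in> I" "w \<in> I" for u w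
      proof -
        have "h (v u) (v w) \<oplus> h (v w) (v u) \<in> eigenspace \<epsilon>"
        proof -
          have \<epsilon>\<epsilon>: "\<epsilon> \<otimes> (\<epsilon> \<otimes> z) = z" if "z \<in> carrier D" for z
            using that \<epsilon> sign_square[OF \<epsilon>(1)] by (simp add: m_assoc[symmetric])
          have "h (v w) (v u) = \<epsilon> \<otimes> \<sigma> (h (v u) (v w))"
            by (intro hs.form_hermitian vV uw)
          then show ?thesis
            using hvv[OF uw] \<epsilon> sign_in_k[OF \<epsilon>(1)] inv_closed
            by (auto simp: eigenspace_def inv_add inv_scalar inv_inv r_distr \<epsilon>\<epsilon> a_comm)
        qed
        then have "c t (h (v u) (v w)) = \<ominus> c t (h (v w) (v u))"
          using van[of t] False t hvv uw coordinate_system_minus[OF cs sub] by simp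
        then have "\<phi> (c t (h (v u) (v w))) = \<ominus>\<^bsub>L\<^esub> \<phi> (c t (h (v w) (v u)))"
          using extension_minus[OF ext csD(2)[OF t]] hvv uw by simp
        then show ?thesis
          using uw L(3) csD t hvv
          by (simp add: BE.X.L.l_minus BE.X.L.r_minus BE.X.L.m_comm)
      qed
      let ?s = "\<Oplus>\<^bsub>L\<^esub>u\<in>I. \<Oplus>\<^bsub>L\<^esub>w\<in>I. ?y u w"
      have s: "?s \<in> carrier L" using y by (intro BE.X.L.finsum_closed) auto
      \<comment> \<open>Exchanging the two summation variables turns the double sum into its own
        negative.\<close>
      have "?s = (\<Oplus>\<^bsub>L\<^esub>w\<in>I. \<Oplus>\<^bsub>L\<^esub>u\<in>I. ?y u w)"
        using I y by (intro BE.X.L.finsum_swap) auto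
      also have "\<dots> = (\<Oplus>\<^bsub>L\<^esub>w\<in>I. \<ominus>\<^bsub>L\<^esub> (\<Oplus>\<^bsub>L\<^esub>u\<in>I. ?y w u))"
      proof (intro BE.X.L.finsum_cong' refl)
        fix w assume w: "w \<in> I"
        have "(\<Oplus>\<^bsub>L\<^esub>u\<in>I. ?y u w) = (\<Oplus>\<^bsub>L\<^esub>u\<in>I. \<ominus>\<^bsub>L\<^esub> ?y w u)"
          by (intro BE.X.L.finsum_cong' refl anti w) (use y w in blast)
        also have "\<dots> = \<ominus>\<^bsub>L\<^esub> (\<Oplus>\<^bsub>L\<^esub>u\<in>I. ?y w u)"
          by (intro BE.X.L.finsum_minus I y w)
        finally show "(\<Oplus>\<^bsub>L\<^esub>u\<in>I. ?y u w) = \<ominus>\<^bsub>L\<^esub> (\<Oplus>\<^bsub>L\<^esub>u\<in>I. ?y w u)" .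
      qed (use y in \<open>blast intro: BE.X.L.finsum_closed BE.X.L.a_inv_closed\<close>)
      also have "\<dots> = \<ominus>\<^bsub>L\<^esub> ?s"
        using I y by (intro BE.X.L.finsum_minus) (blast intro: BE.X.L.finsum_closed)+
      finally show ?thesis using extension_double_eq_zero[OF ext s] eq by simp
    qed
  qed
  have "Q \<in> BE.Z.H"
  proof (rule BE.Z.coordinates_zero_imp_in_H)
    show "x = (\<Oplus>t\<in>{..<m}. c t x \<otimes> e t)" if "x \<in> carrier D" for x
      using coordinate_system_expand[OF cs sub that] .
  qed (use csD lin Q_in coord_Q in auto)
  then have "ext_form (fixed_field D \<sigma>) L \<phi> D h (BE.X.cls P) (BE.X.cls P)
      = \<zero>\<^bsub>ext_algebra (fixed_field D \<sigma>) L \<phi> D\<^esub>"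
    using BE.tensor_map2_cls[OF P_in P_in] Q_in
    by (simp add: ext_form_def ext_algebra_def BE.Z.one_tensor_group BE.Z.cls_eq_H_iff Q_def
        del: carrier_free_Abelian_group_iff)
  moreover have "BE.X.cls P \<in> carrier (ext_module (fixed_field D \<sigma>) L \<phi> V)"
    using P_in by (auto simp: ext_module_def BE.X.carrier_tensor_group)
  moreover have "anisotropic (ext_algebra (fixed_field D \<sigma>) L \<phi> D)
      (ext_module (fixed_field D \<sigma>) L \<phi> V) (ext_form (fixed_field D \<sigma>) L \<phi> D h)"
    using springer L(1,2) hs aniso hs.eps unfolding springer_property_def by blast
  ultimately have "BE.X.cls P = BE.X.H"
    unfolding anisotropic_def by (auto simp: ext_module_def BE.X.one_tensor_group)
  then have PH: "P \<in> BE.X.H" using BE.X.cls_eq_H_iff[OF P_in] by simp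
  \<comment> \<open>As \<open>P\<close> is zero in the tensor product, \<open>\<gamma> u\<close>
    tensor \<open>id\<close> vanishes on it; by duality the value is \<open>x u\<close>.\<close>
  have "x u = \<zero>\<^bsub>L\<^esub>" if u: "u \<in> I" for u
  proof -
    have "BE.X.linear_functional (\<gamma> u)"
      using u rc csD coordinate_system_add[OF cs sub] coordinate_system_scale[OF cs sub]
        hs.right_coordinate_add[OF B(2,1)] hs.right_coordinate_smult[OF B(2,1)] K_closed K_comm
      by (auto simp: BE.X.linear_functional_def \<gamma>_def I_def)
    note lin_\<gamma> = this
    have "\<zero>\<^bsub>L\<^esub> = BE.X.ext_functional (\<gamma> u) P"
      using BE.X.ext_functional_H[OF lin_\<gamma> PH] by simp
    also have "\<dots> = (\<Oplus>\<^bsub>L\<^esub>w\<in>I. \<phi> (\<gamma> u (v w)) \<otimes>\<^bsub>L\<^esub> x w)"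
      unfolding P_def using I vV L(3) \<gamma>v[OF u] one_in_k BE.X.F.zero_closed
      by (subst BE.X.ext_functional_sum[OF lin_\<gamma>])
        (auto simp: BE.X.ext_functional_frag[OF lin_\<gamma>] intro!: BE.X.L.finsum_cong')
    also have "\<dots> = x u"
      using I L(3) u \<gamma>v[OF u] BE.X.\<phi>.hom_one BE.X.\<phi>.hom_zero
      by (intro BE.X.L.finsum_delta[where i = u]) auto
    finally show ?thesis by simp
  qed
  with L(4) show False by auto
qed

end

section \<open>Split algebras with an adjoint involution\<close>

lemma matrix_ring_simps [simp]:
  "(A \<otimes>\<^bsub>matrix_ring L n\<^esub> B) i j = (\<Oplus>\<^bsub>L\<^esub>l\<in>{..<n}. A i l \<otimes>\<^bsub>L\<^esub> B l j)"
  "\<one>\<^bsub>matrix_ring L n\<^esub> i j = (if i < n \<and> i = j then \<one>\<^bsub>L\<^esub> else \<zero>\<^bsub>L\<^esub>)"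
  "(A \<oplus>\<^bsub>matrix_ring L n\<^esub> B) i j = A i j \<oplus>\<^bsub>L\<^esub> B i j"
  by (simp_all add: matrix_ring_def)

lemma matrix_ring_carrier_iff:
  "A \<in> carrier (matrix_ring L n) \<longleftrightarrow>
     (\<forall>i j. (if i < n \<and> j < n then A i j \<in> carrier L else A i j = \<zero>\<^bsub>L\<^esub>))"
  by (simp add: matrix_ring_def)

lemma matrix_entry_outside:
  "A \<in> carrier (matrix_ring L n) \<Longrightarrow> \<not> (i < n \<and> j < n) \<Longrightarrow> A i j = \<zero>\<^bsub>L\<^esub>"
  unfolding matrix_ring_carrier_iff by meson

lemma matrix_eqI:
  assumes "A \<in> carrier (matrix_ring L n)" "B \<in> carrier (matrix_ring L n)"
    and "\<And>i j. i < n \<Longrightarrow> j < n \<Longrightarrow> A i j = B i j"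
  shows "A = B"
proof (intro ext)
  fix i j show "A i j = B i j"
    by (cases "i < n \<and> j < n") (simp_all add: assms matrix_entry_outside[OF assms(1)] matrix_entry_outside[OF assms(2)])
qed

context ring
begin

lemma matrix_entry_closed: "A \<in> carrier (matrix_ring R n) \<Longrightarrow> A i j \<in> carrier R"
  unfolding matrix_ring_carrier_iff by (metis zero_closed)

text \<open>Matrices are functions on all index pairs that vanish off the \<open>n\<close> by
  \<open>n\<close> block, so the laws are checked there as well. They are what later allows
  \<open>G\<close> to be cancelled.\<close>

lemma monoid_matrix_ring: "monoid (matrix_ring R n)"
proof
  fix A B C assume A: "A \<in> carrier (matrix_ring R n)" and B: "B \<in> carrier (matrix_ring R n)"
  note cl = matrix_entry_closed[OF A] matrix_entry_closed[OF B]
  show AB: "A \<otimes>\<^bsub>matrix_ring R n\<^esub> B \<in> carrier (matrix_ring R n)"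
    using cl A B
    by (auto simp: matrix_ring_carrier_iff matrix_entry_outside[OF A] matrix_entry_outside[OF B]
        intro!: finsum_closed add.finprod_one_eqI)
  assume C: "C \<in> carrier (matrix_ring R n)"
  note cl = cl matrix_entry_closed[OF C]
  have "(\<Oplus>l\<in>{..<n}. (\<Oplus>l'\<in>{..<n}. A i l' \<otimes> B l' l) \<otimes> C l j)
      = (\<Oplus>l\<in>{..<n}. \<Oplus>l'\<in>{..<n}. A i l' \<otimes> (B l' l \<otimes> C l j))" for i j
    using cl by (intro finsum_cong') (auto simp: finsum_ldistr m_assoc Pi_def intro!: finsum_closed finsum_cong')
  moreover have "(\<Oplus>l\<in>{..<n}. \<Oplus>l'\<in>{..<n}. A i l' \<otimes> (B l' l \<otimes> C l j))
      = (\<Oplus>l'\<in>{..<n}. \<Oplus>l\<in>{..<n}. A i l' \<otimes> (B l' l \<otimes> C l j))" for i j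
    using cl by (intro finsum_swap) auto
  moreover have "(\<Oplus>l'\<in>{..<n}. \<Oplus>l\<in>{..<n}. A i l' \<otimes> (B l' l \<otimes> C l j))
      = (\<Oplus>l'\<in>{..<n}. A i l' \<otimes> (\<Oplus>l\<in>{..<n}. B l' l \<otimes> C l j))" for i j
    using cl by (intro finsum_cong') (auto simp: finsum_rdistr Pi_def intro!: finsum_closed)
  ultimately show "A \<otimes>\<^bsub>matrix_ring R n\<^esub> B \<otimes>\<^bsub>matrix_ring R n\<^esub> C
      = A \<otimes>\<^bsub>matrix_ring R n\<^esub> (B \<otimes>\<^bsub>matrix_ring R n\<^esub> C)"
    by (intro ext) simp
next
  show one: "\<one>\<^bsub>matrix_ring R n\<^esub> \<in> carrier (matrix_ring R n)"
    by (auto simp: matrix_ring_carrier_iff)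
  fix A assume A: "A \<in> carrier (matrix_ring R n)"
  note cl = matrix_entry_closed[OF A]
  have "(\<Oplus>l\<in>{..<n}. (if i < n \<and> i = l then \<one> else \<zero>) \<otimes> A l j) = A i j" for i j
  proof (cases "i < n")
    case True
    then show ?thesis using cl by (intro finsum_delta[where i = i]) auto
  next
    case False
    then show ?thesis
      using cl by (simp add: matrix_entry_outside[OF A] add.finprod_one_eqI)
  qed
  then show "\<one>\<^bsub>matrix_ring R n\<^esub> \<otimes>\<^bsub>matrix_ring R n\<^esub> A = A" by (intro ext) simp
  have "(\<Oplus>l\<in>{..<n}. A i l \<otimes> (if l < n \<and> l = j then \<one> else \<zero>)) = A i j" for i j
  proof (cases "j < n")
    case True
    then show ?thesis using cl by (intro finsum_delta[where i = j]) auto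
  next
    case False
    then show ?thesis
      using cl by (auto simp: matrix_entry_outside[OF A] intro!: add.finprod_one_eqI)
  qed
  then show "A \<otimes>\<^bsub>matrix_ring R n\<^esub> \<one>\<^bsub>matrix_ring R n\<^esub> = A" by (intro ext) simp
qed

end

text \<open>\<open>N\<close> is a set of entries that determine all entries of the matrices \<open>G T\<^sub>t\<close> (for instance
  those on and above the diagonal, if these matrices are symmetric).\<close>

lemma independent_matrices_card_le:
  fixes L (structure)
  assumes L: "field L" and G: "G \<in> Units (matrix_ring L n)"
    and T: "\<And>t. t < p \<Longrightarrow> T t \<in> carrier (matrix_ring L n)"
    and indep: "\<And>x. \<lbrakk>\<And>t. t < p \<Longrightarrow> x t \<in> carrier L;
       \<And>i j. i < n \<Longrightarrow> j < n \<Longrightarrow> (\<Oplus>t\<in>{..<p}. T t i j \<otimes> x t) = \<zero>\<rbrakk> \<Longrightarrow> \<forall>t<p. x t = \<zero>"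
    and N: "finite N"
      "\<And>x i j. \<lbrakk>\<And>t. t < p \<Longrightarrow> x t \<in> carrier L;
         \<And>i j. (i, j) \<in> N \<Longrightarrow> (\<Oplus>t\<in>{..<p}. (G \<otimes>\<^bsub>matrix_ring L n\<^esub> T t) i j \<otimes> x t) = \<zero>;
         i < n; j < n\<rbrakk> \<Longrightarrow> (\<Oplus>t\<in>{..<p}. (G \<otimes>\<^bsub>matrix_ring L n\<^esub> T t) i j \<otimes> x t) = \<zero>"
  shows "p \<le> card N"
proof (rule ccontr)
  interpret field L by (rule L)
  interpret M: monoid "matrix_ring L n" by (rule monoid_matrix_ring)
  let ?S = "\<lambda>t. G \<otimes>\<^bsub>matrix_ring L n\<^esub> T t"
  have GM: "G \<in> carrier (matrix_ring L n)" using G by (rule M.Units_closed)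
  note cl = matrix_entry_closed[OF GM] matrix_entry_closed[OF T]
  have S: "?S t i j \<in> carrier L" if "t < p" for t i j
    by (rule matrix_entry_closed[OF M.m_closed[OF GM T[OF that]]])
  assume "\<not> p \<le> card N"
  \<comment> \<open>The unknowns are the \<open>p\<close> coefficients and the equations are the
    positions in \<open>N\<close>: a nontrivial combination of the \<open>?S t\<close> vanishes on
    \<open>N\<close>, hence everywhere.\<close>
  then have "\<exists>x. (\<forall>t\<in>{..<p}. x t \<in> carrier L) \<and> (\<exists>t\<in>{..<p}. x t \<noteq> \<zero>) \<and>
           (\<forall>r\<in>N. (\<Oplus>t\<in>{..<p}. ?S t (fst r) (snd r) \<otimes> x t) = \<zero>)"
    using N(1) S by (intro homogeneous_system_nontrivial_solution[OF L]) auto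
  then obtain x where x: "\<forall>t\<in>{..<p}. x t \<in> carrier L" "\<exists>t\<in>{..<p}. x t \<noteq> \<zero>"
    "\<forall>r\<in>N. (\<Oplus>t\<in>{..<p}. ?S t (fst r) (snd r) \<otimes> x t) = \<zero>"
    by blast
  have x0: "(\<Oplus>t\<in>{..<p}. ?S t i j \<otimes> x t) = \<zero>" if "i < n" "j < n" for i j
    by (rule N(2)) (use that x in auto)
  \<comment> \<open>The same combination of the \<open>T t\<close>. The product of \<open>G\<close>
    and \<open>Z\<close> is zero and \<open>G\<close> is invertible, so \<open>Z\<close> is zero,
    against independence.\<close>
  define Z where "Z i j = (\<Oplus>t\<in>{..<p}. T t i j \<otimes> x t)" for i j
  have Z: "Z \<in> carrier (matrix_ring L n)"
    using x cl unfolding matrix_ring_carrier_iff Z_def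
    by (auto intro!: finsum_closed add.finprod_one_eqI simp: matrix_entry_outside[OF T])
  have zero: "(\<lambda>i j. \<zero>) \<in> carrier (matrix_ring L n)" by (simp add: matrix_ring_carrier_iff)
  have "G \<otimes>\<^bsub>matrix_ring L n\<^esub> Z = (\<lambda>i j. \<zero>)"
  proof (rule matrix_eqI[OF M.m_closed[OF GM Z] zero])
    fix i j assume ij: "i < n" "j < n"
    have "(G \<otimes>\<^bsub>matrix_ring L n\<^esub> Z) i j = (\<Oplus>l\<in>{..<n}. \<Oplus>t\<in>{..<p}. G i l \<otimes> T t l j \<otimes> x t)"
      using x cl unfolding matrix_ring_simps Z_def
      by (intro finsum_cong') (auto simp: finsum_rdistr m_assoc Pi_def intro!: finsum_closed finsum_cong')
    also have "\<dots> = (\<Oplus>t\<in>{..<p}. \<Oplus>l\<in>{..<n}. G i l \<otimes> T t l j \<otimes> x t)"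
      using x cl by (intro finsum_swap) auto
    also have "\<dots> = (\<Oplus>t\<in>{..<p}. ?S t i j \<otimes> x t)"
      using x cl unfolding matrix_ring_simps
      by (intro finsum_cong') (auto simp: finsum_ldistr Pi_def intro!: finsum_closed)
    finally show "(G \<otimes>\<^bsub>matrix_ring L n\<^esub> Z) i j = \<zero>" using x0[OF ij] by simp
  qed
  then have "inv\<^bsub>matrix_ring L n\<^esub> G \<otimes>\<^bsub>matrix_ring L n\<^esub> (G \<otimes>\<^bsub>matrix_ring L n\<^esub> Z) = (\<lambda>i j. \<zero>)"
    using matrix_entry_closed[OF M.Units_inv_closed[OF G]]
    by (auto intro!: ext add.finprod_one_eqI)
  then have "Z = (\<lambda>i j. \<zero>)"
    using G Z GM by (simp add: M.m_assoc[symmetric] M.Units_l_inv del: matrix_ring_simps)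
  then have "\<forall>t<p. x t = \<zero>"
    using x by (intro indep) (auto simp: Z_def fun_eq_iff)
  with x show False by auto
qed

text \<open>Counts the positions on or below the diagonal, doubled to avoid division.\<close>

lemma twice_card_le_pairs: "2 * card (Sigma {..<n} (\<lambda>j. {..j})) = n * (n + 1)" for n :: nat
  by (subst card_SigmaI) (auto, induction n, auto)

lemma twice_card_less_pairs: "2 * card (Sigma {..<n} (\<lambda>j. {..<j})) = n * (n - 1)" for n :: nat
proof -
  \<comment> \<open>Adding \<open>n\<close> keeps truncated subtraction out of the
    induction.\<close>
  have "2 * (\<Sum>j<n. j) + n = n * n" by (induction n) auto
  then show ?thesis by (subst card_SigmaI) (auto simp: diff_mult_distrib2)
qed

text \<open>The entries with \<open>j \<le> i\<close> determine a symmetric matrix, and there are n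
  (n + 1) / 2 of them.\<close>

lemma symmetric_family_card_le:
  fixes L (structure)
  assumes "field L" "G \<in> Units (matrix_ring L n)"
    and "\<And>t. t < p \<Longrightarrow> T t \<in> carrier (matrix_ring L n)"
    and "\<And>x. \<lbrakk>\<And>t. t < p \<Longrightarrow> x t \<in> carrier L;
       \<And>i j. i < n \<Longrightarrow> j < n \<Longrightarrow> (\<Oplus>t\<in>{..<p}. T t i j \<otimes> x t) = \<zero>\<rbrakk> \<Longrightarrow> \<forall>t<p. x t = \<zero>"
    and sym: "\<And>t i j. \<lbrakk>t < p; i < n; j < n\<rbrakk> \<Longrightarrow>
       (G \<otimes>\<^bsub>matrix_ring L n\<^esub> T t) j i = (G \<otimes>\<^bsub>matrix_ring L n\<^esub> T t) i j"
  shows "2 * p \<le> n * (n + 1)"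
proof -
  interpret field L by fact
  interpret M: monoid "matrix_ring L n" by (rule monoid_matrix_ring)
  let ?S = "\<lambda>t. G \<otimes>\<^bsub>matrix_ring L n\<^esub> T t"
  have S: "?S t i j \<in> carrier L" if "t < p" for t i j
    by (rule matrix_entry_closed[OF M.m_closed[OF M.Units_closed[OF assms(2)] assms(3)[OF that]]])
  have "p \<le> card (Sigma {..<n} (\<lambda>j. {..j}))"
  proof (rule independent_matrices_card_le[OF assms(1-4)])
    fix x i j
    assume x: "\<And>t. t < p \<Longrightarrow> x t \<in> carrier L" and ij: "i < n" "j < n"
      and N: "\<And>i j. (i, j) \<in> Sigma {..<n} (\<lambda>j. {..j}) \<Longrightarrow> (\<Oplus>t\<in>{..<p}. ?S t i j \<otimes> x t) = \<zero>"
    show "(\<Oplus>t\<in>{..<p}. ?S t i j \<otimes> x t) = \<zero>"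
    proof (cases "j \<le> i")
      case False
      have "(\<Oplus>t\<in>{..<p}. ?S t i j \<otimes> x t) = (\<Oplus>t\<in>{..<p}. ?S t j i \<otimes> x t)"
        using S x sym[OF _ ij] by (intro finsum_cong' refl) (auto simp del: matrix_ring_simps)
      then show ?thesis using N[of j i] False ij by (simp del: matrix_ring_simps)
    qed (use N ij in auto)
  qed auto
  then show ?thesis using twice_card_le_pairs[of n] by simp
qed

text \<open>The entries with \<open>j < i\<close> suffice: mirroring changes the sign, and a
  diagonal entry equals its own negative, so it is zero by \<open>two\<close>.\<close>

lemma skew_family_card_le:
  fixes L (structure)
  assumes "field L" "G \<in> Units (matrix_ring L n)"
    and "\<And>t. t < p \<Longrightarrow> T t \<in> carrier (matrix_ring L n)"
    and "\<And>x. \<lbrakk>\<And>t. t < p \<Longrightarrow> x t \<in> carrier L;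
       \<And>i j. i < n \<Longrightarrow> j < n \<Longrightarrow> (\<Oplus>t\<in>{..<p}. T t i j \<otimes> x t) = \<zero>\<rbrakk> \<Longrightarrow> \<forall>t<p. x t = \<zero>"
    and two: "\<And>y. \<lbrakk>y \<in> carrier L; y = \<ominus> y\<rbrakk> \<Longrightarrow> y = \<zero>"
    and skew: "\<And>t i j. \<lbrakk>t < p; i < n; j < n\<rbrakk> \<Longrightarrow>
       (G \<otimes>\<^bsub>matrix_ring L n\<^esub> T t) j i = \<ominus> (G \<otimes>\<^bsub>matrix_ring L n\<^esub> T t) i j"
  shows "2 * p \<le> n * (n - 1)"
proof -
  interpret field L by fact
  interpret M: monoid "matrix_ring L n" by (rule monoid_matrix_ring)
  let ?S = "\<lambda>t. G \<otimes>\<^bsub>matrix_ring L n\<^esub> T t"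
  have S: "?S t i j \<in> carrier L" if "t < p" for t i j
    by (rule matrix_entry_closed[OF M.m_closed[OF M.Units_closed[OF assms(2)] assms(3)[OF that]]])
  have "p \<le> card (Sigma {..<n} (\<lambda>j. {..<j}))"
  proof (rule independent_matrices_card_le[OF assms(1-4)])
    fix x i j
    assume x: "\<And>t. t < p \<Longrightarrow> x t \<in> carrier L" and ij: "i < n" "j < n"
      and N: "\<And>i j. (i, j) \<in> Sigma {..<n} (\<lambda>j. {..<j}) \<Longrightarrow> (\<Oplus>t\<in>{..<p}. ?S t i j \<otimes> x t) = \<zero>"
    have closed: "(\<Oplus>t\<in>{..<p}. ?S t a b \<otimes> x t) \<in> carrier L" for a b
      using S x by (intro finsum_closed) (auto simp del: matrix_ring_simps)
    have neg: "(\<Oplus>t\<in>{..<p}. ?S t i j \<otimes> x t) = \<ominus> (\<Oplus>t\<in>{..<p}. ?S t j i \<otimes> x t)"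
    proof -
      have "?S t i j \<otimes> x t = \<ominus> (?S t j i \<otimes> x t)" if "t < p" for t
        using S[OF that] x[OF that] skew[OF that ij(2,1)] by (simp add: l_minus del: matrix_ring_simps)
      then have "(\<Oplus>t\<in>{..<p}. ?S t i j \<otimes> x t) = (\<Oplus>t\<in>{..<p}. \<ominus> (?S t j i \<otimes> x t))"
        using S x by (intro finsum_cong' refl) (auto simp del: matrix_ring_simps)
      also have "\<dots> = \<ominus> (\<Oplus>t\<in>{..<p}. ?S t j i \<otimes> x t)"
        using S x by (intro finsum_minus) (auto simp del: matrix_ring_simps)
      finally show ?thesis .
    qed
    show "(\<Oplus>t\<in>{..<p}. ?S t i j \<otimes> x t) = \<zero>"
    proof (cases i j rule: linorder_cases)
      case less
      then show ?thesis using neg N[of j i] ij by (simp del: matrix_ring_simps)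
    next
      case equal
      then show ?thesis using neg two[OF closed] by (simp del: matrix_ring_simps)
    next
      case greater
      then show ?thesis using N[of i j] ij by (simp del: matrix_ring_simps)
    qed
  qed auto
  then show ?thesis using twice_card_less_pairs[of n] by simp
qed

section \<open>Matrices over a splitting field and the dimension of the eigenspaces\<close>

locale split_involution = division_involution D \<sigma> for D (structure) and \<sigma> +
  fixes L \<phi> n \<psi>
  assumes first: "first_kind D \<sigma>" and split: "splitting D L \<phi> n \<psi>"
begin

text \<open>Splittings are taken over the center, the tensor products above over \<open>k\<close>;
  for the first kind the two fields coincide.\<close>

lemma center_field_eq: "center_field D = fixed_field D \<sigma>"
proof -
  have "K = k" using first by (auto simp: first_kind_def)
  then show ?thesis by (simp add: center_field_def fixed_field_def)
qed

lemma ext: "field_extension (fixed_field D \<sigma>) L \<phi>"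
  using split by (simp add: splitting_def center_field_eq)

sublocale Z: scalar_extension "fixed_field D \<sigma>" L \<phi> D "mult D"
  by (rule scalar_extension_D[OF ext])

abbreviation "E \<equiv> ext_algebra (fixed_field D \<sigma>) L \<phi> D"
abbreviation "MR \<equiv> matrix_ring L n"

lemma bilinear_mult: "bilinear_extension (fixed_field D \<sigma>) L \<phi> D (mult D) D (mult D) D (mult D) (mult D)"
proof unfold_locales
  fix a x y assume "a \<in> carrier (fixed_field D \<sigma>)" "x \<in> carrier D" "y \<in> carrier D"
  then have a: "a \<in> K" "a \<in> carrier D" and xy: "x \<in> carrier D" "y \<in> carrier D"
    using K_closed by auto
  show "a \<otimes> x \<otimes> y = a \<otimes> (x \<otimes> y)" using a xy by (simp add: m_assoc)
  have "x \<otimes> (a \<otimes> y) = x \<otimes> a \<otimes> y" using a xy by (simp add: m_assoc)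
  also have "\<dots> = a \<otimes> (x \<otimes> y)" using a xy by (simp add: K_comm m_assoc)
  finally show "x \<otimes> (a \<otimes> y) = a \<otimes> (x \<otimes> y)" .
qed (auto simp: l_distr r_distr)

lemma iso: "\<psi> \<in> ring_iso E MR"
  and scalar: "l \<in> carrier L \<Longrightarrow> \<psi> (Z.cls (frag_of (\<one>, l))) = (\<lambda>i j. if i < n \<and> i = j then l else \<zero>\<^bsub>L\<^esub>)"
  using split by (auto simp: splitting_def center_field_eq)

lemma cls_in_E: "p \<in> carrier Z.free \<Longrightarrow> Z.cls p \<in> carrier E"
  by (auto simp: ext_algebra_def Z.carrier_tensor_group)

lemma E_cases: "X \<in> carrier E \<Longrightarrow> \<exists>p\<in>carrier Z.free. X = Z.cls p"
  by (auto simp: ext_algebra_def Z.carrier_tensor_group)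

lemma \<psi>_closed: "p \<in> carrier Z.free \<Longrightarrow> \<psi> (Z.cls p) \<in> carrier MR"
  using iso cls_in_E by (auto simp: ring_iso_def ring_hom_def)

lemma \<psi>_entry_closed: "p \<in> carrier Z.free \<Longrightarrow> \<psi> (Z.cls p) i j \<in> carrier L"
  by (rule Z.L.matrix_entry_closed[OF \<psi>_closed])

lemma \<psi>_add:
  assumes "p \<in> carrier Z.free" "q \<in> carrier Z.free"
  shows "\<psi> (Z.cls (p + q)) i j = \<psi> (Z.cls p) i j \<oplus>\<^bsub>L\<^esub> \<psi> (Z.cls q) i j"
proof -
  have "Z.cls (p + q) = Z.cls p \<oplus>\<^bsub>E\<^esub> Z.cls q"
    using Z.mult_cls[OF assms] by (simp add: ext_algebra_def)
  then show ?thesis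
    using ring_hom_add[of \<psi> E MR "Z.cls p" "Z.cls q"] iso cls_in_E[OF assms(1)] cls_in_E[OF assms(2)]
    by (simp add: ring_iso_def)
qed

lemma \<psi>_zero: "\<psi> (Z.cls 0) i j = \<zero>\<^bsub>L\<^esub>"
proof -
  have "0 \<in> carrier Z.free" by simp
  from \<psi>_add[OF this this, of i j] \<psi>_entry_closed[OF this, of i j] show ?thesis
    by (simp add: Z.L.add.l_cancel_one')
qed

lemma \<psi>_sum:
  assumes "finite A" "\<And>t. t \<in> A \<Longrightarrow> g t \<in> carrier Z.free"
  shows "\<psi> (Z.cls (sum g A)) i j = (\<Oplus>\<^bsub>L\<^esub>t\<in>A. \<psi> (Z.cls (g t)) i j)"
  using assms
proof (induction A rule: finite_induct)
  case (insert t A)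
  have "sum g A \<in> carrier Z.free"
    using insert.prems by (intro sum_closed_free_Abelian_group) blast
  then have "\<psi> (Z.cls (sum g (insert t A))) i j = \<psi> (Z.cls (g t)) i j \<oplus>\<^bsub>L\<^esub> \<psi> (Z.cls (sum g A)) i j"
    using insert.hyps \<psi>_add[OF insert.prems[of t], of "sum g A"] by simp
  also have "\<dots> = (\<Oplus>\<^bsub>L\<^esub>t\<in>insert t A. \<psi> (Z.cls (g t)) i j)"
    using insert by (subst Z.L.finsum_insert) (auto simp: Pi_def \<psi>_entry_closed simp del: carrier_free_Abelian_group_iff)
  finally show ?case .
qed (simp add: \<psi>_zero)

text \<open>The embedding of \<open>D\<close> into the matrices over \<open>L\<close>; by
  \<open>\<psi>_combination\<close> it determines \<psi> on all sums of pure tensors.\<close>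

definition T where "T x = \<psi> (Z.cls (frag_of (x, \<one>\<^bsub>L\<^esub>)))"

lemma T_closed: "x \<in> carrier D \<Longrightarrow> T x \<in> carrier MR"
  unfolding T_def by (rule \<psi>_closed) simp

lemma T_entry_closed: "x \<in> carrier D \<Longrightarrow> T x i j \<in> carrier L"
  by (rule Z.L.matrix_entry_closed[OF T_closed])

text \<open>A pure tensor is the product of x tensor 1 and 1 tensor l, and the second factor goes to
  a scalar matrix.\<close>

lemma \<psi>_frag:
  assumes x: "x \<in> carrier D" and l: "l \<in> carrier L" and ij: "i < n" "j < n"
  shows "\<psi> (Z.cls (frag_of (x, l))) i j = T x i j \<otimes>\<^bsub>L\<^esub> l"
proof -
  interpret B: bilinear_extension "fixed_field D \<sigma>" L \<phi> D "mult D" D "mult D" D "mult D" "mult D"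
    by (rule bilinear_mult)
  have p: "frag_of (x, \<one>\<^bsub>L\<^esub>) \<in> carrier Z.free" "frag_of (\<one>, l) \<in> carrier Z.free"
    using x l by auto
  have "Z.cls (frag_of (x, l)) = Z.cls (frag_of (x, \<one>\<^bsub>L\<^esub>)) \<otimes>\<^bsub>E\<^esub> Z.cls (frag_of (\<one>, l))"
    using B.tensor_map2_cls[OF p] x l by (simp add: ext_algebra_def frag_map2_of)
  then have eq: "\<psi> (Z.cls (frag_of (x, l))) = T x \<otimes>\<^bsub>MR\<^esub> \<psi> (Z.cls (frag_of (\<one>, l)))"
    using ring_hom_mult[of \<psi> E MR] iso cls_in_E[OF p(1)] cls_in_E[OF p(2)]
    by (simp add: ring_iso_def T_def)
  show ?thesis
    unfolding eq matrix_ring_simps scalar[OF l] using T_entry_closed[OF x] l ij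
    by (intro Z.L.finsum_delta[where i = j]) auto
qed

lemma \<psi>_combination:
  assumes "finite A" "\<And>t. t \<in> A \<Longrightarrow> e t \<in> carrier D" "\<And>t. t \<in> A \<Longrightarrow> x t \<in> carrier L" "i < n" "j < n"
  shows "\<psi> (Z.cls (\<Sum>t\<in>A. frag_of (e t, x t))) i j = (\<Oplus>\<^bsub>L\<^esub>t\<in>A. T (e t) i j \<otimes>\<^bsub>L\<^esub> x t)"
  using assms by (subst \<psi>_sum) (auto simp: \<psi>_frag T_entry_closed intro!: Z.L.finsum_cong')

lemma T_scale:
  assumes "a \<in> k" "x \<in> carrier D" "i < n" "j < n"
  shows "T (a \<otimes> x) i j = T x i j \<otimes>\<^bsub>L\<^esub> \<phi> a"
proof -
  have \<phi>a: "\<phi> a \<in> carrier L" using assms(1) Z.\<phi>.hom_closed by simp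
  have "frag_of (a \<otimes> x, \<one>\<^bsub>L\<^esub>) - frag_of (x, \<phi> a \<otimes>\<^bsub>L\<^esub> \<one>\<^bsub>L\<^esub>) \<in> Z.H"
    using assms by (intro Z.frag_scalar_in_H) auto
  then have "Z.cls (frag_of (a \<otimes> x, \<one>\<^bsub>L\<^esub>)) = Z.cls (frag_of (x, \<phi> a))"
    using assms \<phi>a K_closed by (subst Z.cls_eq_iff) auto
  then show ?thesis
    unfolding T_def[of "a \<otimes> x"] using \<psi>_frag[OF assms(2) \<phi>a assms(3,4)] by simp
qed

context
  fixes m e c assumes cs: "coordinate_system k m e c"
begin

lemma e_closed: "t < m \<Longrightarrow> e t \<in> carrier D"
  by (rule coordinate_system_closed(1)[OF cs subfieldE(1)[OF subfield_k]])

lemma coordinate_linear: "t < m \<Longrightarrow> Z.linear_functional (c t)"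
  using coordinate_system_closed(2)[OF cs subfieldE(1)[OF subfield_k]]
    coordinate_system_add[OF cs subfieldE(1)[OF subfield_k]]
    coordinate_system_scale[OF cs subfieldE(1)[OF subfield_k]] K_closed
  by (auto simp: Z.linear_functional_def)

text \<open>\<psi> is injective, so a vanishing combination of the matrices is already zero in the
  tensor product, where the functionals \<open>c u\<close> tensor \<open>id\<close> read off its
  coefficients.\<close>

lemma T_basis_independent:
  assumes p: "p \<le> m" and x: "\<And>t. t < p \<Longrightarrow> x t \<in> carrier L"
    and zero: "\<And>i j. i < n \<Longrightarrow> j < n \<Longrightarrow> (\<Oplus>\<^bsub>L\<^esub>t\<in>{..<p}. T (e t) i j \<otimes>\<^bsub>L\<^esub> x t) = \<zero>\<^bsub>L\<^esub>"
  shows "\<forall>t<p. x t = \<zero>\<^bsub>L\<^esub>"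
proof (intro allI impI)
  fix u assume u: "u < p"
  define P where "P = (\<Sum>t\<in>{..<p}. frag_of (e t, x t))"
  have Pt: "frag_of (e t, x t) \<in> carrier Z.free" if "t \<in> {..<p}" for t
    using that p x e_closed by auto
  have P: "P \<in> carrier Z.free" "0 \<in> carrier Z.free"
    unfolding P_def using Pt by (intro sum_closed_free_Abelian_group) auto
  have "\<psi> (Z.cls P) i j = \<psi> (Z.cls 0) i j" if "i < n" "j < n" for i j
    unfolding P_def \<psi>_zero
    by (subst \<psi>_combination) (use zero that p x e_closed in auto)
  then have "\<psi> (Z.cls P) = \<psi> (Z.cls 0)"
    by (intro matrix_eqI[OF \<psi>_closed \<psi>_closed] P)
  moreover have "inj_on \<psi> (carrier E)" using iso by (auto simp: ring_iso_def bij_betw_def)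
  ultimately have "Z.cls P = Z.cls 0"
    using cls_in_E P by (auto dest: inj_onD)
  then have "P \<in> Z.H" using Z.cls_eq_iff[OF P] by simp
  then have "\<zero>\<^bsub>L\<^esub> = Z.ext_functional (c u) P"
    using Z.ext_functional_H[OF coordinate_linear] u p by simp
  also have "\<dots> = (\<Oplus>\<^bsub>L\<^esub>t\<in>{..<p}. Z.ext_functional (c u) (frag_of (e t, x t)))"
    unfolding P_def using u p Pt by (intro Z.ext_functional_sum coordinate_linear) auto
  also have "\<dots> = x u"
    using u p x e_closed Z.\<phi>.hom_one Z.\<phi>.hom_zero coordinate_linear[of u]
      coordinate_system_basis[OF cs subfieldE(1)[OF subfield_k]]
    by (intro Z.L.finsum_delta[where i = u]) (auto simp: Z.ext_functional_frag)
  finally show "x u = \<zero>\<^bsub>L\<^esub>" ..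
qed

text \<open>The size \<open>n\<close> is not prescribed by \<open>splitting\<close>. As \<psi> is
  onto, the \<open>m\<close> matrices \<open>T (e t)\<close> span all matrices over
  \<open>L\<close>; this is exploited dually, through a linear form \<open>w\<close> on
  matrices.\<close>

lemma square_le_dim: "n * n \<le> m"
proof (rule ccontr)
  assume "\<not> n * n \<le> m"
  then have "card {..<m} < card ({..<n} \<times> {..<n})" by (simp add: card_cartesian_product)
  \<comment> \<open>With more matrix positions than basis vectors, a nonzero linear form
    \<open>w\<close> kills every \<open>T (e t)\<close>; the positions are the unknowns.\<close>
  then have "\<exists>w. (\<forall>r\<in>{..<n} \<times> {..<n}. w r \<in> carrier L) \<and> (\<exists>r\<in>{..<n} \<times> {..<n}. w r \<noteq> \<zero>\<^bsub>L\<^esub>) \<and>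
      (\<forall>t\<in>{..<m}. (\<Oplus>\<^bsub>L\<^esub>r\<in>{..<n} \<times> {..<n}. T (e t) (fst r) (snd r) \<otimes>\<^bsub>L\<^esub> w r) = \<zero>\<^bsub>L\<^esub>)"
    using T_entry_closed e_closed Z.L.field_axioms by (intro homogeneous_system_nontrivial_solution) auto
  then obtain w where w: "\<forall>r\<in>{..<n} \<times> {..<n}. w r \<in> carrier L"
    "\<exists>r\<in>{..<n} \<times> {..<n}. w r \<noteq> \<zero>\<^bsub>L\<^esub>"
    "\<forall>t\<in>{..<m}. (\<Oplus>\<^bsub>L\<^esub>r\<in>{..<n} \<times> {..<n}. T (e t) (fst r) (snd r) \<otimes>\<^bsub>L\<^esub> w r) = \<zero>\<^bsub>L\<^esub>"
    by blast
  \<comment> \<open>Then \<open>w\<close> kills every matrix: lift \<open>A\<close> through \<psi>,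
    expand the preimage along \<open>e\<close> and use linearity.\<close>
  have kill: "(\<Oplus>\<^bsub>L\<^esub>r\<in>{..<n} \<times> {..<n}. A (fst r) (snd r) \<otimes>\<^bsub>L\<^esub> w r) = \<zero>\<^bsub>L\<^esub>"
    if A: "A \<in> carrier MR" for A
  proof -
    obtain X where X: "X \<in> carrier E" "A = \<psi> X"
      using iso A by (auto simp: ring_iso_def bij_betw_def)
    then obtain p where p: "p \<in> carrier Z.free" "X = Z.cls p" using E_cases by blast
    define y where "y t = Z.ext_functional (c t) p" for t
    have y: "y t \<in> carrier L" if "t < m" for t
      unfolding y_def using that p coordinate_linear by (intro Z.ext_functional_closed)
    have "p - (\<Sum>t\<in>{..<m}. frag_of (e t, y t)) \<in> Z.H"
      unfolding y_def
    proof (rule Z.coordinate_decomposition)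
      show "x = (\<Oplus>t\<in>{..<m}. c t x \<otimes> e t)" if "x \<in> carrier D" for x
        by (rule coordinate_system_expand[OF cs subfieldE(1)[OF subfield_k] that])
    qed (use p e_closed coordinate_linear in auto)
    moreover have "(\<Sum>t\<in>{..<m}. frag_of (e t, y t)) \<in> carrier Z.free"
      using y e_closed by (intro sum_closed_free_Abelian_group) auto
    ultimately have X_eq: "X = Z.cls (\<Sum>t\<in>{..<m}. frag_of (e t, y t))"
      using Z.cls_eq_iff p by blast
    have "(\<Oplus>\<^bsub>L\<^esub>r\<in>{..<n} \<times> {..<n}. A (fst r) (snd r) \<otimes>\<^bsub>L\<^esub> w r)
        = (\<Oplus>\<^bsub>L\<^esub>r\<in>{..<n} \<times> {..<n}. \<Oplus>\<^bsub>L\<^esub>t\<in>{..<m}. y t \<otimes>\<^bsub>L\<^esub> (T (e t) (fst r) (snd r) \<otimes>\<^bsub>L\<^esub> w r))"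
    proof (intro Z.L.finsum_cong' refl)
      fix r assume r: "r \<in> {..<n} \<times> {..<n}"
      have "A (fst r) (snd r) = (\<Oplus>\<^bsub>L\<^esub>t\<in>{..<m}. T (e t) (fst r) (snd r) \<otimes>\<^bsub>L\<^esub> y t)"
        unfolding X X_eq using r y e_closed by (intro \<psi>_combination) auto
      then show "A (fst r) (snd r) \<otimes>\<^bsub>L\<^esub> w r
          = (\<Oplus>\<^bsub>L\<^esub>t\<in>{..<m}. y t \<otimes>\<^bsub>L\<^esub> (T (e t) (fst r) (snd r) \<otimes>\<^bsub>L\<^esub> w r))"
        using r w(1) y e_closed T_entry_closed
        by (auto simp: Z.L.finsum_rdistr Pi_def Z.L.m_ac intro!: Z.L.finsum_cong')
    qed (use w(1) y e_closed T_entry_closed in \<open>auto intro!: Z.L.finsum_closed\<close>)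
    also have "\<dots> = (\<Oplus>\<^bsub>L\<^esub>t\<in>{..<m}. \<Oplus>\<^bsub>L\<^esub>r\<in>{..<n} \<times> {..<n}. y t \<otimes>\<^bsub>L\<^esub> (T (e t) (fst r) (snd r) \<otimes>\<^bsub>L\<^esub> w r))"
      using w(1) y e_closed T_entry_closed by (intro Z.L.finsum_swap) auto
    also have "\<dots> = (\<Oplus>\<^bsub>L\<^esub>t\<in>{..<m}. y t \<otimes>\<^bsub>L\<^esub> \<zero>\<^bsub>L\<^esub>)"
    proof (intro Z.L.finsum_cong' refl)
      fix t assume t: "t \<in> {..<m}"
      have "(\<Oplus>\<^bsub>L\<^esub>r\<in>{..<n} \<times> {..<n}. y t \<otimes>\<^bsub>L\<^esub> (T (e t) (fst r) (snd r) \<otimes>\<^bsub>L\<^esub> w r))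
          = y t \<otimes>\<^bsub>L\<^esub> (\<Oplus>\<^bsub>L\<^esub>r\<in>{..<n} \<times> {..<n}. T (e t) (fst r) (snd r) \<otimes>\<^bsub>L\<^esub> w r)"
        using t w(1) y e_closed T_entry_closed by (intro Z.L.finsum_rdistr[symmetric]) auto
      with w(3) t show "(\<Oplus>\<^bsub>L\<^esub>r\<in>{..<n} \<times> {..<n}. y t \<otimes>\<^bsub>L\<^esub> (T (e t) (fst r) (snd r) \<otimes>\<^bsub>L\<^esub> w r))
          = y t \<otimes>\<^bsub>L\<^esub> \<zero>\<^bsub>L\<^esub>" by simp
    qed (use y in auto)
    also have "\<dots> = \<zero>\<^bsub>L\<^esub>" using y by (intro Z.L.add.finprod_one_eqI) auto
    finally show ?thesis .
  qed
  obtain a b where ab: "a < n" "b < n" "w (a, b) \<noteq> \<zero>\<^bsub>L\<^esub>" using w(2) by auto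
  \<comment> \<open>The matrix unit at a position where \<open>w\<close> is nonzero gives the
    contradiction.\<close>
  define U where "U i j = (if i = a \<and> j = b then \<one>\<^bsub>L\<^esub> else \<zero>\<^bsub>L\<^esub>)" for i j
  have "U \<in> carrier MR" using ab by (auto simp: U_def matrix_ring_carrier_iff)
  then have "\<zero>\<^bsub>L\<^esub> = (\<Oplus>\<^bsub>L\<^esub>r\<in>{..<n} \<times> {..<n}. U (fst r) (snd r) \<otimes>\<^bsub>L\<^esub> w r)"
    using kill by simp
  also have "\<dots> = w (a, b)"
    using ab w(1) by (intro Z.L.finsum_delta[where i = "(a, b)"]) (auto simp: U_def)
  finally show False using ab(3) by simp
qed

end

text \<open>On the \<open>\<epsilon>\<close>-eigenspace the adjoint involution relates \<open>G T\<close> to its transpose, so the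
  symmetry of \<open>G\<close> passes to \<open>G T\<close> up to the sign \<open>\<epsilon>\<close>.\<close>

lemma adjoint_eigenspace:
  assumes adj: "adjoint_under D \<sigma> L \<phi> n \<psi> G" and \<epsilon>: "\<epsilon> \<in> {\<one>, \<ominus> \<one>}"
    and x: "x \<in> eigenspace \<epsilon>" and \<delta>: "\<delta> \<in> carrier L"
    and G: "\<And>i j. G j i = \<delta> \<otimes>\<^bsub>L\<^esub> G i j" and ij: "i < n" "j < n"
  shows "(G \<otimes>\<^bsub>MR\<^esub> T x) i j \<otimes>\<^bsub>L\<^esub> \<phi> \<epsilon> = \<delta> \<otimes>\<^bsub>L\<^esub> (G \<otimes>\<^bsub>MR\<^esub> T x) j i"
proof -
  interpret M: monoid MR by (rule Z.L.monoid_matrix_ring)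
  have xD: "x \<in> carrier D" and \<sigma>x: "\<sigma> x = \<epsilon> \<otimes> x" using x by (auto simp: eigenspace_def)
  have \<epsilon>k: "\<epsilon> \<in> k" using sign_in_k \<epsilon> .
  have \<phi>\<epsilon>: "\<phi> \<epsilon> \<in> carrier L" using \<epsilon>k Z.\<phi>.hom_closed by simp
  have GU: "G \<in> Units MR" and adj':
    "\<And>X. X \<in> carrier E \<Longrightarrow> \<psi> (ext_involution (fixed_field D \<sigma>) L \<phi> D \<sigma> X) =
        inv\<^bsub>MR\<^esub> G \<otimes>\<^bsub>MR\<^esub> mat_transpose (\<psi> X) \<otimes>\<^bsub>MR\<^esub> G"
    using adj by (auto simp: adjoint_under_def center_field_eq)
  have GM: "G \<in> carrier MR" using GU by (rule M.Units_closed)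
  have tr: "mat_transpose (T x) \<in> carrier MR"
    using T_closed[OF xD] by (auto simp: matrix_ring_carrier_iff mat_transpose_def)
  have x1: "frag_of (x, \<one>\<^bsub>L\<^esub>) \<in> carrier Z.free" using xD by simp
  have "ext_involution (fixed_field D \<sigma>) L \<phi> D \<sigma> (Z.cls (frag_of (x, \<one>\<^bsub>L\<^esub>))) = Z.cls (frag_of (\<sigma> x, \<one>\<^bsub>L\<^esub>))"
    unfolding ext_involution_def using xD inv_closed inv_add inv_scalar
    by (intro tensor_map_cls_frag Z.scalar_extension_axioms) auto
  then have "T (\<sigma> x) = inv\<^bsub>MR\<^esub> G \<otimes>\<^bsub>MR\<^esub> mat_transpose (T x) \<otimes>\<^bsub>MR\<^esub> G"
    using adj'[OF cls_in_E[OF x1]] by (simp add: T_def)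
  \<comment> \<open>Multiplying by \<open>G\<close> on the left clears its inverse, and \<sigma>
    acts on the eigenspace as \<epsilon>.\<close>
  then have "G \<otimes>\<^bsub>MR\<^esub> T (\<epsilon> \<otimes> x) = G \<otimes>\<^bsub>MR\<^esub> (inv\<^bsub>MR\<^esub> G \<otimes>\<^bsub>MR\<^esub> (mat_transpose (T x) \<otimes>\<^bsub>MR\<^esub> G))"
    using GU GM tr by (simp add: M.m_assoc \<sigma>x del: matrix_ring_simps)
  also have "\<dots> = mat_transpose (T x) \<otimes>\<^bsub>MR\<^esub> G"
    using GU GM tr by (simp add: M.m_assoc[symmetric] del: matrix_ring_simps)
  finally have eq: "G \<otimes>\<^bsub>MR\<^esub> T (\<epsilon> \<otimes> x) = mat_transpose (T x) \<otimes>\<^bsub>MR\<^esub> G" .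
  note cl = Z.L.matrix_entry_closed[OF GM] T_entry_closed[OF xD] \<phi>\<epsilon> \<delta>
  have "(G \<otimes>\<^bsub>MR\<^esub> T x) i j \<otimes>\<^bsub>L\<^esub> \<phi> \<epsilon> = (\<Oplus>\<^bsub>L\<^esub>l\<in>{..<n}. G i l \<otimes>\<^bsub>L\<^esub> (T x l j \<otimes>\<^bsub>L\<^esub> \<phi> \<epsilon>))"
    using cl unfolding matrix_ring_simps
    by (subst Z.L.finsum_ldistr) (auto simp: Z.L.m_assoc intro!: Z.L.finsum_cong')
  also have "\<dots> = (G \<otimes>\<^bsub>MR\<^esub> T (\<epsilon> \<otimes> x)) i j"
    using cl xD \<epsilon>k ij unfolding matrix_ring_simps
    by (intro Z.L.finsum_cong') (auto simp: T_scale T_entry_closed K_closed)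
  \<comment> \<open>Entry \<open>(l, j)\<close> of \<open>G\<close> is rewritten as \<delta> times
    entry \<open>(j, l)\<close>, so that the product reappears with \<open>i\<close> and
    \<open>j\<close> exchanged.\<close>
  also have "\<dots> = (\<Oplus>\<^bsub>L\<^esub>l\<in>{..<n}. T x l i \<otimes>\<^bsub>L\<^esub> (\<delta> \<otimes>\<^bsub>L\<^esub> G j l))"
    unfolding eq matrix_ring_simps mat_transpose_def
    by (intro Z.L.finsum_cong' refl) (use cl G[of _ j] in auto)
  also have "\<dots> = \<delta> \<otimes>\<^bsub>L\<^esub> (G \<otimes>\<^bsub>MR\<^esub> T x) j i"
    using cl unfolding matrix_ring_simps
    by (subst Z.L.finsum_rdistr) (auto simp: Z.L.m_ac intro!: Z.L.finsum_cong')
  finally show ?thesis .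
qed

text \<open>By \<open>adjoint_eigenspace\<close>, multiplying the independent matrices
  \<open>T (e t)\<close> by \<open>G\<close> gives symmetric matrices if the sign \<delta> of
  \<open>G\<close> is \<epsilon>, and skew-symmetric ones if it is minus \<epsilon>.\<close>

lemma eigenspace_dim_le:
  assumes adj: "adjoint_under D \<sigma> L \<phi> n \<psi> G" and \<epsilon>: "\<epsilon> \<in> {\<one>, \<ominus> \<one>}"
    and ec: "eigen_coordinates \<epsilon> m p e c"
    and G: "\<And>i j. G j i = \<phi> \<delta> \<otimes>\<^bsub>L\<^esub> G i j"
  shows "\<delta> = \<epsilon> \<Longrightarrow> 2 * p \<le> n * (n + 1)" and "\<delta> = \<ominus> \<epsilon> \<Longrightarrow> 2 * p \<le> n * (n - 1)"
proof -
  have cs: "coordinate_system k m e c" and pm: "p \<le> m" and et: "\<And>t. t < p \<Longrightarrow> e t \<in> eigenspace \<epsilon>"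
    using ec by (auto simp: eigen_coordinates_def)
  have eD: "e t \<in> carrier D" if "t < p" for t using et[OF that] by (simp add: eigenspace_def)
  have \<epsilon>k: "\<epsilon> \<in> k" "\<ominus> \<epsilon> \<in> k" using sign_in_k[OF \<epsilon>] uminus_in_k by auto
  have \<phi>\<epsilon>: "\<phi> \<epsilon> \<in> carrier L" using \<epsilon>k Z.\<phi>.hom_closed by simp
  have \<phi>m: "\<phi> (\<ominus> \<epsilon>) = \<ominus>\<^bsub>L\<^esub> \<phi> \<epsilon>" by (rule extension_minus[OF ext \<epsilon>k(1)])
  have sq: "\<phi> \<epsilon> \<otimes>\<^bsub>L\<^esub> (\<phi> \<epsilon> \<otimes>\<^bsub>L\<^esub> y) = y" if "y \<in> carrier L" for y
  proof -
    have "\<phi> \<epsilon> \<otimes>\<^bsub>L\<^esub> \<phi> \<epsilon> = \<one>\<^bsub>L\<^esub>"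
      using Z.\<phi>.hom_mult[of \<epsilon> \<epsilon>] \<epsilon>k sign_square[OF \<epsilon>] Z.\<phi>.hom_one by simp
    then show ?thesis using that \<phi>\<epsilon> by (simp add: Z.L.m_assoc[symmetric])
  qed
  have GU: "G \<in> Units MR" using adj by (simp add: adjoint_under_def)
  interpret M: monoid MR by (rule Z.L.monoid_matrix_ring)
  let ?S = "\<lambda>t. G \<otimes>\<^bsub>MR\<^esub> T (e t)"
  have S: "?S t i j \<in> carrier L" if "t < p" for t i j
    by (rule Z.L.matrix_entry_closed[OF M.m_closed[OF M.Units_closed[OF GU] T_closed[OF eD[OF that]]]])
  show "2 * p \<le> n * (n + 1)" if \<delta>: "\<delta> = \<epsilon>"
  proof (rule symmetric_family_card_le[where T = "\<lambda>t. T (e t)", OF Z.L.field_axioms GU])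
    fix t i j assume t: "t < p" and ij: "i < n" "j < n"
    have "?S t i j \<otimes>\<^bsub>L\<^esub> \<phi> \<epsilon> = \<phi> \<epsilon> \<otimes>\<^bsub>L\<^esub> ?S t j i"
      using adjoint_eigenspace[OF adj \<epsilon> et[OF t] \<phi>\<epsilon> _ ij] G \<delta> by blast
    \<comment> \<open>Multiplication by \<phi> \<epsilon>, whose square is 1, so that the sign
      cancels on both sides.\<close>
    then have "\<phi> \<epsilon> \<otimes>\<^bsub>L\<^esub> (\<phi> \<epsilon> \<otimes>\<^bsub>L\<^esub> ?S t i j) = \<phi> \<epsilon> \<otimes>\<^bsub>L\<^esub> (\<phi> \<epsilon> \<otimes>\<^bsub>L\<^esub> ?S t j i)"
      using Z.L.m_comm[OF S[OF t] \<phi>\<epsilon>] by simp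
    then show "?S t j i = ?S t i j" using sq[OF S[OF t]] by simp
  qed (use T_closed eD T_basis_independent[OF cs pm] in auto)
  show "2 * p \<le> n * (n - 1)" if \<delta>: "\<delta> = \<ominus> \<epsilon>"
  proof (rule skew_family_card_le[where T = "\<lambda>t. T (e t)", OF Z.L.field_axioms GU])
    fix t i j assume t: "t < p" and ij: "i < n" "j < n"
    have "?S t i j \<otimes>\<^bsub>L\<^esub> \<phi> \<epsilon> = \<phi> \<delta> \<otimes>\<^bsub>L\<^esub> ?S t j i"
      by (rule adjoint_eigenspace[OF adj \<epsilon> et[OF t] _ G ij]) (simp add: \<delta> \<phi>m \<phi>\<epsilon>)
    then have "\<phi> \<epsilon> \<otimes>\<^bsub>L\<^esub> (\<phi> \<epsilon> \<otimes>\<^bsub>L\<^esub> ?S t i j) = \<phi> \<epsilon> \<otimes>\<^bsub>L\<^esub> (\<phi> \<epsilon> \<otimes>\<^bsub>L\<^esub> (\<ominus>\<^bsub>L\<^esub> ?S t j i))"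
      using Z.L.m_comm[OF S[OF t] \<phi>\<epsilon>] S[OF t] \<phi>\<epsilon> \<delta> \<phi>m
      by (simp add: Z.L.l_minus Z.L.r_minus del: matrix_ring_simps)
    then have "?S t i j = \<ominus>\<^bsub>L\<^esub> ?S t j i"
      using sq S[OF t] by (simp del: matrix_ring_simps)
    then show "?S t j i = \<ominus>\<^bsub>L\<^esub> ?S t i j"
      using S[OF t] by (simp add: Z.L.minus_minus del: matrix_ring_simps)
  qed (use T_closed eD T_basis_independent[OF cs pm] extension_double_eq_zero[OF ext] in auto)
qed

end

section \<open>Bounds for the hermitian u-invariants\<close>

text \<open>Natural numbers below the real \<open>b\<close> are below its floor, so the supremum has
  a finite bound in \<open>enat\<close>; \<open>0 \<le> b\<close> makes the floor a natural number
  and covers the empty set, whose supremum is 0.\<close>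

lemma Sup_enat_le:
  assumes "\<And>n. enat n \<in> S \<Longrightarrow> real n \<le> b" and "\<infinity> \<notin> S" and "0 \<le> b"
  shows "ereal_of_enat (Sup S) \<le> ereal b"
proof -
  have "x \<le> enat (nat \<lfloor>b\<rfloor>)" if "x \<in> S" for x
  proof (cases x)
    case (enat n)
    then show ?thesis using assms(1)[of n] that by (simp add: le_nat_floor)
  qed (use that assms(2) in auto)
  then have "Sup S \<le> enat (nat \<lfloor>b\<rfloor>)" by (rule Sup_least)
  then have "ereal_of_enat (Sup S) \<le> ereal_of_enat (enat (nat \<lfloor>b\<rfloor>))"
    by (simp only: ereal_of_enat_le_iff)
  also have "\<dots> \<le> ereal b" using assms(3) by (simp add: of_nat_floor)
  finally show ?thesis .
qed

text \<open>Serves the outer suprema over the admissible signs \<epsilon>.\<close>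

lemma ereal_of_enat_Sup_le:
  assumes "\<And>x. x \<in> S \<Longrightarrow> ereal_of_enat x \<le> ereal b" and "0 \<le> b"
  shows "ereal_of_enat (Sup S) \<le> ereal b"
  using assms by (intro Sup_enat_le) (use assms(1)[of "enat _"] assms(1)[of \<infinity>] in auto)

text \<open>The exponent is an integer because \<open>i = 0\<close> gives 1/2.\<close>

lemma two_powi_pred: "2 powi (int i - 1) = (2 ^ i / 2 :: real)"
  by (simp add: power_int_diff)

context division_involution
begin

text \<open>Here \<open>m\<close> and \<open>p\<close> are the dimensions over \<open>k\<close> of \<open>D\<close> and of the eigenspace that contains
  all values \<open>h x x\<close>.\<close>

lemma u_inv_le:
  assumes "A_field i 2 (fixed_field D \<sigma>)" "springer_property D \<sigma>" "0 < m"
    and ec: "eigen_coordinates \<epsilon> m p e c" and pb: "real p * 2 ^ i \<le> b * real m"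
  shows "ereal_of_enat (u_inv D \<sigma> \<epsilon>) \<le> ereal b"
  unfolding u_inv_def
proof (rule Sup_enat_le)
  have "0 \<le> b * real m" using pb by (meson order_trans mult_nonneg_nonneg of_nat_0_le_iff zero_le_power zero_le_numeral)
  then show "0 \<le> b" using assms(3) by (simp add: zero_le_mult_iff)
  fix n
  assume "enat n \<in> {enat n | n. \<exists>(V :: ('a, 'a list) module) h.
            hermitian_space D \<sigma> \<epsilon> V h \<and> anisotropic D V h \<and> right_dimension D V n}"
  then obtain V :: "('a, 'a list) module" and h where
    "hermitian_space D \<sigma> \<epsilon> V h" "anisotropic D V h" "right_dimension D V n" by auto
  from anisotropic_rank_le[OF assms(1,2) this ec] have "real (n * m) \<le> real (p * 2 ^ i)"
    by (simp only: of_nat_le_iff)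
  then have "real n * real m \<le> b * real m" using pb by simp
  then show "real n \<le> b" using assms(3) by simp
qed auto

text \<open>From \<open>2 * p \<le> b * m\<close> it follows that p 2^i / m is at most b 2^(i-1).
  The bound is asked for every suitable basis, since the one in use comes out of an existence
  statement.\<close>

lemma u_inv_le_dim:
  assumes A: "A_field i 2 (fixed_field D \<sigma>)" and S: "springer_property D \<sigma>" and m: "0 < m"
    and dim: "dimension m k (carrier D)" and \<epsilon>: "\<epsilon> \<in> {\<one>, \<ominus> \<one>}"
    and bound: "\<And>p e c. eigen_coordinates \<epsilon> m p e c \<Longrightarrow> (\<not> first_kind D \<sigma> \<Longrightarrow> 2 * p \<le> m) \<Longrightarrow>
                  2 * real p \<le> b * real m"
  shows "ereal_of_enat (u_inv D \<sigma> \<epsilon>) \<le> ereal (b * 2 powi (int i - 1))"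
proof -
  obtain p e c where ec: "eigen_coordinates \<epsilon> m p e c" "\<not> first_kind D \<sigma> \<Longrightarrow> 2 * p \<le> m"
    using eigen_coordinates_exist[OF \<epsilon> dim] by blast
  have "2 * real p * (2 ^ i / 2) \<le> b * real m * (2 ^ i / 2)"
    using bound[OF ec(1)] ec(2) by (intro mult_right_mono) auto
  then show ?thesis
    by (intro u_inv_le[OF A S m ec(1)]) (simp add: two_powi_pred mult_ac)
qed

text \<open>\<delta> records the sign of \<open>G\<close> as an element of \<open>D\<close>. Since
  \<open>n \<le> d\<close>, the triangular numbers for \<open>n\<close> are at most those for
  \<open>d\<close>, and d (d + 1) = (1 + 1/d) d^2, likewise with minus.\<close>

lemma adjoint_dim_le:
  assumes first: "first_kind D \<sigma>" and split: "splitting D L \<phi> n \<psi>"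
    and adj: "adjoint_under D \<sigma> L \<phi> n \<psi> G" and d: "0 < d" and \<epsilon>: "\<epsilon> \<in> {\<one>, \<ominus> \<one>}"
    and ec: "eigen_coordinates \<epsilon> (d ^ 2) p e c"
    and sym: "mat_transpose G = G \<and> \<delta> = \<one> \<or> mat_transpose G = (\<lambda>i j. \<ominus>\<^bsub>L\<^esub> G i j) \<and> \<delta> = \<ominus> \<one>"
  shows "\<delta> = \<epsilon> \<Longrightarrow> 2 * real p \<le> (1 + 1 / real d) * real (d ^ 2)"
    and "\<delta> = \<ominus> \<epsilon> \<Longrightarrow> 2 * real p \<le> (1 - 1 / real d) * real (d ^ 2)"
proof -
  interpret split_involution D \<sigma> L \<phi> n \<psi> by unfold_locales (fact first split)+
  have GM: "G i j \<in> carrier L" for i j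
    using adj monoid.Units_closed[OF Z.L.monoid_matrix_ring] Z.L.matrix_entry_closed
    unfolding adjoint_under_def by blast
  have \<phi>1: "\<phi> \<one> = \<one>\<^bsub>L\<^esub>" using Z.\<phi>.hom_one by simp
  then have \<phi>m1: "\<phi> (\<ominus> \<one>) = \<ominus>\<^bsub>L\<^esub> \<one>\<^bsub>L\<^esub>" using extension_minus[OF ext one_in_k] by simp
  have G: "G j i = \<phi> \<delta> \<otimes>\<^bsub>L\<^esub> G i j" for i j
    using sym
  proof (elim disjE conjE)
    assume "mat_transpose G = G" "\<delta> = \<one>"
    moreover from this(1) have "G j i = G i j" by (metis mat_transpose_def)
    ultimately show ?thesis using GM \<phi>1 by simp
  next
    assume "mat_transpose G = (\<lambda>i j. \<ominus>\<^bsub>L\<^esub> G i j)" "\<delta> = \<ominus> \<one>"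
    moreover from this(1) have "G j i = \<ominus>\<^bsub>L\<^esub> G i j" by (metis mat_transpose_def)
    ultimately show ?thesis using GM \<phi>m1 by (simp add: Z.L.l_minus)
  qed
  have "n * n \<le> d ^ 2"
    using ec by (intro square_le_dim) (auto simp: eigen_coordinates_def)
  then have n: "n \<le> d" by (simp add: power2_eq_square power2_nat_le_eq_le[unfolded power2_eq_square])
  show "2 * real p \<le> (1 + 1 / real d) * real (d ^ 2)" if "\<delta> = \<epsilon>"
  proof -
    have "2 * p \<le> n * (n + 1)" by (rule eigenspace_dim_le(1)[OF adj \<epsilon> ec G that])
    also have "\<dots> \<le> d * (d + 1)" using n by (intro mult_mono) auto
    finally have "real (2 * p) \<le> real (d * (d + 1))" by (simp only: of_nat_le_iff)
    moreover have "(1 + 1 / real d) * real (d ^ 2) = real (d * (d + 1))"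
      using d by (simp add: field_simps power2_eq_square)
    ultimately show ?thesis by simp
  qed
  show "2 * real p \<le> (1 - 1 / real d) * real (d ^ 2)" if "\<delta> = \<ominus> \<epsilon>"
  proof -
    have "2 * p \<le> n * (n - 1)" by (rule eigenspace_dim_le(2)[OF adj \<epsilon> ec G that])
    also have "\<dots> \<le> d * (d - 1)" using n by (intro mult_mono) auto
    finally have "real (2 * p) \<le> real (d * (d - 1))" by (simp only: of_nat_le_iff)
    moreover have "(1 - 1 / real d) * real (d ^ 2) = real (d * (d - 1))"
      using d by (simp add: field_simps power2_eq_square of_nat_diff)
    ultimately show ?thesis by simp
  qed
qed

end

theorem theorem1p1:
  fixes D :: "('d, 'm) ring_scheme" and \<sigma> :: "'d \<Rightarrow> 'd" and d i :: nat
  assumes "division_algebra D d"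
    and "involution D \<sigma>"
    and "\<one>\<^bsub>fixed_field D \<sigma>\<^esub> \<oplus>\<^bsub>fixed_field D \<sigma>\<^esub> \<one>\<^bsub>fixed_field D \<sigma>\<^esub> \<noteq> \<zero>\<^bsub>fixed_field D \<sigma>\<^esub>"
    and "A_field i 2 (fixed_field D \<sigma>)"
    and "springer_property D \<sigma>"
  shows "(first_kind D \<sigma> \<longrightarrow>
            ereal_of_enat (u_plus D \<sigma>) \<le> ereal ((1 + 1 / real d) * 2 powi (int i - 1)) \<and>
            ereal_of_enat (u_minus D \<sigma>) \<le> ereal ((1 - 1 / real d) * 2 powi (int i - 1))) \<and>
         (second_kind D \<sigma> \<longrightarrow>
            ereal_of_enat (u_zero D \<sigma>) \<le> ereal (2 powi (int i - 1)))"
proof -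
  interpret involution D \<sigma> by fact
  interpret division_involution D \<sigma>
  proof (intro division_involution.intro division_involution_axioms.intro)
    show "involution D \<sigma>" by fact
    show "Units D = carrier D - {\<zero>\<^bsub>D\<^esub>}" using assms(1) by (simp add: division_algebra_def)
    show "\<one>\<^bsub>D\<^esub> \<oplus>\<^bsub>D\<^esub> \<one>\<^bsub>D\<^esub> \<noteq> \<zero>\<^bsub>D\<^esub>" using assms(3) by (simp add: fixed_field_def)
    show "field (fixed_field D \<sigma>)" using assms(4) by (simp add: A_field_def)
  qed
  note A = assms(4) and S = assms(5)
  have dimK: "dimension (d ^ 2) K (carrier D)"
    using assms(1) by (simp add: division_algebra_def)
  have d: "0 < d"
  proof (rule ccontr)
    assume "\<not> 0 < d"
    then have "carrier D = {\<zero>\<^bsub>D\<^esub>}" using dimK dimension_zero[OF subfield_K, of "carrier D"] by simp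
    then show False using one_not_zero one_closed by blast
  qed
  then have d2: "0 < d ^ 2" by simp
  \<comment> \<open>The bounds have to be nonnegative for \<open>ereal_of_enat_Sup_le\<close>; for
    \<open>d = 1\<close> the second one is exactly 0.\<close>
  have "1 / real d \<le> 1" using d by simp
  then have nonneg: "0 \<le> (1 + 1 / real d) * 2 powi (int i - 1)" "0 \<le> (1 - 1 / real d) * 2 powi (int i - 1)"
    by auto
  have first: "ereal_of_enat (u_plus D \<sigma>) \<le> ereal ((1 + 1 / real d) * 2 powi (int i - 1)) \<and>
    ereal_of_enat (u_minus D \<sigma>) \<le> ereal ((1 - 1 / real d) * 2 powi (int i - 1))" if fk: "first_kind D \<sigma>"
  proof -
    have "K = k" using fk by (auto simp: first_kind_def)
    then have dim: "dimension (d ^ 2) k (carrier D)" using dimK by simp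
    \<comment> \<open>In \<open>u_plus\<close> the sign of \<open>G\<close> agrees with \<epsilon>:
      a symmetric \<open>G\<close> goes with 1, an alternating one with -1.\<close>
    have orth: "ereal_of_enat (u_inv D \<sigma> \<epsilon>) \<le> ereal ((1 + 1 / real d) * 2 powi (int i - 1))"
      if "\<epsilon> = \<one>\<^bsub>D\<^esub> \<and> orthogonal_inv D \<sigma> \<or> \<epsilon> = \<ominus>\<^bsub>D\<^esub> \<one>\<^bsub>D\<^esub> \<and> symplectic_inv D \<sigma>" for \<epsilon>
    proof -
      from that obtain L \<phi> n \<psi> G where sp: "splitting D L \<phi> n \<psi>" "adjoint_under D \<sigma> L \<phi> n \<psi> G"
        "mat_transpose G = G \<and> \<epsilon> = \<one>\<^bsub>D\<^esub> \<or> mat_transpose G = (\<lambda>i j. \<ominus>\<^bsub>L\<^esub> G i j) \<and> \<epsilon> = \<ominus>\<^bsub>D\<^esub> \<one>\<^bsub>D\<^esub>"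
        unfolding orthogonal_inv_def symplectic_inv_def by metis
      have \<epsilon>: "\<epsilon> \<in> {\<one>\<^bsub>D\<^esub>, \<ominus>\<^bsub>D\<^esub> \<one>\<^bsub>D\<^esub>}" using that by auto
      show ?thesis
        by (rule u_inv_le_dim[OF A S d2 dim \<epsilon>]) (rule adjoint_dim_le(1)[OF fk sp(1,2) d \<epsilon> _ sp(3) refl])
    qed
    have sympl: "ereal_of_enat (u_inv D \<sigma> \<epsilon>) \<le> ereal ((1 - 1 / real d) * 2 powi (int i - 1))"
      if "\<epsilon> = \<ominus>\<^bsub>D\<^esub> \<one>\<^bsub>D\<^esub> \<and> orthogonal_inv D \<sigma> \<or> \<epsilon> = \<one>\<^bsub>D\<^esub> \<and> symplectic_inv D \<sigma>" for \<epsilon>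
    proof -
      have \<epsilon>: "\<epsilon> \<in> {\<one>\<^bsub>D\<^esub>, \<ominus>\<^bsub>D\<^esub> \<one>\<^bsub>D\<^esub>}" using that by auto
      \<comment> \<open>In \<open>u_minus\<close> the sign of \<open>G\<close> is opposite to
        \<epsilon>, so the conditions are rewritten in terms of minus \<epsilon>.\<close>
      from that have "orthogonal_inv D \<sigma> \<and> \<ominus>\<^bsub>D\<^esub> \<epsilon> = \<one>\<^bsub>D\<^esub> \<or> symplectic_inv D \<sigma> \<and> \<ominus>\<^bsub>D\<^esub> \<epsilon> = \<ominus>\<^bsub>D\<^esub> \<one>\<^bsub>D\<^esub>"
        by (auto simp: minus_minus)
      then obtain L \<phi> n \<psi> G where sp: "splitting D L \<phi> n \<psi>" "adjoint_under D \<sigma> L \<phi> n \<psi> G"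
        "mat_transpose G = G \<and> \<ominus>\<^bsub>D\<^esub> \<epsilon> = \<one>\<^bsub>D\<^esub> \<or> mat_transpose G = (\<lambda>i j. \<ominus>\<^bsub>L\<^esub> G i j) \<and> \<ominus>\<^bsub>D\<^esub> \<epsilon> = \<ominus>\<^bsub>D\<^esub> \<one>\<^bsub>D\<^esub>"
        unfolding orthogonal_inv_def symplectic_inv_def by metis
      show ?thesis
        by (rule u_inv_le_dim[OF A S d2 dim \<epsilon>]) (rule adjoint_dim_le(2)[OF fk sp(1,2) d \<epsilon> _ sp(3) refl])
    qed
    show ?thesis
      unfolding u_plus_def u_minus_def
      using orth sympl nonneg by (intro conjI ereal_of_enat_Sup_le) blast+
  qed
  have second: "ereal_of_enat (u_zero D \<sigma>) \<le> ereal (2 powi (int i - 1))" if sk: "second_kind D \<sigma>"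
  proof -
    have dim2: "dimension 2 k K" using sk by (simp add: second_kind_def)
    \<comment> \<open>Tower law with [K : k] = 2 and [D : K] = d^2.\<close>
    have dim: "dimension (2 * d ^ 2) k (carrier D)"
      by (rule telescopic_base[OF subfield_k subfield_K dim2 dimK])
    have nf: "\<not> first_kind D \<sigma>"
    proof
      assume "first_kind D \<sigma>"
      then have "K = k" by (auto simp: first_kind_def)
      \<comment> \<open>If \<open>K\<close> were \<open>k\<close>, the dimension of \<open>K\<close>
        over \<open>k\<close> would be both 2 and 1.\<close>
      then have "(2 :: nat) = 1"
        using dim2 dimension_one[OF subfield_k] by (intro dimension_is_inj[OF subfield_k, of _ k]) simp_all
      then show False by simp
    qed
    \<comment> \<open>The eigenspace has at most half of the dimension \<open>m = 2 * d ^ 2\<close>,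
      so \<open>2 * p \<le> 1 * m\<close> and the factor is 1.\<close>
    have "ereal_of_enat (u_inv D \<sigma> \<epsilon>) \<le> ereal (1 * 2 powi (int i - 1))"
      if \<epsilon>: "\<epsilon> \<in> {\<one>\<^bsub>D\<^esub>, \<ominus>\<^bsub>D\<^esub> \<one>\<^bsub>D\<^esub>}" for \<epsilon>
    proof (rule u_inv_le_dim[OF A S _ dim \<epsilon>])
      fix p assume p: "\<not> first_kind D \<sigma> \<Longrightarrow> 2 * p \<le> 2 * d ^ 2"
      have "real (2 * p) \<le> real (2 * d ^ 2)" using p[OF nf] by (simp only: of_nat_le_iff)
      then show "2 * real p \<le> 1 * real (2 * d ^ 2)" by simp
    qed (use d in simp)
    then show ?thesis
      unfolding u_zero_def by (intro ereal_of_enat_Sup_le) auto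
  qed
  show ?thesis using first second by blast
qed

end
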